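(* Let $G(\lambda)=P(\lambda)+C(\lambda E-A)^{-1}B\in\mathbb{C}(\lambda)^{n\times n}$ with $P(\lambda)=\sum_{i=0}^m\lambda^iA_i$ an $n\times n$ matrix polynomial of degree $m\ge2$, $A,E\in\mathbb{C}^{r\times r}$, $E$ nonsingular, $C\in\mathbb{C}^{n\times r}$, $B\in\mathbb{C}^{r\times n}$. Let $$\mathbb{L}(\lambda)=\left[\begin{array}{c|c}L(\lambda)&e_{m-i_0(\sigma_1,\sigma)}\otimes C\\ \hline e_{m-c_0(\sigma,\sigma_2)}^T\otimes B&A-\lambda E\end{array}\right]$$ be an EGFP of $G(\lambda)$, where $L(\lambda)=M_{\tau_1}(Y_1)M_{\sigma_1}(X_1)(\lambda M^P_\tau-M^P_\sigma)M_{\sigma_2}(X_2)M_{\tau_2}(Y_2)$ is an EGFP of $P(\lambda)$ with $0\in\sigma$ and $-m\in\tau$. Then $\mathbb{L}(\lambda)$ is a Rosenbrock strong linearization of $G(\lambda)$.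
   Context: Notation: $\{0:m\}=\{0,1,\dots,m\}$, $-\{0:m\}=\{-m,\dots,-1,-0\}$, where $-0$ is a formal index different from $0$ (the successor of $-1$). $e_j$ is the $j$-th column of $I_m$; $\otimes$ is the Kronecker product. Index tuples: an index tuple is a finite, possibly empty, tuple of indices. $(\alpha,\beta)$ denotes concatenation and $-\alpha$ negates all entries. A subtuple is obtained by deleting some (possibly no) entries. A tuple $(i_1,\dots,i_t)$ satisfies the Successor Infix Property (SIP) if whenever $a<b$ and $i_a=i_b$ there is $c$ with $a<c<b$ and $i_c=i_a+1$ (for tuples from $-\{0:m\}$ this is understood after shifting by $m$, so $-0$ is the successor of $-1$). For a tuple $\alpha$ with indices from $\{0:m\}$ and $t\in\alpha$, $c_t(\alpha)=p$ (consecutions at $t$) if $(t,t+1,\dots,t+p)$ is a subtuple of $\alpha$ but $(t,\dots,t+p+1)$ is not; $i_t(\alpha)=q$ (inversions at $t$) if $(t+q,\dots,t+1,t)$ is a subtuple of $\alpha$ but $(t+q+1,t+q,\dots,t)$ is not. If $t\notin\alpha$, $c_t(\alpha)=i_t(\alpha)=-1$. Elementary matrices (of size $mn\times mn$): for $X\in\mathbb{C}^{n\times n}$, $M_0(X)=\mathrm{diag}(I_{(m-1)n},X)$, $M_{-m}(X)=\mathrm{diag}(X,I_{(m-1)n})$, and for $i=1,\dots,m-1$ $$M_i(X)=\mathrm{diag}\Big(I_{(m-i-1)n},\begin{bmatrix}X & I_n \\ I_n & 0\end{bmatrix},I_{(i-1)n}\Big),\quad M_{-i}(X)=\mathrm{diag}\Big(I_{(m-i-1)n},\begin{bmatrix}0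 & I_n \\ I_n & X\end{bmatrix},I_{(i-1)n}\Big).$$ $M_i^P=M_i(-A_i)$ for $0\le i\le m-1$, $M_{-i}^P=M_{-i}(A_i)$ for $1\le i\le m$; also $M_{-0}^P=(M_0^P)^{-1}$ and $M_m^P=(M_{-m}^P)^{-1}$ when these inverses exist (these two do not occur when $0\in\sigma$ and $-m\in\tau$). For a tuple $\mathbf t=(t_1,\dots,t_k)$, $M_{\mathbf t}^P=M_{t_1}^P\cdots M_{t_k}^P$; a matrix assignment for $\mathbf t$ is a tuple $X=(X_1,\dots,X_k)$ of $n\times n$ complex matrices, and $M_{\mathbf t}(X)=M_{t_1}(X_1)\cdots M_{t_k}(X_k)$. Empty products equal $I_{mn}$. An assignment is nonsingular if the matrices assigned to positions occupied by indices $\pm0,\pm m$ are nonsingular. EGFP (extended generalized Fiedler pencil) of $P$: let $(\sigma,\omega)$ be a permutation of $\{0:m\}$ and $\tau=-\omega$. Let $\sigma_1,\sigma_2$ be index tuples with indices from $\sigma\setminus\{m-1,m\}$ such that $(\sigma_1,\sigma,\sigma_2)$ satisfies the SIP, and $\tau_1,\tau_2$ index tuples with indices from $\tau\setminus\{-1,-0\}$ such that $(\tau_1,\tau,\tau_2)$ satisfies the SIP. Let $X_1,X_2,Y_1,Y_2$ be arbitrary nonsingular matrix assignments for $\sigma_1,\sigma_2,\tau_1,\tau_2$, respectively. Then $L(\lambda)=M_{\tau_1}(Y_1)M_{\sigma_1}(X_1)(\lambda M^P_\tau-M^P_\sigma)M_{\sigma_2}(X_2)M_{\tau_2}(Y_2)$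 is an EGFP of $P(\lambda)$. If $0\in\sigma$ and $-m\in\tau$, the pencil $\mathbb{L}(\lambda)$ displayed in the claim is called an EGFP of $G(\lambda)$. System matrix of $G(\lambda)$: $\mathcal S(\lambda)=\left[\begin{array}{c|c}P(\lambda)&C\\ \hline B&A-\lambda E\end{array}\right]$. A system matrix $\left[\begin{array}{c|c}\mathcal P(\lambda)&\mathcal C\\ \hline\mathcal B&H-\lambda K\end{array}\right]$ with $H-\lambda K$ of size $r\times r$ and $K$ nonsingular is irreducible if $\mathrm{rank}[\mathcal B\ \ H-\lambda K]=r=\mathrm{rank}\,[\mathcal C^T\ \ (H-\lambda K)^T]^T$ for all $\lambda\in\mathbb{C}$. A square matrix polynomial is unimodular if its determinant is a nonzero constant. A square rational matrix $F(\lambda)$ is proper if it tends to a finite matrix $F(\infty)$ as $\lambda\to\infty$, and biproper if moreover $F(\infty)$ is nonsingular. Rosenbrock strong linearization: an $(mn+r)\times(mn+r)$ irreducible system matrix $\mathbb{L}(\lambda)=\left[\begin{array}{c|c}\mathcal X-\lambda\mathcal Y&\mathcal C\\ \hline\mathcal B&H-\lambda K\end{array}\right]$, with $H-\lambda K$ an $r\times r$ pencil, $K$ nonsingular, is a Rosenbrock strong linearization of $G(\lambda)$ if: (a) there are $mn\times mn$ unimodular matrix polynomials $U(\lambda),V(\lambda)$ and $r\times r$ nonsingular matrices $U_0,V_0$ with $\mathrm{diag}(U(\lambda),U_0)\,\mathbb{L}(\lambda)\,\mathrm{diag}(V(\lambda),V_0)=\mathrm{diag}(I_{(m-1)n},\mathcal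 S(\lambda))$; and (b) there are $mn\times mn$ biproper rational matrices $\mathcal O_\ell(\lambda),\mathcal O_r(\lambda)$ with $\mathcal O_\ell(\lambda)\,\lambda^{-1}\mathbb{G}(\lambda)\,\mathcal O_r(\lambda)=\mathrm{diag}(I_{(m-1)n},\lambda^{-m}G(\lambda))$, where $\mathbb{G}(\lambda)=\mathcal X-\lambda\mathcal Y+\mathcal C(\lambda K-H)^{-1}\mathcal B$.
   Formalization: The system matrix S(λ) of G(λ) is additionally assumed irreducible; without this the claim fails (e.g. B=0, C=0, r≥1), since a Rosenbrock strong linearization must itself be an irreducible system matrix. *)

theory Defs
  imports
    Complex_Main
    "HOL-Library.Sublist"
    "HOL-Computational_Algebra.Computational_Algebra"
    "HOL-Computational_Algebra.Field_as_Ring"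
    "Jordan_Normal_Form.DL_Rank"
    "Jordan_Normal_Form.Gauss_Jordan_Elimination"
begin

section \<open>Index tuples\<close>

text \<open>The indices \<open>0, \<dots>, m\<close> are \<open>PosI i\<close> and the indices \<open>-m, \<dots>, -1, -0\<close> are
  \<open>NegI i\<close>; in particular \<open>NegI 0\<close> is the formal index \<open>-0\<close>, different from \<open>PosI 0\<close>.\<close>

datatype index = PosI nat | NegI nat

fun neg_index :: "index \<Rightarrow> index" where
  "neg_index (PosI i) = NegI i"
| "neg_index (NegI i) = PosI i"

text \<open>\<open>is_succ_index s t\<close>: \<open>s\<close> is the successor of \<open>t\<close>. The index \<open>-0\<close> succeeds \<open>-1\<close> and has
  itself no successor, which is the order that \<open>-{0:m}\<close> inherits from \<open>{0:m}\<close> when shifted by \<open>m\<close>.\<close>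

fun is_succ_index :: "index \<Rightarrow> index \<Rightarrow> bool" where
  "is_succ_index s (PosI i) \<longleftrightarrow> s = PosI (Suc i)"
| "is_succ_index s (NegI (Suc i)) \<longleftrightarrow> s = NegI i"
| "is_succ_index s (NegI 0) \<longleftrightarrow> False"

definition SIP :: "index list \<Rightarrow> bool" where
  "SIP \<alpha> \<longleftrightarrow> (\<forall>a b. a < b \<and> b < length \<alpha> \<and> \<alpha> ! a = \<alpha> ! b \<longrightarrow>
     (\<exists>c. a < c \<and> c < b \<and> is_succ_index (\<alpha> ! c) (\<alpha> ! a)))"

definition consecutions :: "nat \<Rightarrow> index list \<Rightarrow> int" where
  "consecutions t \<alpha> =
     (if PosI t \<in> set \<alpha>
      then int (THE p. subseq (map PosI [t..<t + p + 1]) \<alpha>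
                     \<and> \<not> subseq (map PosI [t..<t + p + 2]) \<alpha>)
      else -1)"

definition inversions :: "nat \<Rightarrow> index list \<Rightarrow> int" where
  "inversions t \<alpha> =
     (if PosI t \<in> set \<alpha>
      then int (THE q. subseq (map PosI (rev [t..<t + q + 1])) \<alpha>
                     \<and> \<not> subseq (map PosI (rev [t..<t + q + 2])) \<alpha>)
      else -1)"

section \<open>Constant, polynomial and rational matrices\<close>

abbreviation inv_mat :: "'a :: field mat \<Rightarrow> 'a mat" where
  "inv_mat M \<equiv> the (mat_inverse M)"

definition kronecker :: "'a :: times mat \<Rightarrow> 'a mat \<Rightarrow> 'a mat" where
  "kronecker M N = mat (dim_row M * dim_row N) (dim_col M * dim_col N)
     (\<lambda>(i, j). M $$ (i div dim_row N, j div dim_col N) * N $$ (i mod dim_row N, j mod dim_col N))"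

text \<open>The \<open>j\<close>-th column of the identity as an \<open>m \<times> 1\<close> matrix, with \<open>j\<close> counted from 1.\<close>

definition unit_col :: "nat \<Rightarrow> nat \<Rightarrow> complex mat" where
  "unit_col m j = mat_of_cols m [unit_vec m (j - 1)]"

abbreviation diag2 :: "'a :: zero mat \<Rightarrow> 'a mat \<Rightarrow> 'a mat" where
  "diag2 M N \<equiv> diag_block_mat [M, N]"

text \<open>Embeddings \<open>\<complex> \<rightarrow> \<complex>[\<lambda>] \<rightarrow> \<complex>(\<lambda>)\<close>, entrywise, and the indeterminate in both rings.\<close>

abbreviation poly_mat :: "complex mat \<Rightarrow> complex poly mat" where
  "poly_mat M \<equiv> map_mat (\<lambda>c. [:c:]) M"

abbreviation rat_mat :: "complex poly mat \<Rightarrow> complex poly fract mat" where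
  "rat_mat M \<equiv> map_mat to_fract M"

abbreviation lam :: "complex poly" where
  "lam \<equiv> [:0, 1:]"

abbreviation lam_rat :: "complex poly fract" where
  "lam_rat \<equiv> to_fract lam"

definition mat_polynomial :: "nat \<Rightarrow> nat \<Rightarrow> (nat \<Rightarrow> complex mat) \<Rightarrow> complex poly mat" where
  "mat_polynomial m n Ac = mat n n (\<lambda>(i, j). \<Sum>k\<le>m. monom (Ac k $$ (i, j)) k)"

definition unimodular :: "complex poly mat \<Rightarrow> bool" where
  "unimodular U \<longleftrightarrow> square_mat U \<and> (\<exists>c. c \<noteq> 0 \<and> det U = [:c:])"

text \<open>Value of a rational function at a point; meaningful away from the finitely many poles.\<close>

definition eval_rat :: "complex poly fract \<Rightarrow> complex \<Rightarrow> complex" where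
  "eval_rat f z = poly (fst (quot_of_fract f)) z / poly (snd (quot_of_fract f)) z"

definition tends_to_at_infinity :: "complex poly fract mat \<Rightarrow> complex mat \<Rightarrow> bool" where
  "tends_to_at_infinity F F0 \<longleftrightarrow> dim_row F0 = dim_row F \<and> dim_col F0 = dim_col F \<and>
     (\<forall>i < dim_row F. \<forall>j < dim_col F. (eval_rat (F $$ (i, j)) \<longlongrightarrow> F0 $$ (i, j)) at_infinity)"

definition biproper :: "complex poly fract mat \<Rightarrow> bool" where
  "biproper F \<longleftrightarrow> square_mat F \<and> (\<exists>F0. tends_to_at_infinity F F0 \<and> invertible_mat F0)"

section \<open>System matrices and Rosenbrock strong linearizations\<close>

text \<open>The system matrix with blocks \<open>P(\<lambda>)\<close>, \<open>C\<close>, \<open>B\<close>, \<open>H - \<lambda>K\<close>, and its transfer function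
  \<open>P(\<lambda>) + C (\<lambda>K - H)\<inverse> B\<close>.\<close>

definition system_matrix ::
  "complex poly mat \<Rightarrow> complex mat \<Rightarrow> complex mat \<Rightarrow> complex mat \<Rightarrow> complex mat \<Rightarrow> complex poly mat"
  where
  "system_matrix P C B H K =
     four_block_mat P (poly_mat C) (poly_mat B) (poly_mat H - lam \<cdot>\<^sub>m poly_mat K)"

definition transfer_function ::
  "complex poly mat \<Rightarrow> complex mat \<Rightarrow> complex mat \<Rightarrow> complex mat \<Rightarrow> complex mat \<Rightarrow> complex poly fract mat"
  where
  "transfer_function P C B H K =
     rat_mat P + rat_mat (poly_mat C)
       * inv_mat (lam_rat \<cdot>\<^sub>m rat_mat (poly_mat K) - rat_mat (poly_mat H))
       * rat_mat (poly_mat B)"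

text \<open>Irreducibility of a system matrix whose first diagonal block has size \<open>N \<times> N\<close> and whose second
  one, \<open>H - \<lambda>K\<close>, has size \<open>r \<times> r\<close>; it does not depend on the first block. The first argument of
  \<open>vec_space.rank\<close> is the number of rows, and \<open>@\<^sub>r\<close> stacks matrices vertically.\<close>

definition irreducible_system ::
  "nat \<Rightarrow> nat \<Rightarrow> complex mat \<Rightarrow> complex mat \<Rightarrow> complex mat \<Rightarrow> complex mat \<Rightarrow> bool" where
  "irreducible_system N r C B H K \<longleftrightarrow>
     C \<in> carrier_mat N r \<and> B \<in> carrier_mat r N \<and> H \<in> carrier_mat r r \<and> K \<in> carrier_mat r r \<and>
     invertible_mat K \<and>
     (\<forall>z. vec_space.rank r (transpose_mat (transpose_mat B @\<^sub>r transpose_mat (H - z \<cdot>\<^sub>m K))) = r \<and>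
          vec_space.rank (N + r) (C @\<^sub>r (H - z \<cdot>\<^sub>m K)) = r)"

text \<open>\<open>LL\<close> is a Rosenbrock strong linearization of \<open>G(\<lambda>) = P(\<lambda>) + C (\<lambda>E - A)\<inverse> B\<close>, where \<open>P\<close> is
  \<open>n \<times> n\<close> of degree \<open>m\<close> and \<open>A\<close> is \<open>r \<times> r\<close>. The blocks quantified existentially are determined by
  \<open>LL\<close>.\<close>

definition rosenbrock_strong_linearization ::
  "nat \<Rightarrow> nat \<Rightarrow> nat \<Rightarrow> complex poly mat \<Rightarrow> complex mat \<Rightarrow> complex mat \<Rightarrow> complex mat \<Rightarrow> complex mat
    \<Rightarrow> complex poly mat \<Rightarrow> bool" where
  "rosenbrock_strong_linearization m n r P C B A E LL \<longleftrightarrow>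
     (\<exists>X Y C' B' H K.
        X \<in> carrier_mat (m * n) (m * n) \<and> Y \<in> carrier_mat (m * n) (m * n) \<and>
        LL = system_matrix (poly_mat X - lam \<cdot>\<^sub>m poly_mat Y) C' B' H K \<and>
        irreducible_system (m * n) r C' B' H K \<and>
        (\<exists>U V U0 V0.
           U \<in> carrier_mat (m * n) (m * n) \<and> unimodular U \<and>
           V \<in> carrier_mat (m * n) (m * n) \<and> unimodular V \<and>
           U0 \<in> carrier_mat r r \<and> invertible_mat U0 \<and>
           V0 \<in> carrier_mat r r \<and> invertible_mat V0 \<and>
           diag2 U (poly_mat U0) * LL * diag2 V (poly_mat V0)
             = diag2 (1\<^sub>m ((m - 1) * n)) (system_matrix P C B A E)) \<and>
        (\<exists>Ol Or.
           Ol \<in> carrier_mat (m * n) (m * n) \<and> biproper Ol \<and>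
           Or \<in> carrier_mat (m * n) (m * n) \<and> biproper Or \<and>
           Ol * (inverse lam_rat \<cdot>\<^sub>m
                   transfer_function (poly_mat X - lam \<cdot>\<^sub>m poly_mat Y) C' B' H K) * Or
             = diag2 (1\<^sub>m ((m - 1) * n))
                 (inverse (lam_rat ^ m) \<cdot>\<^sub>m transfer_function P C B A E)))"

section \<open>Extended generalized Fiedler pencils\<close>

text \<open>\<open>M\<^sub>i(X)\<close>. The indices \<open>PosI m\<close> and \<open>NegI 0\<close>, for which no elementary matrix with a free
  parameter is defined, give meaningless values here.\<close>

fun elem_mat :: "nat \<Rightarrow> nat \<Rightarrow> index \<Rightarrow> complex mat \<Rightarrow> complex mat" where
  "elem_mat m n (PosI i) X =
     (if i = 0 then diag_block_mat [1\<^sub>m ((m - 1) * n), X]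
      else diag_block_mat [1\<^sub>m ((m - i - 1) * n),
                           four_block_mat X (1\<^sub>m n) (1\<^sub>m n) (0\<^sub>m n n),
                           1\<^sub>m ((i - 1) * n)])"
| "elem_mat m n (NegI i) X =
     (if i = m then diag_block_mat [X, 1\<^sub>m ((m - 1) * n)]
      else diag_block_mat [1\<^sub>m ((m - i - 1) * n),
                           four_block_mat (0\<^sub>m n n) (1\<^sub>m n) (1\<^sub>m n) X,
                           1\<^sub>m ((i - 1) * n)])"

text \<open>\<open>M\<^sub>i\<^sup>P\<close> for \<open>P(\<lambda>) = \<Sum> \<lambda>\<^sup>i Ac\<^sub>i\<close>.\<close>

fun fiedler_mat :: "nat \<Rightarrow> nat \<Rightarrow> (nat \<Rightarrow> complex mat) \<Rightarrow> index \<Rightarrow> complex mat" where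
  "fiedler_mat m n Ac (PosI i) =
     (if i = m then inv_mat (elem_mat m n (NegI m) (Ac m)) else elem_mat m n (PosI i) (- Ac i))"
| "fiedler_mat m n Ac (NegI i) =
     (if i = 0 then inv_mat (elem_mat m n (PosI 0) (- Ac 0)) else elem_mat m n (NegI i) (Ac i))"

definition prod_mats :: "nat \<Rightarrow> 'a :: semiring_1 mat list \<Rightarrow> 'a mat" where
  "prod_mats N Ms = foldr (*) Ms (1\<^sub>m N)"

definition elem_prod :: "nat \<Rightarrow> nat \<Rightarrow> index list \<Rightarrow> complex mat list \<Rightarrow> complex mat" where
  "elem_prod m n t X = prod_mats (m * n) (map2 (elem_mat m n) t X)"

definition fiedler_prod :: "nat \<Rightarrow> nat \<Rightarrow> (nat \<Rightarrow> complex mat) \<Rightarrow> index list \<Rightarrow> complex mat" where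
  "fiedler_prod m n Ac t = prod_mats (m * n) (map (fiedler_mat m n Ac) t)"

definition matrix_assignment :: "nat \<Rightarrow> index list \<Rightarrow> complex mat list \<Rightarrow> bool" where
  "matrix_assignment n t X \<longleftrightarrow> length X = length t \<and> set X \<subseteq> carrier_mat n n"

definition nonsingular_assignment ::
  "nat \<Rightarrow> nat \<Rightarrow> index list \<Rightarrow> complex mat list \<Rightarrow> bool" where
  "nonsingular_assignment m n t X \<longleftrightarrow> matrix_assignment n t X \<and>
     (\<forall>k < length t. t ! k \<in> {PosI 0, NegI 0, PosI m, NegI m} \<longrightarrow> invertible_mat (X ! k))"

text \<open>The data from which an EGFP of \<open>P(\<lambda>) = \<Sum> \<lambda>\<^sup>i Ac\<^sub>i\<close> is built. The last two conditions
  say that the inverses occurring in \<open>M\<^sup>P\<^sub>\<sigma>\<close> and \<open>M\<^sup>P\<^sub>\<tau>\<close> exist.\<close>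

definition EGFP_data ::
  "nat \<Rightarrow> nat \<Rightarrow> (nat \<Rightarrow> complex mat) \<Rightarrow> index list \<Rightarrow> index list
    \<Rightarrow> index list \<Rightarrow> index list \<Rightarrow> index list \<Rightarrow> index list
    \<Rightarrow> complex mat list \<Rightarrow> complex mat list \<Rightarrow> complex mat list \<Rightarrow> complex mat list \<Rightarrow> bool" where
  "EGFP_data m n Ac \<sigma> \<tau> \<sigma>1 \<sigma>2 \<tau>1 \<tau>2 X1 X2 Y1 Y2 \<longleftrightarrow>
     (\<exists>\<omega>. distinct (\<sigma> @ \<omega>) \<and> set (\<sigma> @ \<omega>) = PosI ` {0..m} \<and> \<tau> = map neg_index \<omega>) \<and>
     set \<sigma>1 \<subseteq> set \<sigma> - {PosI (m - 1), PosI m} \<and>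
     set \<sigma>2 \<subseteq> set \<sigma> - {PosI (m - 1), PosI m} \<and>
     SIP (\<sigma>1 @ \<sigma> @ \<sigma>2) \<and>
     set \<tau>1 \<subseteq> set \<tau> - {NegI 1, NegI 0} \<and>
     set \<tau>2 \<subseteq> set \<tau> - {NegI 1, NegI 0} \<and>
     SIP (\<tau>1 @ \<tau> @ \<tau>2) \<and>
     nonsingular_assignment m n \<sigma>1 X1 \<and> nonsingular_assignment m n \<sigma>2 X2 \<and>
     nonsingular_assignment m n \<tau>1 Y1 \<and> nonsingular_assignment m n \<tau>2 Y2 \<and>
     (PosI m \<in> set \<sigma> \<longrightarrow> invertible_mat (elem_mat m n (NegI m) (Ac m))) \<and>
     (NegI 0 \<in> set \<tau> \<longrightarrow> invertible_mat (elem_mat m n (PosI 0) (- Ac 0)))"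

definition EGFP ::
  "nat \<Rightarrow> nat \<Rightarrow> (nat \<Rightarrow> complex mat) \<Rightarrow> index list \<Rightarrow> index list
    \<Rightarrow> index list \<Rightarrow> index list \<Rightarrow> index list \<Rightarrow> index list
    \<Rightarrow> complex mat list \<Rightarrow> complex mat list \<Rightarrow> complex mat list \<Rightarrow> complex mat list
    \<Rightarrow> complex poly mat" where
  "EGFP m n Ac \<sigma> \<tau> \<sigma>1 \<sigma>2 \<tau>1 \<tau>2 X1 X2 Y1 Y2 =
     poly_mat (elem_prod m n \<tau>1 Y1) * poly_mat (elem_prod m n \<sigma>1 X1)
     * (lam \<cdot>\<^sub>m poly_mat (fiedler_prod m n Ac \<tau>) - poly_mat (fiedler_prod m n Ac \<sigma>))
     * poly_mat (elem_prod m n \<sigma>2 X2) * poly_mat (elem_prod m n \<tau>2 Y2)"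

text \<open>The EGFP of \<open>G(\<lambda>) = \<Sum> \<lambda>\<^sup>i Ac\<^sub>i + C (\<lambda>E - A)\<inverse> B\<close>, for \<open>0 \<in> \<sigma>\<close> and \<open>-m \<in> \<tau>\<close>. The two
  differences \<open>m - i\<^sub>0(\<sigma>\<^sub>1,\<sigma>)\<close> and \<open>m - c\<^sub>0(\<sigma>,\<sigma>\<^sub>2)\<close> then lie in \<open>{1..m}\<close>.\<close>

definition EGFP_rational ::
  "nat \<Rightarrow> nat \<Rightarrow> (nat \<Rightarrow> complex mat) \<Rightarrow> complex mat \<Rightarrow> complex mat \<Rightarrow> complex mat \<Rightarrow> complex mat
    \<Rightarrow> index list \<Rightarrow> index list
    \<Rightarrow> index list \<Rightarrow> index list \<Rightarrow> index list \<Rightarrow> index list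
    \<Rightarrow> complex mat list \<Rightarrow> complex mat list \<Rightarrow> complex mat list \<Rightarrow> complex mat list
    \<Rightarrow> complex poly mat" where
  "EGFP_rational m n Ac C B A E \<sigma> \<tau> \<sigma>1 \<sigma>2 \<tau>1 \<tau>2 X1 X2 Y1 Y2 =
     system_matrix
       (EGFP m n Ac \<sigma> \<tau> \<sigma>1 \<sigma>2 \<tau>1 \<tau>2 X1 X2 Y1 Y2)
       (kronecker (unit_col m (nat (int m - inversions 0 (\<sigma>1 @ \<sigma>)))) C)
       (kronecker (transpose_mat (unit_col m (nat (int m - consecutions 0 (\<sigma> @ \<sigma>2))))) B)
       A E"

end

theory Submission
  imports Defs
begin

text \<open>
  Write \<open>M_\<alpha>\<close> for the product of the elementary matrices \<open>M_i(- A_i)\<close> along a tuple \<open>\<alpha>\<close>, \<open>e_j\<close> for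
  the \<open>j\<close>-th block column of the identity, and \<open>R(\<lambda>) = C (\<lambda>E - A)\<inverse> B\<close>, so that \<open>G = P + R\<close>.

  \<^emph>\<open>Reduction to a Fiedler pencil.\<close> For \<open>1 \<le> i < m\<close> the factors \<open>M_i(- A_i)\<close> and \<open>M_{-i}(A_i)\<close> are
  inverse to each other. Every factor of \<open>M_\<tau>\<close> except the one with index \<open>-m\<close> can therefore be
  moved to the other term of the pencil. The EGFP becomes \<open>G1 (\<lambda> M_{-m} - M_\<alpha>) G2\<close> with constant
  invertible \<open>G1\<close>, \<open>G2\<close> and a permutation \<open>\<alpha> = (p, 0, q)\<close> of \<open>{0, \<dots>, m - 1}\<close>. Under the same
  transformation the block column that carries \<open>C\<close> becomes \<open>M_p e_m\<close>, and the block row that carries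
  \<open>B\<close> becomes the row \<open>e_m\<^sup>T M_q\<close>. This is where the inversions and consecutions of \<open>0\<close> come from:
  multiplying \<open>e_{m-j}\<close> by \<open>M_i\<close> moves the block one place up if \<open>i = j + 1\<close>, does nothing if
  \<open>i \<notin> {j, j + 1}\<close>, and the SIP rules out \<open>i = j\<close>. The SIP for \<open>\<tau>\<close> keeps the remaining factors with
  negative indices away from the block (\<open>EGFP_factorization\<close>).

  \<^emph>\<open>Finite part.\<close> Over any commutative ring and for any ring element \<open>a\<close>, the pencil \<open>a M_{-m} - M_\<alpha>\<close>
  reduces to \<open>diag(I, \<Sum> a^i A_i)\<close> by Horner's scheme. Splitting off the factor with index \<open>m - 1\<close>, which
  can be brought to one end of \<open>M_\<alpha>\<close>, leaves an identity block and the pencil of size \<open>m - 1\<close> whose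
  leading coefficient is \<open>a A_m + A_{m-1}\<close>. The two transformations also carry \<open>M_p e_m\<close> and
  \<open>e_m\<^sup>T M_q\<close> to \<open>e_m\<close> and \<open>e_m\<^sup>T\<close>. With \<open>a = \<lambda>\<close> over the polynomials this is exactly
  what is needed to transform the whole system matrix (\<open>reducible_to_peel\<close>,
  \<open>fiedler_pencil_reducible\<close>, \<open>finite_part\<close>).

  \<^emph>\<open>Infinity.\<close> The transfer function of the pencil is \<open>G1 (\<lambda> M_{-m} - M_\<alpha> + M_p e_m R e_m\<^sup>T M_q) G2\<close>, and
  the correction term only replaces \<open>A_0\<close> by \<open>A_0 + R\<close> in the factor with index \<open>0\<close>. So it remains to
  reduce \<open>M_{-m} - \<mu> M_\<alpha>\<close> with \<open>\<mu> = 1/\<lambda>\<close> over the ring of proper rational functions, to which \<open>\<mu>\<close>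
  and the entries of \<open>R\<close> belong. Reversing the order of all rows and columns exchanges the roles of
  \<open>M_0\<close> and \<open>M_{-m}\<close>, and the Horner argument applies once more, to the coefficients in opposite
  order and with \<open>a = \<mu>\<close> (\<open>reversed_pencil_reducible\<close>, \<open>infinite_part\<close>). A matrix that is invertible
  over the proper rational functions is biproper.

  \<^emph>\<open>Irreducibility\<close> is inherited from the system matrix of \<open>G\<close>, because \<open>C\<close> and \<open>B\<close> are only
  padded by zero blocks (\<open>irreducible_embed\<close>).
\<close>

section \<open>Direct sums and stacked blocks\<close>

text \<open>Associativity and transposition rules whose side conditions are equations between
  dimensions, so that the simplifier can discharge them.\<close>

lemma mult_assoc_dim:
  fixes A B C :: "'a::semiring_0 mat"
  shows "dim_col A = dim_row B \<Longrightarrow> dim_col B = dim_row C \<Longrightarrow> A * B * C = A * (B * C)"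
  by (rule assoc_mult_mat[of _ "dim_row A" "dim_row B" _ "dim_row C" _ "dim_col C"]) auto

text \<open>Block diagonal matrices as a binary operation. Unlike the list version, it is
  associative on the nose, so that the same matrix can be split at different places.\<close>

definition dsum :: "'a :: zero mat \<Rightarrow> 'a mat \<Rightarrow> 'a mat" (infixr "\<oplus>\<^sub>d" 66) where
  "A \<oplus>\<^sub>d B = four_block_mat A (0\<^sub>m (dim_row A) (dim_col B)) (0\<^sub>m (dim_row B) (dim_col A)) B"

lemma dim_dsum [simp]:
  "dim_row (A \<oplus>\<^sub>d B) = dim_row A + dim_row B" "dim_col (A \<oplus>\<^sub>d B) = dim_col A + dim_col B"
  by (simp_all add: dsum_def)

lemma dsum_carrier [intro, simp]:
  "A \<in> carrier_mat a b \<Longrightarrow> B \<in> carrier_mat c d \<Longrightarrow> A \<oplus>\<^sub>d B \<in> carrier_mat (a + c) (b + d)"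
  by (auto intro!: carrier_matI)

lemma diag2_eq_dsum: "diag_block_mat [A, B] = A \<oplus>\<^sub>d B"
  by (simp only: diag_block_mat.simps(2)[of A "[B]"] Let_def diag_block_mat_singleton dsum_def)

lemma diag3_eq_dsum: "diag_block_mat [A, B, C] = A \<oplus>\<^sub>d B \<oplus>\<^sub>d C"
  by (simp only: diag_block_mat.simps(2)[of A "[B, C]"] Let_def diag2_eq_dsum dsum_def[of A])

lemma dsum_one: "1\<^sub>m a \<oplus>\<^sub>d 1\<^sub>m b = (1\<^sub>m (a + b) :: 'a :: {zero,one} mat)"
  by (rule eq_matI) (auto simp: dsum_def)

lemma dsum_assoc: "(A \<oplus>\<^sub>d B) \<oplus>\<^sub>d C = A \<oplus>\<^sub>d (B \<oplus>\<^sub>d C)"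
  using assoc_four_block_mat[of A B C] unfolding dsum_def by (simp add: Let_def add.commute)

lemma dsum_empty [simp]: "1\<^sub>m 0 \<oplus>\<^sub>d A = A" "A \<oplus>\<^sub>d 1\<^sub>m 0 = A"
  by (rule eq_matI; simp add: dsum_def)+

lemma dsum_mult:
  fixes A B C D :: "'a :: semiring_0 mat"
  assumes "dim_col A = dim_row C" "dim_col B = dim_row D"
  shows "(A \<oplus>\<^sub>d B) * (C \<oplus>\<^sub>d D) = (A * C) \<oplus>\<^sub>d (B * D)"
proof -
  have "(A \<oplus>\<^sub>d B) * (C \<oplus>\<^sub>d D) =
    four_block_mat (A * C + 0\<^sub>m (dim_row A) (dim_col B) * 0\<^sub>m (dim_row D) (dim_col C))
      (A * 0\<^sub>m (dim_row C) (dim_col D) + 0\<^sub>m (dim_row A) (dim_col B) * D)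
      (0\<^sub>m (dim_row B) (dim_col A) * C + B * 0\<^sub>m (dim_row D) (dim_col C))
      (0\<^sub>m (dim_row B) (dim_col A) * 0\<^sub>m (dim_row C) (dim_col D) + B * D)"
    unfolding dsum_def
    by (rule mult_four_block_mat[where ?n1.0 = "dim_row C" and ?n2.0 = "dim_row D"])
       (use assms in auto)
  also have "\<dots> = (A * C) \<oplus>\<^sub>d (B * D)"
    unfolding dsum_def by (rule cong_four_block_mat; rule eq_matI; use assms in simp)
  finally show ?thesis .
qed

lemma dsum_transpose: "(A \<oplus>\<^sub>d B)\<^sup>T = A\<^sup>T \<oplus>\<^sub>d B\<^sup>T"
  by (rule eq_matI) (auto simp: dsum_def)

lemma dsum_map: "f 0 = 0 \<Longrightarrow> map_mat f (A \<oplus>\<^sub>d B) = map_mat f A \<oplus>\<^sub>d map_mat f B"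
  by (rule eq_matI) (auto simp: dsum_def)

lemma append_rows_dim [simp]:
  "dim_row (A @\<^sub>r B) = dim_row A + dim_row B" "dim_col (A @\<^sub>r B) = dim_col A"
  by (simp_all add: append_rows_def)

lemma append_rows_index:
  "i < dim_row A + dim_row B \<Longrightarrow> j < dim_col A \<Longrightarrow> dim_col B = dim_col A \<Longrightarrow>
   (A @\<^sub>r B) $$ (i, j) = (if i < dim_row A then A $$ (i, j) else B $$ (i - dim_row A, j))"
  by (auto simp: append_rows_def)

text \<open>Block columns are stacked with \<open>@\<^sub>r\<close>; this is how a block matrix acts on one.\<close>

lemma four_block_append_rows:
  fixes A B C D X Y :: "'a :: semiring_0 mat"
  assumes "A \<in> carrier_mat a p" "B \<in> carrier_mat a q" "C \<in> carrier_mat b p" "D \<in> carrier_mat b q"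
    and "X \<in> carrier_mat p k" "Y \<in> carrier_mat q k"
  shows "four_block_mat A B C D * (X @\<^sub>r Y) = (A * X + B * Y) @\<^sub>r (C * X + D * Y)"
proof -
  have e: "X @\<^sub>r Y = four_block_mat X (0\<^sub>m p 0) Y (0\<^sub>m q 0)"
    using assms(5,6) by (simp add: append_rows_def)
  have "four_block_mat A B C D * (X @\<^sub>r Y) =
    four_block_mat (A * X + B * Y) (A * 0\<^sub>m p 0 + B * 0\<^sub>m q 0) (C * X + D * Y) (C * 0\<^sub>m p 0 + D * 0\<^sub>m q 0)"
    unfolding e by (rule mult_four_block_mat[OF assms(1-5) _ assms(6)]) auto
  moreover have "A * 0\<^sub>m p 0 + B * 0\<^sub>m q 0 = 0\<^sub>m a 0" "C * 0\<^sub>m p 0 + D * 0\<^sub>m q 0 = 0\<^sub>m b 0"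
    by (rule eq_matI; use assms in simp)+
  ultimately show ?thesis using assms by (simp add: append_rows_def)
qed

lemma dsum_append_rows:
  fixes A B X Y :: "'a :: semiring_0 mat"
  assumes "dim_col A = dim_row X" "dim_col B = dim_row Y" "dim_col Y = dim_col X"
  shows "(A \<oplus>\<^sub>d B) * (X @\<^sub>r Y) = (A * X) @\<^sub>r (B * Y)"
proof -
  have "(A \<oplus>\<^sub>d B) * (X @\<^sub>r Y) =
     (A * X + 0\<^sub>m (dim_row A) (dim_col B) * Y) @\<^sub>r (0\<^sub>m (dim_row B) (dim_col A) * X + B * Y)"
    unfolding dsum_def
    by (rule four_block_append_rows[where p = "dim_row X" and q = "dim_row Y" and k = "dim_col X"
          and a = "dim_row A" and b = "dim_row B"])
       (use assms in auto)
  moreover have "A * X + 0\<^sub>m (dim_row A) (dim_col B) * Y = A * X"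
    using assms by (intro eq_matI) auto
  moreover have "0\<^sub>m (dim_row B) (dim_col A) * X + B * Y = B * Y"
    using assms by (intro eq_matI) auto
  ultimately show ?thesis by simp
qed

section \<open>Invertible matrices over a subring\<close>

lemma transpose_mult_dim:
  fixes A B :: "'a::comm_semiring_0 mat"
  shows "dim_col A = dim_row B \<Longrightarrow> (A * B)\<^sup>T = B\<^sup>T * A\<^sup>T"
  by (rule transpose_mult[of _ "dim_row A" "dim_row B" _ "dim_col B"]) auto

definition mats :: "'a set \<Rightarrow> nat \<Rightarrow> nat \<Rightarrow> 'a mat set" where
  "mats S a b = {A \<in> carrier_mat a b. \<forall>i<a. \<forall>j<b. A $$ (i, j) \<in> S}"

text \<open>The group of invertible matrices over a set \<open>S\<close> of coefficients, the inverse being again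
  over \<open>S\<close>. The theory is used for all polynomials (where it means unimodular), for all complex
  numbers, and for the proper rational functions (where it means biproper).\<close>

definition GL :: "'a :: semiring_1 set \<Rightarrow> nat \<Rightarrow> 'a mat set" where
  "GL S N = {U \<in> mats S N N. \<exists>U'\<in>mats S N N. U * U' = 1\<^sub>m N \<and> U' * U = 1\<^sub>m N}"

lemma mats_carrier: "A \<in> mats S a b \<Longrightarrow> A \<in> carrier_mat a b"
  by (simp add: mats_def)

lemma mats_UNIV [simp]: "mats UNIV a b = carrier_mat a b"
  by (auto simp: mats_def)

lemma GL_carrier: "U \<in> GL S N \<Longrightarrow> U \<in> carrier_mat N N"
  by (auto simp: GL_def mats_def)

lemma GL_E:
  assumes "U \<in> GL S N"
  obtains U' where "U' \<in> GL S N" "U * U' = 1\<^sub>m N" "U' * U = 1\<^sub>m N"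
  using assms unfolding GL_def by blast

locale coeff_ring =
  fixes S :: "'a :: comm_ring_1 set"
  assumes zero_in [simp]: "0 \<in> S" and one_in [simp]: "1 \<in> S"
    and add_in: "x \<in> S \<Longrightarrow> y \<in> S \<Longrightarrow> x + y \<in> S"
    and uminus_in: "x \<in> S \<Longrightarrow> - x \<in> S"
    and mult_in: "x \<in> S \<Longrightarrow> y \<in> S \<Longrightarrow> x * y \<in> S"
begin

lemma sum_in: "(\<And>i. i \<in> I \<Longrightarrow> f i \<in> S) \<Longrightarrow> sum f I \<in> S"
  by (induction I rule: infinite_finite_induct) (auto intro: add_in)

lemma power_in: "a \<in> S \<Longrightarrow> a ^ k \<in> S"
  by (induction k) (auto intro: mult_in)

lemma mats_one: "1\<^sub>m k \<in> mats S k k"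
  and mats_zero: "0\<^sub>m k l \<in> mats S k l"
  by (auto simp: mats_def)

lemma mats_add: "A \<in> mats S k l \<Longrightarrow> B \<in> mats S k l \<Longrightarrow> A + B \<in> mats S k l"
  by (auto simp: mats_def intro!: add_in)

lemma mats_uminus: "A \<in> mats S k l \<Longrightarrow> - A \<in> mats S k l"
  by (auto simp: mats_def intro!: uminus_in)

lemma mats_minus: 
  assumes "A \<in> mats S k l" "B \<in> mats S k l" shows "A - B \<in> mats S k l"
proof -
  have "A - B = A + - B" using assms by (intro eq_matI) (auto simp: mats_def)
  then show ?thesis using mats_add[OF assms(1) mats_uminus[OF assms(2)]] by simp
qed

lemma mats_smult: "a \<in> S \<Longrightarrow> A \<in> mats S k l \<Longrightarrow> a \<cdot>\<^sub>m A \<in> mats S k l"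
  by (auto simp: mats_def intro!: mult_in)

lemma mats_mult: "A \<in> mats S k l \<Longrightarrow> B \<in> mats S l p \<Longrightarrow> A * B \<in> mats S k p"
  by (auto simp: mats_def scalar_prod_def intro!: sum_in mult_in)

lemma mats_transpose: "A \<in> mats S k l \<Longrightarrow> A\<^sup>T \<in> mats S l k"
  by (auto simp: mats_def)

lemma mats_four_block:
  "A \<in> mats S a c \<Longrightarrow> B \<in> mats S a d \<Longrightarrow> C \<in> mats S b c \<Longrightarrow> D \<in> mats S b d \<Longrightarrow>
   four_block_mat A B C D \<in> mats S (a + b) (c + d)"
  by (auto simp: mats_def)

lemma mats_dsum: "A \<in> mats S a c \<Longrightarrow> D \<in> mats S b d \<Longrightarrow> A \<oplus>\<^sub>d D \<in> mats S (a + b) (c + d)"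
  unfolding dsum_def by (rule mats_four_block) (auto simp: mats_def)

lemma mats_append_rows:
  assumes "A \<in> mats S a c" "B \<in> mats S b c" shows "A @\<^sub>r B \<in> mats S (a + b) c"
proof -
  have "A @\<^sub>r B \<in> mats S (a + b) (c + 0)"
    unfolding append_rows_def using assms
    by (intro mats_four_block) (auto simp: mats_def)
  then show ?thesis by simp
qed

lemma GL_I:
  "U \<in> mats S N N \<Longrightarrow> U' \<in> mats S N N \<Longrightarrow> U * U' = 1\<^sub>m N \<Longrightarrow> U' * U = 1\<^sub>m N \<Longrightarrow> U \<in> GL S N"
  by (auto simp: GL_def)

lemma GL_one: "1\<^sub>m N \<in> GL S N"
  by (rule GL_I[OF mats_one mats_one]) auto

lemma GL_mult:
  assumes "U \<in> GL S N" "V \<in> GL S N" shows "U * V \<in> GL S N"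
proof -
  obtain U' where U: "U' \<in> GL S N" "U * U' = 1\<^sub>m N" "U' * U = 1\<^sub>m N" using assms(1) by (rule GL_E)
  obtain V' where V: "V' \<in> GL S N" "V * V' = 1\<^sub>m N" "V' * V = 1\<^sub>m N" using assms(2) by (rule GL_E)
  note c [simp] = GL_carrier[OF assms(1)] GL_carrier[OF assms(2)] GL_carrier[OF U(1)] GL_carrier[OF V(1)]
  note d [simp] = c[THEN carrier_matD(1)] c[THEN carrier_matD(2)]
  have "U * V * (V' * U') = U * ((V * V') * U')" by (simp add: mult_assoc_dim)
  also have "\<dots> = 1\<^sub>m N" using U V by simp
  finally have 1: "U * V * (V' * U') = 1\<^sub>m N" .
  have "V' * U' * (U * V) = V' * ((U' * U) * V)" by (simp add: mult_assoc_dim)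
  also have "\<dots> = 1\<^sub>m N" using U V by simp
  finally have 2: "V' * U' * (U * V) = 1\<^sub>m N" .
  show ?thesis
    using assms U(1) V(1) by (intro GL_I[OF _ _ 1 2] mats_mult[of _ _ N]) (auto simp: GL_def)
qed

lemma GL_transpose:
  assumes "U \<in> GL S N" shows "U\<^sup>T \<in> GL S N"
proof -
  obtain U' where U: "U' \<in> GL S N" "U * U' = 1\<^sub>m N" "U' * U = 1\<^sub>m N" using assms(1) by (rule GL_E)
  note c = GL_carrier[OF assms(1)] GL_carrier[OF U(1)]
  have 1: "U\<^sup>T * U'\<^sup>T = 1\<^sub>m N" "U'\<^sup>T * U\<^sup>T = 1\<^sub>m N"
    using transpose_mult[OF c] transpose_mult[OF c(2) c(1)] unfolding U transpose_one by (auto dest: sym)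
  show ?thesis
    using assms U(1) by (intro GL_I[OF _ _ 1] mats_transpose) (auto simp: GL_def)
qed

lemma GL_dsum:
  assumes "U \<in> GL S M" "V \<in> GL S N" shows "U \<oplus>\<^sub>d V \<in> GL S (M + N)"
proof -
  obtain U' where U: "U' \<in> GL S M" "U * U' = 1\<^sub>m M" "U' * U = 1\<^sub>m M" using assms(1) by (rule GL_E)
  obtain V' where V: "V' \<in> GL S N" "V * V' = 1\<^sub>m N" "V' * V = 1\<^sub>m N" using assms(2) by (rule GL_E)
  note c [simp] = GL_carrier[OF assms(1)] GL_carrier[OF assms(2)] GL_carrier[OF U(1)] GL_carrier[OF V(1)]
  note d [simp] = c[THEN carrier_matD(1)] c[THEN carrier_matD(2)]
  have 1: "(U \<oplus>\<^sub>d V) * (U' \<oplus>\<^sub>d V') = 1\<^sub>m (M + N)" "(U' \<oplus>\<^sub>d V') * (U \<oplus>\<^sub>d V) = 1\<^sub>m (M + N)"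
    by (simp_all add: dsum_mult U V dsum_one)
  show ?thesis
    using assms U(1) V(1) by (intro GL_I[OF _ _ 1] mats_dsum) (auto simp: GL_def)
qed

end

definition last_block :: "nat \<Rightarrow> nat \<Rightarrow> 'a :: {zero,one} mat" where
  "last_block k n = 0\<^sub>m (k * n) n @\<^sub>r 1\<^sub>m n"

text \<open>The relation established for pencils \<open>T\<close> with \<open>k + 1\<close> blocks: \<open>T\<close> is equivalent over \<open>S\<close>
  to \<open>diag(I, Z)\<close>, and the equivalence takes the block column \<open>x\<close> and the block row \<open>y\<^sup>T\<close> to the last
  ones. In a system matrix \<open>x\<close> and \<open>y\<^sup>T\<close> are the places where \<open>C\<close> and \<open>B\<close> are attached.\<close>

definition reducible_to ::
  "'a :: comm_ring_1 set \<Rightarrow> nat \<Rightarrow> nat \<Rightarrow> 'a mat \<Rightarrow> 'a mat \<Rightarrow> 'a mat \<Rightarrow> 'a mat \<Rightarrow> bool" where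
  "reducible_to S k n T x y Z \<longleftrightarrow> (\<exists>U\<in>GL S (n + k * n). \<exists>V\<in>GL S (n + k * n).
     U * T * V = 1\<^sub>m (k * n) \<oplus>\<^sub>d Z \<and> U * x = last_block k n \<and> V\<^sup>T * y = last_block k n)"

context coeff_ring
begin

lemma reducible_to_equiv:
  assumes G: "G \<in> GL S (n + k * n)" and H: "H \<in> GL S (n + k * n)"
    and T: "T \<in> carrier_mat (n + k * n) (n + k * n)"
    and x: "x \<in> carrier_mat (n + k * n) n" and y: "y \<in> carrier_mat (n + k * n) n"
    and red: "reducible_to S k n T x y Z"
  shows "reducible_to S k n (G * T * H) (G * x) (H\<^sup>T * y) Z"
proof -
  let ?N = "n + k * n"
  obtain U V where UV: "U \<in> GL S ?N" "V \<in> GL S ?N" "U * T * V = 1\<^sub>m (k * n) \<oplus>\<^sub>d Z"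
    "U * x = last_block k n" "V\<^sup>T * y = last_block k n"
    using red unfolding reducible_to_def by blast
  obtain G' where G': "G' \<in> GL S ?N" "G * G' = 1\<^sub>m ?N" "G' * G = 1\<^sub>m ?N" using G by (rule GL_E)
  obtain H' where H': "H' \<in> GL S ?N" "H * H' = 1\<^sub>m ?N" "H' * H = 1\<^sub>m ?N" using H by (rule GL_E)
  note c [simp] = GL_carrier[OF G] GL_carrier[OF H] GL_carrier[OF G'(1)] GL_carrier[OF H'(1)]
    GL_carrier[OF UV(1)] GL_carrier[OF UV(2)] T
  note d [simp] = c[THEN carrier_matD(1)] c[THEN carrier_matD(2)]
  have [simp]: "dim_row x = ?N" "dim_row y = ?N" "dim_col x = n" "dim_col y = n" using x y by auto
  have c1: "G' * (G * Y) = Y" if "dim_row Y = ?N" for Y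
    using that by (subst mult_assoc_dim[symmetric]) (auto simp: G' left_mult_one_mat')
  have c2: "H * (H' * Y) = Y" if "dim_row Y = ?N" for Y
    using that by (subst mult_assoc_dim[symmetric]) (auto simp: H' left_mult_one_mat')
  have "H'\<^sup>T * H\<^sup>T = 1\<^sub>m ?N" using transpose_mult[of H ?N ?N H' ?N] H' by simp
  then have c3: "H'\<^sup>T * (H\<^sup>T * Y) = Y" if "dim_row Y = ?N" for Y
    using that by (subst mult_assoc_dim[symmetric]) (auto simp: left_mult_one_mat')
  have 1: "U * G' * (G * T * H) * (H' * V) = 1\<^sub>m (k * n) \<oplus>\<^sub>d Z"
    using UV(3) by (simp add: mult_assoc_dim c1 c2)
  have 2: "U * G' * (G * x) = last_block k n"
    using UV(4) by (simp add: mult_assoc_dim c1)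
  have "(H' * V)\<^sup>T = V\<^sup>T * H'\<^sup>T" by (rule transpose_mult[of _ ?N ?N _ ?N]) auto
  then have 3: "(H' * V)\<^sup>T * (H\<^sup>T * y) = last_block k n"
    using UV(5) by (simp add: mult_assoc_dim c3)
  show ?thesis unfolding reducible_to_def
    using GL_mult[OF UV(1) G'(1)] GL_mult[OF H'(1) UV(2)] 1 2 3 by blast
qed

text \<open>Transposition exchanges the two sides, which halves the number of cases below.\<close>

lemma reducible_to_transpose:
  assumes T: "T \<in> carrier_mat (n + k * n) (n + k * n)"
    and red: "reducible_to S k n T x y Z"
  shows "reducible_to S k n T\<^sup>T y x Z\<^sup>T"
proof -
  let ?N = "n + k * n"
  obtain U V where UV: "U \<in> GL S ?N" "V \<in> GL S ?N" "U * T * V = 1\<^sub>m (k * n) \<oplus>\<^sub>d Z"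
    "U * x = last_block k n" "V\<^sup>T * y = last_block k n"
    using red unfolding reducible_to_def by blast
  note c [simp] = GL_carrier[OF UV(1)] GL_carrier[OF UV(2)] T
  note d [simp] = c[THEN carrier_matD(1)] c[THEN carrier_matD(2)]
  have "V\<^sup>T * T\<^sup>T * U\<^sup>T = (U * T * V)\<^sup>T"
    by (simp add: transpose_mult_dim mult_assoc_dim)
  also have "\<dots> = 1\<^sub>m (k * n) \<oplus>\<^sub>d Z\<^sup>T" by (simp add: UV(3) dsum_transpose)
  finally show ?thesis unfolding reducible_to_def
    using GL_transpose[OF UV(1)] GL_transpose[OF UV(2)] UV(4,5) by (metis transpose_transpose)
qed

end

section \<open>The Horner step\<close>

abbreviation first_block :: "nat \<Rightarrow> nat \<Rightarrow> 'a :: {zero,one} mat" where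
  "first_block l n \<equiv> 1\<^sub>m n @\<^sub>r 0\<^sub>m l n"

lemma append_rows_mult:
  fixes A B C :: "'a :: semiring_0 mat"
  assumes "dim_col A = dim_row C" "dim_col B = dim_row C"
  shows "(A @\<^sub>r B) * C = (A * C) @\<^sub>r (B * C)"
proof (rule eq_matI)
  fix i j assume ij: "i < dim_row ((A * C) @\<^sub>r (B * C))" "j < dim_col ((A * C) @\<^sub>r (B * C))"
  have "row (A @\<^sub>r B) i = (if i < dim_row A then row A i else row B (i - dim_row A))"
    using ij assms by (intro eq_vecI) (auto simp: append_rows_index)
  then show "((A @\<^sub>r B) * C) $$ (i, j) = ((A * C) @\<^sub>r (B * C)) $$ (i, j)"
    using ij assms by (auto simp: append_rows_index)
qed simp_all

text \<open>The elementary matrix \<open>M_i(X)\<close> with the largest index, the only one that touches the first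
  block, and its inverse, an elementary matrix of negative index.\<close>

definition top_factor :: "nat \<Rightarrow> nat \<Rightarrow> 'a :: {zero,one} mat \<Rightarrow> 'a mat" where
  "top_factor l n X = four_block_mat X (1\<^sub>m n) (1\<^sub>m n) (0\<^sub>m n n) \<oplus>\<^sub>d 1\<^sub>m l"

definition top_factor_inv :: "nat \<Rightarrow> nat \<Rightarrow> 'a :: {zero,one} mat \<Rightarrow> 'a mat" where
  "top_factor_inv l n W = four_block_mat (0\<^sub>m n n) (1\<^sub>m n) (1\<^sub>m n) W \<oplus>\<^sub>d 1\<^sub>m l"

lemma top_factor_inverse:
  fixes X :: "'a :: comm_ring_1 mat"
  assumes X: "X \<in> carrier_mat n n"
  shows "top_factor l n X * top_factor_inv l n (- X) = 1\<^sub>m (n + (n + l))"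
    and "top_factor_inv l n (- X) * top_factor l n X = 1\<^sub>m (n + (n + l))"
proof -
  have [simp]: "dim_row X = n" "dim_col X = n" using X by auto
  have X': "- X \<in> carrier_mat n n" using X by simp
  have z: "X + - X = 0\<^sub>m n n" "- X + X = 0\<^sub>m n n" by (rule eq_matI; use X in simp)+
  have [simp]: "- 0\<^sub>m n n = (0\<^sub>m n n :: 'a mat)" by (rule eq_matI) simp_all
  have one: "four_block_mat (1\<^sub>m n) (0\<^sub>m n n) (0\<^sub>m n n) (1\<^sub>m n) = (1\<^sub>m (n + n) :: 'a mat)" 
    by (rule four_block_one_mat)
  have 1: "four_block_mat X (1\<^sub>m n) (1\<^sub>m n) (0\<^sub>m n n) * four_block_mat (0\<^sub>m n n) (1\<^sub>m n) (1\<^sub>m n) (- X) = 1\<^sub>m (n + n)"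
    by (subst mult_four_block_mat[where ?nr1.0 = n and ?nr2.0 = n and ?n1.0 = n and ?n2.0 = n and ?nc1.0 = n and ?nc2.0 = n]) (use X X' z one in simp_all)
  have 2: "four_block_mat (0\<^sub>m n n) (1\<^sub>m n) (1\<^sub>m n) (- X) * four_block_mat X (1\<^sub>m n) (1\<^sub>m n) (0\<^sub>m n n) = 1\<^sub>m (n + n)"
    by (subst mult_four_block_mat[where ?nr1.0 = n and ?nr2.0 = n and ?n1.0 = n and ?n2.0 = n and ?nc1.0 = n and ?nc2.0 = n]) (use X X' z one in simp_all)
  show "top_factor l n X * top_factor_inv l n (- X) = 1\<^sub>m (n + (n + l))"
    "top_factor_inv l n (- X) * top_factor l n X = 1\<^sub>m (n + (n + l))"
    unfolding top_factor_def top_factor_inv_def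
    by (simp_all add: dsum_mult 1 2 dsum_one add.assoc)
qed

text \<open>The same matrix split as \<open>1 + (rest)\<close> instead of \<open>2 + (rest)\<close> blocks, as needed to eliminate
  its first block.\<close>

lemma top_factor_inv_blocks:
  fixes W :: "'a :: comm_ring_1 mat"
  assumes W: "W \<in> carrier_mat n n"
  shows "top_factor_inv l n W =
    four_block_mat (0\<^sub>m n n) (first_block l n)\<^sup>T (first_block l n) (W \<oplus>\<^sub>d 1\<^sub>m l)"
proof (rule eq_matI)
  have [simp]: "dim_row W = n" "dim_col W = n" using W by auto
  show "dim_row (top_factor_inv l n W) = dim_row (four_block_mat (0\<^sub>m n n) (first_block l n)\<^sup>T (first_block l n) (W \<oplus>\<^sub>d 1\<^sub>m l))"
   "dim_col (top_factor_inv l n W) = dim_col (four_block_mat (0\<^sub>m n n) (first_block l n)\<^sup>T (first_block l n) (W \<oplus>\<^sub>d 1\<^sub>m l))"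
    by (simp_all add: top_factor_inv_def)
  fix i j assume "i < dim_row (four_block_mat (0\<^sub>m n n) (first_block l n)\<^sup>T (first_block l n) (W \<oplus>\<^sub>d 1\<^sub>m l))"
    "j < dim_col (four_block_mat (0\<^sub>m n n) (first_block l n)\<^sup>T (first_block l n) (W \<oplus>\<^sub>d 1\<^sub>m l))"
  then have i: "i < n + (n + l)" and j: "j < n + (n + l)" by simp_all
  consider "i < n" | "n \<le> i" "i < n + n" | "n + n \<le> i" by linarith
  then show "top_factor_inv l n W $$ (i, j) =
      four_block_mat (0\<^sub>m n n) (first_block l n)\<^sup>T (first_block l n) (W \<oplus>\<^sub>d 1\<^sub>m l) $$ (i, j)"
  proof cases
    case 1
    consider "j < n" | "n \<le> j" "j < n + n" | "n + n \<le> j" by linarith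
    then show ?thesis using i j 1
      by cases (simp_all add: top_factor_inv_def dsum_def append_rows_index less_diff_conv2)
  next
    case 2
    consider "j < n" | "n \<le> j" "j < n + n" | "n + n \<le> j" by linarith
    then show ?thesis using i j 2
      by cases (simp_all add: top_factor_inv_def dsum_def append_rows_index less_diff_conv2)
  next
    case 3
    consider "j < n" | "n \<le> j" "j < n + n" | "n + n \<le> j" by linarith
    then show ?thesis using i j 3
      by cases (simp_all add: top_factor_inv_def dsum_def append_rows_index less_diff_conv2 diff_diff_left)
  qed
qed

lemma first_block_outer:
  fixes D :: "'a :: comm_ring_1 mat"
  assumes D: "D \<in> carrier_mat n n"
  shows "first_block l n * (D * (first_block l n)\<^sup>T) = D \<oplus>\<^sub>d 0\<^sub>m l l"
proof -
  have [simp]: "dim_row D = n" "dim_col D = n" using D by auto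
  have "D * (first_block l n)\<^sup>T = (first_block l n * D\<^sup>T)\<^sup>T"
    by (simp add: transpose_mult_dim)
  also have "first_block l n * D\<^sup>T = D\<^sup>T @\<^sub>r 0\<^sub>m l n"
    by (simp add: append_rows_mult left_mult_one_mat')
  finally have 1: "D * (first_block l n)\<^sup>T = (D\<^sup>T @\<^sub>r 0\<^sub>m l n)\<^sup>T" .
  show ?thesis unfolding 1
    by (rule eq_matI) (simp_all add: append_rows_mult left_mult_one_mat' append_rows_index dsum_def)
qed

context coeff_ring
begin

lemma top_factor_GL:
  assumes X: "X \<in> mats S n n"
  shows "top_factor l n X \<in> GL S (n + (n + l))" "top_factor_inv l n (- X) \<in> GL S (n + (n + l))"
proof -
  have 1: "top_factor l n X \<in> mats S (n + n + l) (n + n + l)"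
    unfolding top_factor_def by (intro mats_dsum mats_four_block mats_one mats_zero X)
  have 2: "top_factor_inv l n (- X) \<in> mats S (n + n + l) (n + n + l)"
    unfolding top_factor_inv_def by (intro mats_dsum mats_four_block mats_one mats_zero mats_uminus X)
  show "top_factor l n X \<in> GL S (n + (n + l))" "top_factor_inv l n (- X) \<in> GL S (n + (n + l))"
    using GL_I[OF _ _ top_factor_inverse[OF mats_carrier[OF X]]]
      GL_I[OF _ _ top_factor_inverse(2,1)[OF mats_carrier[OF X]]] 1 2 by (simp_all add: add.assoc)
qed

end

lemma last_block_Suc: "last_block (Suc k) n = 0\<^sub>m n n @\<^sub>r last_block k n"
  unfolding last_block_def by (rule eq_matI; simp add: append_rows_index; auto)

lemma uminus_zero_mat [simp]: "- 0\<^sub>m a b = (0\<^sub>m a b :: 'a :: group_add mat)"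
  by (rule eq_matI) simp_all

lemma last_block_carrier [simp]: "last_block k n \<in> carrier_mat (n + k * n) n"
  by (rule carrier_matI) (simp_all add: last_block_def)

lemma dim_last_block [simp]: "dim_row (last_block k n) = n + k * n" "dim_col (last_block k n) = n"
  by (simp_all add: last_block_def)

lemma mult_four_block_square:
  fixes A1 :: "'a :: semiring_0 mat"
  assumes "A1 \<in> carrier_mat p p" "B1 \<in> carrier_mat p q" "C1 \<in> carrier_mat q p" "D1 \<in> carrier_mat q q"
    "A2 \<in> carrier_mat p p" "B2 \<in> carrier_mat p q" "C2 \<in> carrier_mat q p" "D2 \<in> carrier_mat q q"
  shows "four_block_mat A1 B1 C1 D1 * four_block_mat A2 B2 C2 D2 =
    four_block_mat (A1 * A2 + B1 * C2) (A1 * B2 + B1 * D2) (C1 * A2 + D1 * C2) (C1 * B2 + D1 * D2)"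
  by (rule mult_four_block_mat[OF assms])

lemma smult_smult_mat: "a \<cdot>\<^sub>m (b \<cdot>\<^sub>m A) = (a * b :: 'a :: comm_semiring_1) \<cdot>\<^sub>m A"
  by (rule eq_matI) (simp_all add: mult.assoc)

lemma minus_four_block_mat:
  fixes A1 :: "'a :: group_add mat"
  assumes "A1 \<in> carrier_mat p p" "B1 \<in> carrier_mat p q" "C1 \<in> carrier_mat q p" "D1 \<in> carrier_mat q q"
    "A2 \<in> carrier_mat p p" "B2 \<in> carrier_mat p q" "C2 \<in> carrier_mat q p" "D2 \<in> carrier_mat q q"
  shows "four_block_mat A1 B1 C1 D1 - four_block_mat A2 B2 C2 D2 =
    four_block_mat (A1 - A2) (B1 - B2) (C1 - C2) (D1 - D2)"
proof (rule eq_matI)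
  fix i j assume "i < dim_row (four_block_mat (A1 - A2) (B1 - B2) (C1 - C2) (D1 - D2))"
    "j < dim_col (four_block_mat (A1 - A2) (B1 - B2) (C1 - C2) (D1 - D2))"
  then have "i < p + q" "j < p + q" using assms by simp_all
  then show "(four_block_mat A1 B1 C1 D1 - four_block_mat A2 B2 C2 D2) $$ (i, j) =
    four_block_mat (A1 - A2) (B1 - B2) (C1 - C2) (D1 - D2) $$ (i, j)"
    using assms by (cases "i < p"; cases "j < p") simp_all
qed (use assms in simp_all)

lemma add_dsum:
  fixes A B C D :: "'a :: monoid_add mat"
  assumes "A \<in> carrier_mat p q" "C \<in> carrier_mat p q" "B \<in> carrier_mat r s" "D \<in> carrier_mat r s"
  shows "(A \<oplus>\<^sub>d B) + (C \<oplus>\<^sub>d D) = (A + C) \<oplus>\<^sub>d (B + D)"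
proof -
  have "(A \<oplus>\<^sub>d B) + (C \<oplus>\<^sub>d D) =
    four_block_mat (A + C) (0\<^sub>m p s + 0\<^sub>m p s) (0\<^sub>m r q + 0\<^sub>m r q) (B + D)"
    using assms unfolding dsum_def
    by (simp add: add_four_block_mat[where ?nr1.0 = p and ?nc1.0 = q and ?nr2.0 = r and ?nc2.0 = s])
  then show ?thesis using assms by (simp add: dsum_def)
qed

lemma smult_dsum: "a \<cdot>\<^sub>m (A \<oplus>\<^sub>d B) = (a \<cdot>\<^sub>m A) \<oplus>\<^sub>d (a \<cdot>\<^sub>m B :: 'a :: semiring_0 mat)"
  unfolding smult_mat_def by (rule dsum_map) simp

context coeff_ring
begin

lemma reducible_to_pad:
  assumes T: "T \<in> carrier_mat (n + k * n) (n + k * n)" and Z: "Z \<in> carrier_mat n n"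
    and x: "x \<in> carrier_mat (n + k * n) n" and y: "y \<in> carrier_mat (n + k * n) n"
    and red: "reducible_to S k n T x y Z"
  shows "reducible_to S (Suc k) n (1\<^sub>m n \<oplus>\<^sub>d T) (0\<^sub>m n n @\<^sub>r x) (0\<^sub>m n n @\<^sub>r y) Z"
proof -
  let ?N = "n + k * n"
  obtain U V where UV: "U \<in> GL S ?N" "V \<in> GL S ?N" "U * T * V = 1\<^sub>m (k * n) \<oplus>\<^sub>d Z"
    "U * x = last_block k n" "V\<^sup>T * y = last_block k n"
    using red unfolding reducible_to_def by blast
  note c = GL_carrier[OF UV(1)] GL_carrier[OF UV(2)] T Z x y
  note d [simp] = c[THEN carrier_matD(1)] c[THEN carrier_matD(2)]
  have U: "1\<^sub>m n \<oplus>\<^sub>d U \<in> GL S (n + Suc k * n)" and V: "1\<^sub>m n \<oplus>\<^sub>d V \<in> GL S (n + Suc k * n)"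
    using GL_dsum[OF GL_one[of n] UV(1)] GL_dsum[OF GL_one[of n] UV(2)] by simp_all
  have "(1\<^sub>m n \<oplus>\<^sub>d U) * (1\<^sub>m n \<oplus>\<^sub>d T) * (1\<^sub>m n \<oplus>\<^sub>d V) = 1\<^sub>m n \<oplus>\<^sub>d (U * T * V)"
    by (simp add: dsum_mult)
  also have "\<dots> = 1\<^sub>m (Suc k * n) \<oplus>\<^sub>d Z"
    by (simp add: UV(3) dsum_assoc[symmetric] dsum_one)
  finally have 1: "(1\<^sub>m n \<oplus>\<^sub>d U) * (1\<^sub>m n \<oplus>\<^sub>d T) * (1\<^sub>m n \<oplus>\<^sub>d V) = 1\<^sub>m (Suc k * n) \<oplus>\<^sub>d Z" .
  have 2: "(1\<^sub>m n \<oplus>\<^sub>d U) * (0\<^sub>m n n @\<^sub>r x) = last_block (Suc k) n"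
    by (simp add: dsum_append_rows UV(4) last_block_Suc)
  have 3: "(1\<^sub>m n \<oplus>\<^sub>d V)\<^sup>T * (0\<^sub>m n n @\<^sub>r y) = last_block (Suc k) n"
    by (simp add: dsum_transpose dsum_append_rows UV(5) last_block_Suc)
  show ?thesis unfolding reducible_to_def using U V 1 2 3 by blast
qed

text \<open>One step of Horner's scheme. Let the top factor \<open>Q\<close> stand on the right. After multiplication
  by the inverse of \<open>Q\<close> the top left block of the pencil is \<open>-I\<close>, and eliminating with it adds
  \<open>a\<^sup>2 D\<close> to the block \<open>- a X\<close> that remains: the leading coefficient of the smaller pencil
  is \<open>a D - X\<close>. Neither elimination touches a block column that vanishes in the first block.\<close>

lemma reducible_to_peel:
  assumes a: "a \<in> S" and D: "D \<in> mats S n n" and X: "X \<in> mats S n n"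
    and M: "M \<in> carrier_mat (n + k * n) (n + k * n)" and Z: "Z \<in> carrier_mat n n"
    and x: "x \<in> carrier_mat (n + k * n) n" and y: "y \<in> carrier_mat (n + k * n) n"
    and red: "reducible_to S k n (a \<cdot>\<^sub>m ((a \<cdot>\<^sub>m D - X) \<oplus>\<^sub>d 1\<^sub>m (k * n)) - M) x y Z"
  shows "reducible_to S (Suc k) n
    (a \<cdot>\<^sub>m (D \<oplus>\<^sub>d 1\<^sub>m (n + k * n)) - (1\<^sub>m n \<oplus>\<^sub>d M) * top_factor (k * n) n X)
    (0\<^sub>m n n @\<^sub>r x) ((top_factor (k * n) n X)\<^sup>T * (0\<^sub>m n n @\<^sub>r y)) Z"
proof -
  let ?N = "n + k * n"
  (* T * Qi has the blocks -I and a D J^T in the first row and a J below -I; L clears the column and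
     R the row. R is an involution because of the sign of its first block. *)
  define J where "J = (first_block (k * n) n :: 'a mat)"
  define Q where "Q = top_factor (k * n) n X"
  define Qi where "Qi = top_factor_inv (k * n) n (- X)"
  define W where "W = (- X) \<oplus>\<^sub>d 1\<^sub>m (k * n)"
  define B where "B = a \<cdot>\<^sub>m (D * J\<^sup>T)"
  define T' where "T' = a \<cdot>\<^sub>m ((a \<cdot>\<^sub>m D - X) \<oplus>\<^sub>d 1\<^sub>m (k * n)) - M"
  define T where "T = a \<cdot>\<^sub>m (D \<oplus>\<^sub>d 1\<^sub>m ?N) - (1\<^sub>m n \<oplus>\<^sub>d M) * Q"
  define L where "L = four_block_mat (1\<^sub>m n) (0\<^sub>m n ?N) (- (a \<cdot>\<^sub>m J)) (1\<^sub>m ?N)"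
  define L' where "L' = four_block_mat (1\<^sub>m n) (0\<^sub>m n ?N) (a \<cdot>\<^sub>m J) (1\<^sub>m ?N)"
  define R where "R = four_block_mat (- 1\<^sub>m n) B (0\<^sub>m ?N n) (1\<^sub>m ?N)"
  have QGL: "Q \<in> GL S (n + ?N)" and QiGL: "Qi \<in> GL S (n + ?N)"
    unfolding Q_def Qi_def using top_factor_GL[OF X] by simp_all
  have QiQ: "Q * Qi = 1\<^sub>m (n + ?N)" "Qi * Q = 1\<^sub>m (n + ?N)"
    unfolding Q_def Qi_def by (rule top_factor_inverse[OF mats_carrier[OF X]])+
  have Jm: "J \<in> mats S ?N n"
    unfolding J_def by (intro mats_append_rows mats_one mats_zero)
  have Bm: "B \<in> mats S n ?N"
    unfolding B_def by (intro mats_smult a mats_mult[OF D] mats_transpose Jm)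
  have Lm: "L \<in> mats S (n + ?N) (n + ?N)" and L'm: "L' \<in> mats S (n + ?N) (n + ?N)"
    and Rm: "R \<in> mats S (n + ?N) (n + ?N)"
    unfolding L_def L'_def R_def
    by (intro mats_four_block mats_one mats_zero mats_uminus mats_smult a Jm Bm)+
  have c [simp]: "J \<in> carrier_mat ?N n" "B \<in> carrier_mat n ?N" "D \<in> carrier_mat n n" "X \<in> carrier_mat n n"
    using mats_carrier[OF Jm] mats_carrier[OF Bm] mats_carrier[OF D] mats_carrier[OF X] by auto
  have c2: "L \<in> carrier_mat (n + ?N) (n + ?N)" "R \<in> carrier_mat (n + ?N) (n + ?N)" 
    "Q \<in> carrier_mat (n + ?N) (n + ?N)"  "Qi \<in> carrier_mat (n + ?N) (n + ?N)"
    using mats_carrier[OF Lm] mats_carrier[OF Rm] GL_carrier[OF QGL] GL_carrier[OF QiGL] by auto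
  note d [simp] = c[THEN carrier_matD(1)] c[THEN carrier_matD(2)]
     c2[THEN carrier_matD(1)] c2[THEN carrier_matD(2)] M[THEN carrier_matD(1)] M[THEN carrier_matD(2)]
  have W [simp]: "W \<in> carrier_mat ?N ?N" unfolding W_def by (rule carrier_matI) simp_all
  have T' [simp]: "T' \<in> carrier_mat ?N ?N" unfolding T'_def by (rule carrier_matI) simp_all
  note d2 [simp] = W[THEN carrier_matD(1)] W[THEN carrier_matD(2)] T'[THEN carrier_matD(1)] T'[THEN carrier_matD(2)]
  have LL: "L * L' = 1\<^sub>m (n + ?N)" "L' * L = 1\<^sub>m (n + ?N)"
  proof -
    have [simp]: "- (a \<cdot>\<^sub>m J) + a \<cdot>\<^sub>m J = 0\<^sub>m ?N n" "a \<cdot>\<^sub>m J + - (a \<cdot>\<^sub>m J) = 0\<^sub>m ?N n"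
      by (rule eq_matI; simp)+
    show "L * L' = 1\<^sub>m (n + ?N)" "L' * L = 1\<^sub>m (n + ?N)"
      unfolding L_def L'_def
      by (subst mult_four_block_square[where p = n and q = ?N]; simp)+
  qed
  have RR: "R * R = 1\<^sub>m (n + ?N)"
  proof -
    have [simp]: "- 1\<^sub>m n * - 1\<^sub>m n + 0\<^sub>m n n = (1\<^sub>m n :: 'a mat)" 
      by (rule eq_matI) simp_all
    have [simp]: "- B + B = 0\<^sub>m n ?N" 
      by (rule eq_matI) simp_all
    show ?thesis
      unfolding R_def by (subst mult_four_block_square[where p = n and q = ?N]; simp)
  qed
  have LGL: "L \<in> GL S (n + ?N)" by (rule GL_I[OF Lm L'm LL])
  have RGL: "R \<in> GL S (n + ?N)" by (rule GL_I[OF Rm Rm RR RR])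
  have e1: "T * Qi = four_block_mat (- 1\<^sub>m n) B (a \<cdot>\<^sub>m J) (a \<cdot>\<^sub>m W - M)"
  proof -
    have "T * Qi = a \<cdot>\<^sub>m ((D \<oplus>\<^sub>d 1\<^sub>m ?N) * Qi) - (1\<^sub>m n \<oplus>\<^sub>d M) * (Q * Qi)"
      unfolding T_def
      by (subst minus_mult_distrib_mat[where nr = "n + ?N" and n = "n + ?N" and nc = "n + ?N"])
         (auto simp: mult_assoc_dim)
    also have "(D \<oplus>\<^sub>d 1\<^sub>m ?N) * Qi = four_block_mat (0\<^sub>m n n) (D * J\<^sup>T) J W"
    proof -
      have DJ: "D * J\<^sup>T \<in> carrier_mat n ?N" by (rule carrier_matI) simp_all
      have D1: "D \<oplus>\<^sub>d 1\<^sub>m ?N = four_block_mat D (0\<^sub>m n ?N) (0\<^sub>m ?N n) (1\<^sub>m ?N)" by (simp add: dsum_def)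
      show ?thesis
        unfolding Qi_def top_factor_inv_blocks[OF uminus_carrier_mat[OF c(4)]] J_def[symmetric] W_def[symmetric] D1
        by (subst mult_four_block_square[where p = n and q = ?N]) (use DJ in simp_all)
    qed
    also have "a \<cdot>\<^sub>m four_block_mat (0\<^sub>m n n) (D * J\<^sup>T) J W - (1\<^sub>m n \<oplus>\<^sub>d M) * (Q * Qi)
      = four_block_mat (- 1\<^sub>m n) B (a \<cdot>\<^sub>m J) (a \<cdot>\<^sub>m W - M)"
      
    proof -
      have DJ: "D * J\<^sup>T \<in> carrier_mat n ?N" by (rule carrier_matI) simp_all
      have 1: "(1\<^sub>m n \<oplus>\<^sub>d M) * (Q * Qi) = 1\<^sub>m n \<oplus>\<^sub>d M"
        unfolding QiQ by (rule right_mult_one_mat') simp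
      have 2: "1\<^sub>m n \<oplus>\<^sub>d M = four_block_mat (1\<^sub>m n) (0\<^sub>m n ?N) (0\<^sub>m ?N n) M"
        by (simp add: dsum_def)
      have 3: "0\<^sub>m n n - 1\<^sub>m n = (- 1\<^sub>m n :: 'a mat)" "a \<cdot>\<^sub>m J - 0\<^sub>m ?N n = a \<cdot>\<^sub>m J" "B - 0\<^sub>m n ?N = B"
        by (rule eq_matI; simp)+
      show ?thesis
        unfolding 1 unfolding 2 smult_four_block_mat[OF zero_carrier_mat DJ c(1) W] B_def[symmetric]
        by (subst minus_four_block_mat[where p = n and q = ?N]) (simp_all add: 3 M)
    qed
    finally show ?thesis .
  qed
  have e2: "L * ((1\<^sub>m n \<oplus>\<^sub>d T') * R) = four_block_mat (- 1\<^sub>m n) B (a \<cdot>\<^sub>m J) (a \<cdot>\<^sub>m W - M)"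
  proof -
    have "(1\<^sub>m n \<oplus>\<^sub>d T') * R = four_block_mat (- 1\<^sub>m n) B (0\<^sub>m ?N n) T'"
      unfolding R_def dsum_def
      by (subst mult_four_block_square[where p = n and q = ?N]) simp_all
    moreover have "- (a \<cdot>\<^sub>m J) * - 1\<^sub>m n = a \<cdot>\<^sub>m J" by (rule eq_matI) simp_all
    moreover have "- (a \<cdot>\<^sub>m J) * B + T' = a \<cdot>\<^sub>m W - M"
    proof -
      have DJ: "D * J\<^sup>T \<in> carrier_mat n ?N" by (rule carrier_matI) simp_all
      have "a \<cdot>\<^sub>m J * B = (a * a) \<cdot>\<^sub>m (J * (D * J\<^sup>T))"
        unfolding B_def using DJ
        by (simp add: mult_smult_distrib[OF smult_carrier_mat[OF c(1)] DJ] mult_smult_assoc_mat[OF c(1) DJ] smult_smult_mat)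
      also have "J * (D * J\<^sup>T) = D \<oplus>\<^sub>d 0\<^sub>m (k * n) (k * n)"
        unfolding J_def by (rule first_block_outer) simp
      finally have "- (a \<cdot>\<^sub>m J) * B = - ((a * a) \<cdot>\<^sub>m (D \<oplus>\<^sub>d 0\<^sub>m (k * n) (k * n)))"
        by simp
      then have "- (a \<cdot>\<^sub>m J) * B + T' = - ((a * a) \<cdot>\<^sub>m (D \<oplus>\<^sub>d 0\<^sub>m (k * n) (k * n))) + T'"
        by (simp only:)
      also have "\<dots> = a \<cdot>\<^sub>m W - M"

      proof -
        have "a \<cdot>\<^sub>m ((a \<cdot>\<^sub>m D - X) \<oplus>\<^sub>d 1\<^sub>m (k * n)) = a \<cdot>\<^sub>m W + (a * a) \<cdot>\<^sub>m (D \<oplus>\<^sub>d 0\<^sub>m (k * n) (k * n))"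
        proof -
          have "a \<cdot>\<^sub>m (a \<cdot>\<^sub>m D - X) = a \<cdot>\<^sub>m (- X) + (a * a) \<cdot>\<^sub>m D"
            by (rule eq_matI) (simp_all add: right_diff_distrib mult.assoc)
          then show ?thesis unfolding W_def smult_dsum
            by (subst add_dsum[where p = n and q = n and r = "k * n" and s = "k * n"]) simp_all
        qed
        moreover have "- P + ((V + P) - M) = V - M"
          if "P \<in> carrier_mat ?N ?N" "V \<in> carrier_mat ?N ?N" for P V :: "'a mat"
          using that by (intro eq_matI) simp_all
        ultimately show ?thesis unfolding T'_def by simp
      qed
      finally show ?thesis .
    qed
    ultimately show ?thesis unfolding L_def
      by (simp) (subst mult_four_block_square[where p = n and q = ?N]; simp)
  qed
  have "T = T * (Qi * Q)" unfolding QiQ T_def by simp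
  also have "\<dots> = T * Qi * Q" by (simp add: mult_assoc_dim T_def)
  also have "\<dots> = L * ((1\<^sub>m n \<oplus>\<^sub>d T') * R) * Q" unfolding e1 e2 ..
  also have "\<dots> = L * (1\<^sub>m n \<oplus>\<^sub>d T') * (R * Q)" by (simp add: mult_assoc_dim)
  finally have Teq: "T = L * (1\<^sub>m n \<oplus>\<^sub>d T') * (R * Q)" .
  have [simp]: "dim_row x = ?N" "dim_col x = n" "dim_row y = ?N" "dim_col y = n" using x y by auto
  have Lx: "L * (0\<^sub>m n n @\<^sub>r x) = 0\<^sub>m n n @\<^sub>r x"
    unfolding L_def
    by (subst four_block_append_rows[where a = n and b = ?N and p = n and q = ?N and k = n]) 
       (use x in \<open>simp_all add: left_mult_one_mat'\<close>)
  have RT: "R\<^sup>T = four_block_mat (- 1\<^sub>m n) (0\<^sub>m n ?N) (B\<^sup>T) (1\<^sub>m ?N)"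
    unfolding R_def by (rule eq_matI) simp_all
  have Ry: "R\<^sup>T * (0\<^sub>m n n @\<^sub>r y) = 0\<^sub>m n n @\<^sub>r y"
    unfolding RT by (subst four_block_append_rows[where a = n and b = ?N and p = n and q = ?N and k = n]) 
       (use y in \<open>simp_all add: left_mult_one_mat'\<close>)
  have 4: "reducible_to S (Suc k) n (L * (1\<^sub>m n \<oplus>\<^sub>d T') * (R * Q)) (L * (0\<^sub>m n n @\<^sub>r x))
     ((R * Q)\<^sup>T * (0\<^sub>m n n @\<^sub>r y)) Z"
  proof (rule reducible_to_equiv)
    show "L \<in> GL S (n + Suc k * n)" using LGL by simp
    show "R * Q \<in> GL S (n + Suc k * n)" using GL_mult[OF RGL QGL] by simp
    show "1\<^sub>m n \<oplus>\<^sub>d T' \<in> carrier_mat (n + Suc k * n) (n + Suc k * n)" by (rule carrier_matI) simp_all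
    show "0\<^sub>m n n @\<^sub>r x \<in> carrier_mat (n + Suc k * n) n" by (rule carrier_matI) simp_all
    show "0\<^sub>m n n @\<^sub>r y \<in> carrier_mat (n + Suc k * n) n" by (rule carrier_matI) simp_all
    show "reducible_to S (Suc k) n (1\<^sub>m n \<oplus>\<^sub>d T') (0\<^sub>m n n @\<^sub>r x) (0\<^sub>m n n @\<^sub>r y) Z"
      by (rule reducible_to_pad[OF T' Z x y red[folded T'_def]])
  qed
  have 5: "(R * Q)\<^sup>T * (0\<^sub>m n n @\<^sub>r y) = Q\<^sup>T * (0\<^sub>m n n @\<^sub>r y)"
    by (simp add: transpose_mult_dim mult_assoc_dim Ry)
  show ?thesis using 4 unfolding Teq[symmetric] Lx 5 unfolding T_def Q_def .
qed

end

section \<open>Products of elementary matrices\<close>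

lemma dsum_uminus: "- (A \<oplus>\<^sub>d B) = (- A) \<oplus>\<^sub>d (- B :: 'a :: group_add mat)"
  by (rule eq_matI) (simp_all add: dsum_def)

text \<open>Elementary matrices over an arbitrary coefficient ring: Horner's scheme is applied over the
  polynomials and over the proper rational functions, and reversal exchanges the two signs.\<close>

fun gelem :: "nat \<Rightarrow> nat \<Rightarrow> index \<Rightarrow> 'a :: {zero,one} mat \<Rightarrow> 'a mat" where
  "gelem m n (PosI i) X =
     (if i = 0 then 1\<^sub>m ((m - 1) * n) \<oplus>\<^sub>d X
      else 1\<^sub>m ((m - i - 1) * n) \<oplus>\<^sub>d four_block_mat X (1\<^sub>m n) (1\<^sub>m n) (0\<^sub>m n n) \<oplus>\<^sub>d 1\<^sub>m ((i - 1) * n))"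
| "gelem m n (NegI i) X =
     (if i = m then X \<oplus>\<^sub>d 1\<^sub>m ((m - 1) * n)
      else 1\<^sub>m ((m - i - 1) * n) \<oplus>\<^sub>d four_block_mat (0\<^sub>m n n) (1\<^sub>m n) (1\<^sub>m n) X \<oplus>\<^sub>d 1\<^sub>m ((i - 1) * n))"

declare gelem.simps [simp del]

lemma elem_mat_eq_gelem: "elem_mat m n s X = gelem m n s X"
  by (cases s) (simp_all only: elem_mat.simps gelem.simps diag2_eq_dsum diag3_eq_dsum)

lemma block_count:
  fixes n :: nat
  assumes "0 < i" "i < m"
  shows "(m - i - 1) * n + (n + n + (i - 1) * n) = m * n"
proof -
  have "m = (m - i - 1) + (1 + 1 + (i - 1))" using assms by simp
  then have "m * n = ((m - i - 1) + (1 + 1 + (i - 1))) * n" by metis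
  then show ?thesis by (simp only: add_mult_distrib mult_1)
qed

lemma gelem_pos_dim:
  assumes "i < m" "X \<in> carrier_mat n n"
  shows "gelem m n (PosI i) X \<in> carrier_mat (m * n) (m * n)"
proof (cases "i = 0")
  case True
  have "(m - 1) * n + n = m * n" using assms(1) by (cases m) simp_all
  then show ?thesis using True assms by (intro carrier_matI) (simp_all add: gelem.simps)
next
  case False
  then show ?thesis using assms(2) block_count[of i m n] assms(1) 
    by (intro carrier_matI) (simp_all add: add.assoc gelem.simps)
qed

text \<open>Adding a block in front changes none of the factors with smaller index; this makes induction
  on the number of blocks possible.\<close>

lemma gelem_pos_Suc:
  assumes "i < m"
  shows "gelem (Suc m) n (PosI i) X = 1\<^sub>m n \<oplus>\<^sub>d gelem m n (PosI i) X"
proof -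
  have "(Suc m - i - 1) * n = n + (m - i - 1) * n" "(Suc m - 1) * n = n + (m - 1) * n"
    using assms by (cases "m - i"; cases m; simp)+
  then show ?thesis by (simp add: gelem.simps dsum_one[symmetric] dsum_assoc del: diff_Suc_Suc)
qed

lemma gelem_top: "gelem (Suc (Suc k)) n (PosI (Suc k)) X = top_factor (k * n) n X"
  by (simp add: top_factor_def gelem.simps)

lemma gelem_pos_transpose:
  assumes "X \<in> carrier_mat n n"
  shows "(gelem m n (PosI i) X)\<^sup>T = gelem m n (PosI i) (X\<^sup>T)"
proof -
  have "(four_block_mat X (1\<^sub>m n) (1\<^sub>m n) (0\<^sub>m n n))\<^sup>T = four_block_mat (X\<^sup>T) (1\<^sub>m n) (1\<^sub>m n) (0\<^sub>m n n)"
    using transpose_four_block_mat[OF assms one_carrier_mat one_carrier_mat zero_carrier_mat] by simp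
  then show ?thesis by (simp add: gelem.simps dsum_transpose)
qed

definition pprod :: "nat \<Rightarrow> nat \<Rightarrow> (nat \<Rightarrow> 'a :: semiring_1 mat) \<Rightarrow> nat list \<Rightarrow> 'a mat" where
  "pprod m n X \<alpha> = prod_mats (m * n) (map (\<lambda>i. gelem m n (PosI i) (X i)) \<alpha>)"

lemma pprod_Nil [simp]: "pprod m n X [] = 1\<^sub>m (m * n)"
  and pprod_Cons: "pprod m n X (i # \<alpha>) = gelem m n (PosI i) (X i) * pprod m n X \<alpha>"
  by (simp_all add: pprod_def prod_mats_def)

lemma pprod_carrier:
  assumes "set \<alpha> \<subseteq> {..<m}" "\<And>i. i < m \<Longrightarrow> X i \<in> carrier_mat n n"
  shows "pprod m n X \<alpha> \<in> carrier_mat (m * n) (m * n)"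
  using assms(1)
proof (induction \<alpha>)
  case (Cons i \<alpha>)
  then show ?case using gelem_pos_dim[of i m "X i" n] assms(2)[of i]
    by (auto simp: pprod_Cons intro!: mult_carrier_mat[where n = "m * n"])
qed simp

lemma pprod_append:
  assumes "set \<alpha> \<subseteq> {..<m}" "set \<beta> \<subseteq> {..<m}" "\<And>i. i < m \<Longrightarrow> X i \<in> carrier_mat n n"
  shows "pprod m n X (\<alpha> @ \<beta>) = pprod m n X \<alpha> * pprod m n X \<beta>"
  using assms(1)
proof (induction \<alpha>)
  case Nil
  then show ?case using pprod_carrier[OF assms(2), of X n] assms(3) by (simp add: left_mult_one_mat)
next
  case (Cons i \<alpha>)
  have "gelem m n (PosI i) (X i) \<in> carrier_mat (m * n) (m * n)"
    using Cons.prems by (intro gelem_pos_dim assms(3)) auto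
  moreover have "pprod m n X \<alpha> \<in> carrier_mat (m * n) (m * n)"
    using Cons.prems by (intro pprod_carrier assms(3)) auto
  ultimately show ?case using Cons pprod_carrier[OF assms(2), of X n] assms(3)
    by (simp add: pprod_Cons assoc_mult_mat[of _ "m * n" "m * n" _ "m * n" _ "m * n"])
qed

lemma pprod_pad:
  assumes "set \<alpha> \<subseteq> {..k}" "\<And>i. i \<le> k \<Longrightarrow> X i \<in> carrier_mat n n"
  shows "pprod (Suc (Suc k)) n X \<alpha> = 1\<^sub>m n \<oplus>\<^sub>d pprod (Suc k) n X \<alpha>"
  using assms(1)
proof (induction \<alpha>)
  case (Cons i \<alpha>)
  have "gelem (Suc k) n (PosI i) (X i) \<in> carrier_mat (Suc k * n) (Suc k * n)"
    using Cons.prems by (intro gelem_pos_dim assms(2)) auto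
  moreover have "pprod (Suc k) n X \<alpha> \<in> carrier_mat (Suc k * n) (Suc k * n)"
    using Cons.prems by (intro pprod_carrier assms(2)) auto
  ultimately show ?case using Cons
    by (simp add: pprod_Cons gelem_pos_Suc dsum_mult)
qed (simp add: dsum_one)

lemma pprod_pad2:
  assumes "set \<alpha> \<subseteq> {..<k}" "\<And>i. i < k \<Longrightarrow> X i \<in> carrier_mat n n"
  shows "pprod (Suc (Suc k)) n X \<alpha> = 1\<^sub>m (n + n) \<oplus>\<^sub>d pprod k n X \<alpha>"
  using assms(1)
proof (induction \<alpha>)
  case (Cons i \<alpha>)
  have "gelem k n (PosI i) (X i) \<in> carrier_mat (k * n) (k * n)"
    using Cons.prems by (intro gelem_pos_dim assms(2)) auto
  moreover have "pprod k n X \<alpha> \<in> carrier_mat (k * n) (k * n)"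
    using Cons.prems by (intro pprod_carrier assms(2)) auto
  moreover have "gelem (Suc (Suc k)) n (PosI i) (X i) = 1\<^sub>m (n + n) \<oplus>\<^sub>d gelem k n (PosI i) (X i)"
    using Cons.prems by (simp add: gelem_pos_Suc dsum_one[symmetric] dsum_assoc)
  ultimately show ?case using Cons
    by (simp add: pprod_Cons dsum_mult)
qed (simp add: dsum_one add.assoc)

text \<open>Elementary matrices whose indices differ by at least two act on disjoint blocks.\<close>

lemma pprod_top_commute:
  assumes "set \<alpha> \<subseteq> {..<k}" "\<And>i. i < k \<Longrightarrow> X i \<in> carrier_mat n n" "Y \<in> carrier_mat n n"
  shows "top_factor (k * n) n Y * pprod (Suc (Suc k)) n X \<alpha> = pprod (Suc (Suc k)) n X \<alpha> * top_factor (k * n) n Y"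
proof -
  have "pprod k n X \<alpha> \<in> carrier_mat (k * n) (k * n)"
    using assms by (intro pprod_carrier)
  moreover have "four_block_mat Y (1\<^sub>m n) (1\<^sub>m n) (0\<^sub>m n n) \<in> carrier_mat (n + n) (n + n)"
    using assms(3) by simp
  ultimately show ?thesis using assms(3)
    by (simp add: pprod_pad2[OF assms(1,2)] top_factor_def dsum_mult)
qed

lemma pprod_transpose:
  fixes X :: "nat \<Rightarrow> 'a :: comm_ring_1 mat"
  assumes "set \<alpha> \<subseteq> {..<m}" "\<And>i. i < m \<Longrightarrow> X i \<in> carrier_mat n n"
  shows "(pprod m n X \<alpha>)\<^sup>T = pprod m n (\<lambda>i. (X i)\<^sup>T) (rev \<alpha>)"
  using assms(1)
proof (induction \<alpha>)
  case (Cons i \<alpha>)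
  have X: "X i \<in> carrier_mat n n" using Cons.prems assms(2) by auto
  have 1: "gelem m n (PosI i) (X i) \<in> carrier_mat (m * n) (m * n)"
    "gelem m n (PosI i) ((X i)\<^sup>T) \<in> carrier_mat (m * n) (m * n)"
    using Cons.prems X by (auto intro!: gelem_pos_dim)
  have 2: "pprod m n X \<alpha> \<in> carrier_mat (m * n) (m * n)"
    using Cons.prems by (intro pprod_carrier assms(2)) auto
  have "(pprod m n X (i # \<alpha>))\<^sup>T = (pprod m n X \<alpha>)\<^sup>T * (gelem m n (PosI i) (X i))\<^sup>T"
    unfolding pprod_Cons by (rule transpose_mult[OF 1(1) 2])
  also have "\<dots> = pprod m n (\<lambda>i. (X i)\<^sup>T) (rev \<alpha>) * pprod m n (\<lambda>i. (X i)\<^sup>T) [i]"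
    using Cons 1 by (simp add: pprod_Cons gelem_pos_transpose[OF X])
  also have "\<dots> = pprod m n (\<lambda>i. (X i)\<^sup>T) (rev (i # \<alpha>))"
    using Cons.prems assms(2) by (simp add: pprod_append)
  finally show ?case .
qed simp

lemma top_factor_carrier: "X \<in> carrier_mat n n \<Longrightarrow> top_factor l n X \<in> carrier_mat (n + (n + l)) (n + (n + l))"
  unfolding top_factor_def by (rule carrier_matI) simp_all

lemma top_factor_transpose:
  "X \<in> carrier_mat n n \<Longrightarrow> (top_factor (k * n) n X)\<^sup>T = top_factor (k * n) n (X\<^sup>T)"
  unfolding gelem_top[symmetric] by (rule gelem_pos_transpose)

lemma top_factor_last_block:
  fixes X :: "'a :: comm_ring_1 mat"
  assumes "X \<in> carrier_mat n n"
  shows "top_factor (Suc k * n) n X * last_block (Suc (Suc k)) n = last_block (Suc (Suc k)) n"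
proof -
  have 1: "last_block (Suc (Suc k)) n = 0\<^sub>m (n + n) n @\<^sub>r last_block k n"
    unfolding last_block_def by (rule eq_matI; simp add: append_rows_index; auto)
  have "four_block_mat X (1\<^sub>m n) (1\<^sub>m n) (0\<^sub>m n n) * 0\<^sub>m (n + n) n = 0\<^sub>m (n + n) n"
    by (rule right_mult_zero_mat, rule carrier_matI) (use assms in simp_all)
  then show ?thesis unfolding 1 top_factor_def using assms
    by (subst dsum_append_rows) (simp_all add: left_mult_one_mat')
qed

text \<open>The polynomial with leading coefficient \<open>D\<close> and lower coefficients \<open>- X_l\<close>, evaluated at \<open>a\<close>.\<close>

definition horner :: "nat \<Rightarrow> nat \<Rightarrow> 'a :: comm_ring_1 \<Rightarrow> (nat \<Rightarrow> 'a mat) \<Rightarrow> 'a mat \<Rightarrow> 'a mat" where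
  "horner k n a X D = mat n n (\<lambda>ij. a ^ Suc k * D $$ ij - (\<Sum>l\<le>k. a ^ l * X l $$ ij))"

lemma horner_carrier [simp]: "horner k n a X D \<in> carrier_mat n n"
  by (simp add: horner_def)

lemma horner_Suc:
  assumes "D \<in> carrier_mat n n" "X (Suc k) \<in> carrier_mat n n"
  shows "horner k n a X (a \<cdot>\<^sub>m D - X (Suc k)) = horner (Suc k) n a X D"
  unfolding horner_def using assms by (intro eq_matI) (simp_all add: algebra_simps)

lemma horner_transpose:
  assumes "D \<in> carrier_mat n n" "\<And>i. i \<le> k \<Longrightarrow> X i \<in> carrier_mat n n"
  shows "(horner k n a X D)\<^sup>T = horner k n a (\<lambda>i. (X i)\<^sup>T) D\<^sup>T"
proof (rule eq_matI)
  fix i j assume "i < dim_row (horner k n a (\<lambda>i. (X i)\<^sup>T) D\<^sup>T)" "j < dim_col (horner k n a (\<lambda>i. (X i)\<^sup>T) D\<^sup>T)"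
  then have ij: "i < n" "j < n" by (simp_all add: horner_def)
  have "(\<Sum>l\<le>k. a ^ l * (X l)\<^sup>T $$ (i, j)) = (\<Sum>l\<le>k. a ^ l * X l $$ (j, i))"
    using ij assms(2) by (intro sum.cong refl) (metis atMost_iff carrier_matD index_transpose_mat(1))
  then show "(horner k n a X D)\<^sup>T $$ (i, j) = horner k n a (\<lambda>i. (X i)\<^sup>T) D\<^sup>T $$ (i, j)"
    using ij assms(1) by (simp add: horner_def)
qed (simp_all add: horner_def)

context coeff_ring
begin

text \<open>The Fiedler pencil of the permutation \<open>(u, 0, v)\<close>. The block column and the block row that
  go with it are obtained by letting the factors on either side of \<open>M_0\<close> act on the last block.\<close>

definition fiedler_reducible :: "nat \<Rightarrow> nat \<Rightarrow> 'a \<Rightarrow> (nat \<Rightarrow> 'a mat) \<Rightarrow> 'a mat \<Rightarrow> nat list \<Rightarrow> nat list \<Rightarrow> bool" where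
  "fiedler_reducible k n a X D u v \<longleftrightarrow> reducible_to S k n
     (a \<cdot>\<^sub>m (D \<oplus>\<^sub>d 1\<^sub>m (k * n)) - pprod (Suc k) n X (u @ 0 # v))
     (pprod (Suc k) n X u * last_block k n) ((pprod (Suc k) n X v)\<^sup>T * last_block k n)
     (horner k n a X D)"

lemma fiedler_reducible_transpose:
  assumes X: "\<And>i. i \<le> k \<Longrightarrow> X i \<in> carrier_mat n n" and D: "D \<in> carrier_mat n n"
    and s: "set (u @ 0 # v) \<subseteq> {..k}"
    and red: "fiedler_reducible k n a X D u v"
  shows "fiedler_reducible k n a (\<lambda>i. (X i)\<^sup>T) D\<^sup>T (rev v) (rev u)"
proof -
  have s': "set (u @ 0 # v) \<subseteq> {..<Suc k}" "set u \<subseteq> {..<Suc k}" "set v \<subseteq> {..<Suc k}" using s by auto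
  have X': "\<And>i. i < Suc k \<Longrightarrow> X i \<in> carrier_mat n n" using X by simp
  have P: "pprod (Suc k) n X (u @ 0 # v) \<in> carrier_mat (Suc k * n) (Suc k * n)"
    by (rule pprod_carrier[OF s'(1) X'])
  have Dk: "D \<oplus>\<^sub>d 1\<^sub>m (k * n) \<in> carrier_mat (Suc k * n) (Suc k * n)"
    using D by (intro carrier_matI) simp_all
  have "(a \<cdot>\<^sub>m (D \<oplus>\<^sub>d 1\<^sub>m (k * n)) - pprod (Suc k) n X (u @ 0 # v))\<^sup>T
      = a \<cdot>\<^sub>m (D \<oplus>\<^sub>d 1\<^sub>m (k * n))\<^sup>T - (pprod (Suc k) n X (u @ 0 # v))\<^sup>T"
    using P D by (intro eq_matI) simp_all
  also have "(D \<oplus>\<^sub>d 1\<^sub>m (k * n))\<^sup>T = D\<^sup>T \<oplus>\<^sub>d 1\<^sub>m (k * n)" by (simp add: dsum_transpose)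
  also have "(pprod (Suc k) n X (u @ 0 # v))\<^sup>T = pprod (Suc k) n (\<lambda>i. (X i)\<^sup>T) (rev v @ 0 # rev u)"
    by (subst pprod_transpose[OF s'(1) X']) simp_all
  finally have T: "(a \<cdot>\<^sub>m (D \<oplus>\<^sub>d 1\<^sub>m (k * n)) - pprod (Suc k) n X (u @ 0 # v))\<^sup>T
      = a \<cdot>\<^sub>m (D\<^sup>T \<oplus>\<^sub>d 1\<^sub>m (k * n)) - pprod (Suc k) n (\<lambda>i. (X i)\<^sup>T) (rev v @ 0 # rev u)" .
  have u0: "(pprod (Suc k) n X u)\<^sup>T = pprod (Suc k) n (\<lambda>i. (X i)\<^sup>T) (rev u)"
    by (rule pprod_transpose[OF s'(2) X'])
  have u: "pprod (Suc k) n X u = (pprod (Suc k) n (\<lambda>i. (X i)\<^sup>T) (rev u))\<^sup>T"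
    by (simp only: u0[symmetric] transpose_transpose)
  have v: "pprod (Suc k) n (\<lambda>i. (X i)\<^sup>T) (rev v) = (pprod (Suc k) n X v)\<^sup>T"
    by (rule pprod_transpose[OF s'(3) X', symmetric])
  have h: "(horner k n a X D)\<^sup>T = horner k n a (\<lambda>i. (X i)\<^sup>T) D\<^sup>T"
    by (rule horner_transpose[OF D X])
  have "a \<cdot>\<^sub>m (D \<oplus>\<^sub>d 1\<^sub>m (k * n)) - pprod (Suc k) n X (u @ 0 # v) \<in> carrier_mat (n + k * n) (n + k * n)"
    using P Dk by (intro carrier_matI) simp_all
  from reducible_to_transpose[OF this red[unfolded fiedler_reducible_def]]
  show ?thesis
    unfolding fiedler_reducible_def T u v h .
qed

end

section \<open>Fiedler pencils\<close>

lemma horner_0: 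
  assumes "D \<in> carrier_mat n n" "X 0 \<in> carrier_mat n n"
  shows "horner 0 n a X D = a \<cdot>\<^sub>m D - X 0"
  unfolding horner_def using assms by (intro eq_matI) simp_all

context coeff_ring
begin

text \<open>The index \<open>k + 1\<close> is assumed to stand to the left of \<open>0\<close>; the other case follows by
  transposition. The factor with this index commutes with all others except the one with index \<open>k\<close>, so
  it can be moved to the far right if \<open>k\<close> stands to its left, and to the far left otherwise.\<close>

lemma fiedler_reducible_step:
  assumes a: "a \<in> S" and D: "D \<in> mats S n n"
    and X: "\<And>i. i \<le> Suc k \<Longrightarrow> X i \<in> mats S n n"
    and dist: "distinct (u1 @ Suc k # u2 @ 0 # v)" and set: "set (u1 @ Suc k # u2 @ 0 # v) = {..Suc k}"
    and IH: "\<And>D X u v. D \<in> mats S n n \<Longrightarrow> (\<And>i. i \<le> k \<Longrightarrow> X i \<in> mats S n n) \<Longrightarrow> distinct (u @ 0 # v) \<Longrightarrow>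
       set (u @ 0 # v) = {..k} \<Longrightarrow> fiedler_reducible k n a X D u v"
  shows "fiedler_reducible (Suc k) n a X D (u1 @ Suc k # u2) v"
proof -
  define Q where "Q = top_factor (k * n) n (X (Suc k))"
  let ?P = "pprod (Suc (Suc k)) n X" and ?p = "pprod (Suc k) n X" and ?N = "n + k * n"
  let ?D' = "a \<cdot>\<^sub>m D - X (Suc k)"
  define M where "M = ?p (u1 @ u2 @ 0 # v)"
  define x where "x = ?p (u1 @ u2) * last_block k n"
  define y where "y = (?p v)\<^sup>T * last_block k n"
  note Dc = mats_carrier[OF D]
  have Xc: "\<And>i. i < Suc (Suc k) \<Longrightarrow> X i \<in> carrier_mat n n" "\<And>i. i < Suc k \<Longrightarrow> X i \<in> carrier_mat n n"
    "\<And>i. i \<le> k \<Longrightarrow> X i \<in> carrier_mat n n" "\<And>i. i < k \<Longrightarrow> X i \<in> carrier_mat n n"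
    by (rule mats_carrier[OF X]; simp)+
  have XS: "X (Suc k) \<in> mats S n n" "X (Suc k) \<in> carrier_mat n n"
    using X[of "Suc k"] mats_carrier[OF X[of "Suc k"]] by simp_all
  have setk: "set (u1 @ u2 @ 0 # v) = {..k}"
  proof -
    have "set (u1 @ u2 @ 0 # v) = set (u1 @ Suc k # u2 @ 0 # v) - {Suc k}" using dist by auto
    also have "\<dots> = {..k}" unfolding set by auto
    finally show ?thesis .
  qed
  have sub: "set u1 \<subseteq> {..k}" "set u2 \<subseteq> {..k}" "set v \<subseteq> {..k}" "set (u1 @ u2) \<subseteq> {..k}" "set (0 # v) \<subseteq> {..k}"
    "set (u2 @ 0 # v) \<subseteq> {..k}" "set (u1 @ u2 @ 0 # v) \<subseteq> {..k}"
    unfolding setk[symmetric] by auto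
  have lt: "set w \<subseteq> {..<Suc (Suc k)}" "set w \<subseteq> {..<Suc k}" if "set w \<subseteq> {..k}" for w
    using that by (auto simp: less_Suc_eq_le)
  have below: "set w \<subseteq> {..<k}" if "set w \<subseteq> {..k}" "k \<notin> set w" for w
  proof
    fix x assume "x \<in> set w"
    then have "x \<le> k" "x \<noteq> k" using that by auto
    then show "x \<in> {..<k}" by simp
  qed
  have pad: "?P w = 1\<^sub>m n \<oplus>\<^sub>d ?p w" if "set w \<subseteq> {..k}" for w
    by (rule pprod_pad[OF that Xc(3)])
  have pc: "?p w \<in> carrier_mat ?N ?N" if "set w \<subseteq> {..k}" for w
    using pprod_carrier[of w "Suc k" X n, OF lt(2)[OF that] Xc(2)] by simp
  have Pc: "?P w \<in> carrier_mat (n + ?N) (n + ?N)" if "set w \<subseteq> {..k}" for w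
    using pprod_carrier[of w "Suc (Suc k)" X n, OF lt(1)[OF that] Xc(1)] by simp
  have Pd [simp]: "dim_row (?P w) = n + ?N" "dim_col (?P w) = n + ?N" if "set w \<subseteq> {..k}" for w
    using Pc[OF that] by auto
  have pd [simp]: "dim_row (?p w) = ?N" "dim_col (?p w) = ?N" if "set w \<subseteq> {..k}" for w
    using pc[OF that] by auto
  have Papp: "?P (w @ w') = ?P w * ?P w'" if "set w \<subseteq> {..Suc k}" "set w' \<subseteq> {..Suc k}" for w w'
    using that by (intro pprod_append Xc(1)) (auto simp: less_Suc_eq_le)
  have Qc: "Q \<in> carrier_mat (n + ?N) (n + ?N)" unfolding Q_def by (rule top_factor_carrier[OF XS(2)])
  have Qd [simp]: "dim_row Q = n + ?N" "dim_col Q = n + ?N" using Qc by auto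
  have PQ: "?P [Suc k] = Q" 
    using Qc by (simp add: pprod_Cons gelem_top Q_def)
  have le: "set w \<subseteq> {..Suc k}" if "set w \<subseteq> {..k}" for w using that by auto
  have Pk: "?P (Suc k # w) = Q * ?P w" if "set w \<subseteq> {..k}" for w
    using Papp[of "[Suc k]" w] le[OF that] PQ by simp
  have Pk': "?P (w' @ Suc k # w) = ?P w' * (Q * ?P w)" if "set w' \<subseteq> {..k}" "set w \<subseteq> {..k}" for w w'
    using Papp[of w' "Suc k # w"] le[OF that(1)] le[OF that(2)] Pk[OF that(2)] by simp
  have Papp': "?P (w @ w') = ?P w * ?P w'" if "set w \<subseteq> {..k}" "set w' \<subseteq> {..k}" for w w'
    by (rule Papp[OF le[OF that(1)] le[OF that(2)]])
  have Pu: "?P (u1 @ Suc k # u2) = ?P u1 * (Q * ?P u2)" by (rule Pk'[OF sub(1,2)])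
  have Pall: "?P ((u1 @ Suc k # u2) @ 0 # v) = ?P u1 * (Q * ?P (u2 @ 0 # v))"
    using Pk'[OF sub(1,6)] by simp
  have lb: "?P w * last_block (Suc k) n = 0\<^sub>m n n @\<^sub>r (?p w * last_block k n)" if "set w \<subseteq> {..k}" for w
    unfolding pad[OF that] last_block_Suc using that by (subst dsum_append_rows) simp_all
  have lbT: "(?P w)\<^sup>T * last_block (Suc k) n = 0\<^sub>m n n @\<^sub>r ((?p w)\<^sup>T * last_block k n)" if "set w \<subseteq> {..k}" for w
    unfolding pad[OF that] last_block_Suc using that
    by (simp add: dsum_transpose dsum_append_rows)
  have comm: "Q * ?P w = ?P w * Q" if "set w \<subseteq> {..<k}" for w
    unfolding Q_def by (rule pprod_top_commute[OF that Xc(4) XS(2)])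
  have M: "M \<in> carrier_mat ?N ?N" unfolding M_def by (rule pc[OF sub(7)])
  have x: "x \<in> carrier_mat ?N n" unfolding x_def using sub by (intro carrier_matI) simp_all
  have y: "y \<in> carrier_mat ?N n" unfolding y_def using sub by (intro carrier_matI) simp_all
  have D': "?D' \<in> mats S n n" by (intro mats_minus mats_smult a D XS(1))
  have red: "reducible_to S k n (a \<cdot>\<^sub>m (?D' \<oplus>\<^sub>d 1\<^sub>m (k * n)) - M) x y (horner (Suc k) n a X D)"
  proof -
    have "fiedler_reducible k n a X ?D' (u1 @ u2) v"
    proof (rule IH[OF D'])
      show "X i \<in> mats S n n" if "i \<le> k" for i by (rule X) (use that in simp)
      show "distinct ((u1 @ u2) @ 0 # v)" using dist by simp
      show "set ((u1 @ u2) @ 0 # v) = {..k}" using setk by (simp only: append_assoc)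
    qed
    then show ?thesis
      unfolding fiedler_reducible_def M_def x_def y_def horner_Suc[of D n X k a, OF Dc XS(2)] by simp
  qed
  show ?thesis
  proof (cases "k \<in> set u1")
    case True
    (* In particular k is not 0, so the top factor fixes the last block and may also be inserted
       in front of it. *)
    then have k0: "k \<noteq> 0" "k \<notin> set u2" "k \<notin> set (0 # v)" using dist by auto
    then obtain k' where k': "k = Suc k'" by (cases k) auto
    have lt': "set u2 \<subseteq> {..<k}" "set v \<subseteq> {..<k}" "set (u2 @ 0 # v) \<subseteq> {..<k}" 
      by (rule below; use sub k0 in auto)+
    have e1: "?P ((u1 @ Suc k # u2) @ 0 # v) = (1\<^sub>m n \<oplus>\<^sub>d M) * Q"
      unfolding Pall comm[OF lt'(3)] M_def pad[OF sub(7), symmetric] Papp'[OF sub(1,6)]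
      by (rule mult_assoc_dim[symmetric]) (use sub in simp_all)
    have Ql: "Q * last_block (Suc k) n = last_block (Suc k) n" 
      unfolding Q_def k' by (rule top_factor_last_block) (use XS(2) k' in simp)
    have QTl: "Q\<^sup>T * last_block (Suc k) n = last_block (Suc k) n"
      unfolding Q_def top_factor_transpose[OF XS(2)] unfolding k' 
      by (rule top_factor_last_block) (use XS(2) k' in simp)
    have "?P (u1 @ Suc k # u2) * last_block (Suc k) n = ?P (u1 @ u2) * last_block (Suc k) n"
      unfolding Pu comm[OF lt'(1)] Papp'[OF sub(1,2)] using sub(1,2) by (simp add: mult_assoc_dim Ql)
    also have "\<dots> = 0\<^sub>m n n @\<^sub>r x" unfolding x_def by (rule lb[OF sub(4)])
    finally have e2: "?P (u1 @ Suc k # u2) * last_block (Suc k) n = 0\<^sub>m n n @\<^sub>r x" .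
    have "(?P v)\<^sup>T * last_block (Suc k) n = (?P v)\<^sup>T * (Q\<^sup>T * last_block (Suc k) n)" unfolding QTl by (rule refl)
    also have "\<dots> = (Q * ?P v)\<^sup>T * last_block (Suc k) n"
      using sub by (simp add: transpose_mult_dim mult_assoc_dim)
    also have "\<dots> = Q\<^sup>T * ((?P v)\<^sup>T * last_block (Suc k) n)"
      unfolding comm[OF lt'(2)] using sub by (simp add: transpose_mult_dim mult_assoc_dim)
    also have "\<dots> = Q\<^sup>T * (0\<^sub>m n n @\<^sub>r y)" unfolding y_def lbT[OF sub(3)] by (rule refl)
    finally have e3: "(?P v)\<^sup>T * last_block (Suc k) n = Q\<^sup>T * (0\<^sub>m n n @\<^sub>r y)" .
    show ?thesis
      using reducible_to_peel[OF a D XS(1) M horner_carrier x y red]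
      unfolding fiedler_reducible_def e1 e2 e3 Q_def by simp
  next
    case False
    have lt': "set u1 \<subseteq> {..<k}" by (rule below[OF sub(1) False])
    have e1: "?P ((u1 @ Suc k # u2) @ 0 # v) = Q * (1\<^sub>m n \<oplus>\<^sub>d M)"
    proof -
      have "?P u1 * (Q * ?P (u2 @ 0 # v)) = ?P u1 * Q * ?P (u2 @ 0 # v)"
        by (rule mult_assoc_dim[symmetric]) (use sub in simp_all)
      also have "\<dots> = Q * (?P u1 * ?P (u2 @ 0 # v))"
        unfolding comm[OF lt', symmetric] by (rule mult_assoc_dim) (use sub in simp_all)
      finally show ?thesis
        unfolding Pall M_def pad[OF sub(7), symmetric] Papp'[OF sub(1,6)] .
    qed
    have "?P (u1 @ Suc k # u2) = Q * ?P (u1 @ u2)"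
    proof -
      have "?P u1 * (Q * ?P u2) = ?P u1 * Q * ?P u2"
        by (rule mult_assoc_dim[symmetric]) (use sub in simp_all)
      also have "\<dots> = Q * (?P u1 * ?P u2)"
        unfolding comm[OF lt', symmetric] by (rule mult_assoc_dim) (use sub in simp_all)
      finally show ?thesis unfolding Pu Papp'[OF sub(1,2)] .
    qed
    then have "?P (u1 @ Suc k # u2) * last_block (Suc k) n = Q * (?P (u1 @ u2) * last_block (Suc k) n)"
      using sub by (simp add: mult_assoc_dim)
    then have e2: "?P (u1 @ Suc k # u2) * last_block (Suc k) n = Q * (0\<^sub>m n n @\<^sub>r x)"
      unfolding x_def lb[OF sub(4)] .
    have e3: "(?P v)\<^sup>T * last_block (Suc k) n = 0\<^sub>m n n @\<^sub>r y" unfolding y_def lbT[OF sub(3)] by (rule refl)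
    have redT: "reducible_to S k n (a \<cdot>\<^sub>m ((a \<cdot>\<^sub>m D\<^sup>T - (X (Suc k))\<^sup>T) \<oplus>\<^sub>d 1\<^sub>m (k * n)) - M\<^sup>T) y x (horner (Suc k) n a X D)\<^sup>T"
    proof -
      have "(a \<cdot>\<^sub>m (?D' \<oplus>\<^sub>d 1\<^sub>m (k * n)) - M)\<^sup>T = a \<cdot>\<^sub>m (?D' \<oplus>\<^sub>d 1\<^sub>m (k * n))\<^sup>T - M\<^sup>T"
        using M XS(2) by (intro eq_matI) simp_all
      also have "(?D' \<oplus>\<^sub>d 1\<^sub>m (k * n))\<^sup>T = ?D'\<^sup>T \<oplus>\<^sub>d 1\<^sub>m (k * n)" by (simp add: dsum_transpose)
      also have "?D'\<^sup>T = a \<cdot>\<^sub>m D\<^sup>T - (X (Suc k))\<^sup>T" using Dc XS(2) by (intro eq_matI) simp_all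
      finally have e: "(a \<cdot>\<^sub>m (?D' \<oplus>\<^sub>d 1\<^sub>m (k * n)) - M)\<^sup>T
         = a \<cdot>\<^sub>m ((a \<cdot>\<^sub>m D\<^sup>T - (X (Suc k))\<^sup>T) \<oplus>\<^sub>d 1\<^sub>m (k * n)) - M\<^sup>T" .
      show ?thesis
        using reducible_to_transpose[OF _ red] M XS(2) unfolding e by (simp add: minus_carrier_mat)
    qed
    have M': "M\<^sup>T \<in> carrier_mat ?N ?N" "(horner (Suc k) n a X D)\<^sup>T \<in> carrier_mat n n" using M by simp_all
    have r1: "reducible_to S (Suc k) n (a \<cdot>\<^sub>m (D\<^sup>T \<oplus>\<^sub>d 1\<^sub>m ?N) - (1\<^sub>m n \<oplus>\<^sub>d M\<^sup>T) * Q\<^sup>T)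
       (0\<^sub>m n n @\<^sub>r y) (Q * (0\<^sub>m n n @\<^sub>r x)) (horner (Suc k) n a X D)\<^sup>T"
      using reducible_to_peel[OF a mats_transpose[OF D] mats_transpose[OF XS(1)] M' y x redT]
      unfolding top_factor_transpose[OF XS(2), symmetric] Q_def by simp
    have r2: "a \<cdot>\<^sub>m (D\<^sup>T \<oplus>\<^sub>d 1\<^sub>m ?N) - (1\<^sub>m n \<oplus>\<^sub>d M\<^sup>T) * Q\<^sup>T
        = (a \<cdot>\<^sub>m (D \<oplus>\<^sub>d 1\<^sub>m ?N) - Q * (1\<^sub>m n \<oplus>\<^sub>d M))\<^sup>T" (is "_ = ?T\<^sup>T")
    proof -
      have e4: "(1\<^sub>m n \<oplus>\<^sub>d M\<^sup>T) * Q\<^sup>T = (Q * (1\<^sub>m n \<oplus>\<^sub>d M))\<^sup>T"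
        using M by (simp add: transpose_mult_dim dsum_transpose)
      have e5: "(a \<cdot>\<^sub>m (D \<oplus>\<^sub>d 1\<^sub>m ?N) - Y)\<^sup>T = a \<cdot>\<^sub>m (D \<oplus>\<^sub>d 1\<^sub>m ?N)\<^sup>T - Y\<^sup>T"
        if "Y \<in> carrier_mat (n + ?N) (n + ?N)" for Y
        using that Dc by (intro eq_matI) simp_all
      have "?T\<^sup>T = a \<cdot>\<^sub>m (D \<oplus>\<^sub>d 1\<^sub>m ?N)\<^sup>T - (Q * (1\<^sub>m n \<oplus>\<^sub>d M))\<^sup>T"
        by (rule e5, rule carrier_matI) (use M in simp_all)
      then show ?thesis unfolding e4 dsum_transpose transpose_one by (rule sym)
    qed
    have r3: "?T\<^sup>T \<in> carrier_mat (n + Suc k * n) (n + Suc k * n)"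
      using M Dc by (intro carrier_matI) simp_all
    have "reducible_to S (Suc k) n (?T\<^sup>T)\<^sup>T (Q * (0\<^sub>m n n @\<^sub>r x)) (0\<^sub>m n n @\<^sub>r y) ((horner (Suc k) n a X D)\<^sup>T)\<^sup>T"
      by (rule reducible_to_transpose[OF r3 r1[unfolded r2]])
    then show ?thesis
      unfolding fiedler_reducible_def e1 e2 e3 by simp
  qed
qed

text \<open>Horner's scheme for Fiedler pencils, over any ring and for any permutation.\<close>

theorem fiedler_pencil_reducible:
  assumes a: "a \<in> S" 
  shows "D \<in> mats S n n \<Longrightarrow> (\<And>i. i \<le> k \<Longrightarrow> X i \<in> mats S n n) \<Longrightarrow> distinct (u @ 0 # v) \<Longrightarrow>
       set (u @ 0 # v) = {..k} \<Longrightarrow> fiedler_reducible k n a X D u v"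
proof (induction k arbitrary: D X u v)
  case 0
  have "set u \<subseteq> {0}" "set v \<subseteq> {0}" "0 \<notin> set u" "0 \<notin> set v" using "0.prems"(3,4) by auto
  then have uv: "u = []" "v = []" by (cases u; cases v; auto)+
  have c [simp]: "D \<in> carrier_mat n n" "X 0 \<in> carrier_mat n n" using "0.prems"(1,2) mats_carrier by blast+
  have [simp]: "D \<oplus>\<^sub>d 1\<^sub>m 0 = D" by simp
  have g: "gelem (Suc 0) n (PosI 0) (X 0) = X 0" by (simp add: gelem.simps)
  have l: "last_block 0 n = (1\<^sub>m n :: 'a mat)" by (rule eq_matI) (simp_all add: last_block_def append_rows_index)
  have m: "a \<cdot>\<^sub>m D - X 0 \<in> carrier_mat n n" by (rule carrier_matI) (use carrier_matD[OF c(2)] in simp_all)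
  show ?case
    unfolding fiedler_reducible_def reducible_to_def uv horner_0[of D n X a, OF c]
    by (rule bexI[OF _ GL_one], rule bexI[OF _ GL_one]) (use carrier_matD[OF c(2)] in \<open>simp add: pprod_Cons g l left_mult_one_mat' right_mult_one_mat'\<close>)
next
  case (Suc k)
  consider "Suc k \<in> set u" | "Suc k \<in> set v" using Suc.prems(4) by auto
  then show ?case
  proof cases
    case 1
    then obtain u1 u2 where u: "u = u1 @ Suc k # u2" by (metis split_list)
    show ?thesis unfolding u
      using Suc.prems unfolding u by (intro fiedler_reducible_step[OF a] Suc.IH) simp_all
  next
    case 2
    then have "Suc k \<in> set (rev v)" by simp
    then obtain v1 v2 where v: "rev v = v1 @ Suc k # v2" by (metis split_list)
    have Dc: "D\<^sup>T \<in> mats S n n" and Xc: "\<And>i. i \<le> Suc k \<Longrightarrow> (X i)\<^sup>T \<in> mats S n n"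
      using Suc.prems(1,2) by (auto intro: mats_transpose)
    have dd: "distinct (v1 @ Suc k # v2 @ 0 # rev u)"
    proof -
      have "distinct (rev (u @ 0 # v))" using Suc.prems(3) unfolding distinct_rev .
      then show ?thesis using v by simp
    qed
    have ss: "set (v1 @ Suc k # v2 @ 0 # rev u) = {..Suc k}"
    proof -
      have "set (rev (u @ 0 # v)) = {..Suc k}" using Suc.prems(4) unfolding set_rev .
      then show ?thesis using v by simp
    qed
    have "fiedler_reducible (Suc k) n a (\<lambda>i. (X i)\<^sup>T) D\<^sup>T (rev v) (rev u)"
      unfolding v by (rule fiedler_reducible_step[OF a Dc Xc dd ss Suc.IH]) 
    note red = this
    have ss': "set (rev v @ 0 # rev u) \<subseteq> {..Suc k}" using Suc.prems(4) by auto
    have "fiedler_reducible (Suc k) n a (\<lambda>i. (X i)\<^sup>T\<^sup>T) (D\<^sup>T)\<^sup>T (rev (rev u)) (rev (rev v))"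
      by (rule fiedler_reducible_transpose[OF mats_carrier[OF Xc] mats_carrier[OF Dc] ss' red])
    then show ?thesis by simp
  qed
qed

end

section \<open>Inverses and reversal\<close>

text \<open>As a default introduction rule, extensionality of matrices sends the classical reasoner into
  loops on goals that contain several equations between matrices.\<close>

declare eq_matI [rule del]

lemma prod_mats_Nil [simp]: "prod_mats N [] = 1\<^sub>m N"
  and prod_mats_Cons [simp]: "prod_mats N (A # As) = A * prod_mats N As"
  by (simp_all add: prod_mats_def)

lemma prod_mats_carrier:
  "set Ms \<subseteq> carrier_mat N N \<Longrightarrow> prod_mats N Ms \<in> carrier_mat N N"
  by (induction Ms) (auto intro: mult_carrier_mat[where n = N])

lemma prod_mats_append:
  assumes "set As \<subseteq> carrier_mat N N" "set Bs \<subseteq> carrier_mat N N"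
  shows "prod_mats N (As @ Bs) = prod_mats N As * prod_mats N Bs"
  using assms(1)
proof (induction As)
  case Nil
  then show ?case using prod_mats_carrier[OF assms(2)] by simp
next
  case (Cons A As)
  then have "A \<in> carrier_mat N N" "prod_mats N As \<in> carrier_mat N N" "prod_mats N Bs \<in> carrier_mat N N"
    using prod_mats_carrier assms(2) by auto
  then show ?case using Cons by (simp add: assoc_mult_mat[of _ N N _ N _ N])
qed

lemma prod_mats_transpose:
  fixes Ms :: "'a :: comm_ring_1 mat list"
  assumes "set Ms \<subseteq> carrier_mat N N"
  shows "(prod_mats N Ms)\<^sup>T = prod_mats N (rev (map transpose_mat Ms))"
  using assms
proof (induction Ms)
  case (Cons A As)
  then have c: "A \<in> carrier_mat N N" "prod_mats N As \<in> carrier_mat N N" "set As \<subseteq> carrier_mat N N"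
    using prod_mats_carrier by auto
  have "(prod_mats N (A # As))\<^sup>T = (prod_mats N As)\<^sup>T * A\<^sup>T" using transpose_mult[OF c(1,2)] by simp
  also have "\<dots> = prod_mats N (rev (map transpose_mat As)) * prod_mats N [A\<^sup>T]"
    using Cons c by simp
  also have "\<dots> = prod_mats N (rev (map transpose_mat As) @ [A\<^sup>T])"
    by (rule prod_mats_append[symmetric]) (use c in auto)
  finally show ?case by simp
qed simp

lemma (in coeff_ring) prod_mats_GL: "set Ms \<subseteq> GL S N \<Longrightarrow> prod_mats N Ms \<in> GL S N"
  by (induction Ms) (auto intro: GL_one GL_mult)

lemma prod_mats_inverse:
  fixes f g :: "'b \<Rightarrow> 'a :: semiring_1 mat"
  assumes "\<And>x. x \<in> set xs \<Longrightarrow> f x \<in> carrier_mat N N \<and> g x \<in> carrier_mat N N \<and> f x * g x = 1\<^sub>m N"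
  shows "prod_mats N (map f xs) * prod_mats N (map g (rev xs)) = 1\<^sub>m N"
  using assms
proof (induction xs)
  case (Cons x xs)
  have c: "f x \<in> carrier_mat N N" "g x \<in> carrier_mat N N" "f x * g x = 1\<^sub>m N"
    "set (map f xs) \<subseteq> carrier_mat N N" "set (map g (rev xs)) \<subseteq> carrier_mat N N"
    using Cons.prems by auto
  note d = c(1,2) prod_mats_carrier[OF c(4)] prod_mats_carrier[OF c(5)]
  note dd [simp] = d[THEN carrier_matD(1)] d[THEN carrier_matD(2)]
  have e: "prod_mats N (map g (rev (x # xs))) = prod_mats N (map g (rev xs)) * g x"
    using prod_mats_append[OF c(5), of "[g x]"] c(2) by simp
  have "prod_mats N (map f (x # xs)) * prod_mats N (map g (rev (x # xs)))
     = f x * ((prod_mats N (map f xs) * prod_mats N (map g (rev xs))) * g x)"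
    unfolding e by (simp add: mult_assoc_dim)
  also have "prod_mats N (map f xs) * prod_mats N (map g (rev xs)) = 1\<^sub>m N"
    using Cons by simp
  finally show ?case using c by simp
qed simp

lemma gelem_pos_top_factor:
  "0 < i \<Longrightarrow> gelem m n (PosI i) X = 1\<^sub>m ((m - i - 1) * n) \<oplus>\<^sub>d top_factor ((i - 1) * n) n X"
  by (simp add: gelem.simps top_factor_def)

lemma gelem_neg_top_factor:
  "i < m \<Longrightarrow> gelem m n (NegI i) X = 1\<^sub>m ((m - i - 1) * n) \<oplus>\<^sub>d top_factor_inv ((i - 1) * n) n X"
  by (simp add: gelem.simps top_factor_inv_def)

lemma top_factor_inv_carrier: "X \<in> carrier_mat n n \<Longrightarrow> top_factor_inv l n X \<in> carrier_mat (n + (n + l)) (n + (n + l))"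
  unfolding top_factor_inv_def by (rule carrier_matI) simp_all

lemma gelem_neg_dim:
  assumes "0 < i" "i \<le> m" "X \<in> carrier_mat n n"
  shows "gelem m n (NegI i) X \<in> carrier_mat (m * n) (m * n)"
proof (cases "i = m")
  case True
  have "n + (m - 1) * n = m * n" using assms(1) True by (cases m) simp_all
  then show ?thesis using True assms by (intro carrier_matI) (simp_all add: gelem.simps)
next
  case False
  then show ?thesis using assms(3) block_count[of i m n] assms(1,2) 
    by (intro carrier_matI) (simp_all add: add.assoc gelem.simps)
qed

lemma gelem_inverse:
  fixes X :: "'a :: comm_ring_1 mat"
  assumes i: "0 < i" "i < m" and X: "X \<in> carrier_mat n n"
  shows "gelem m n (PosI i) X * gelem m n (NegI i) (- X) = 1\<^sub>m (m * n)"
    and "gelem m n (NegI i) (- X) * gelem m n (PosI i) X = 1\<^sub>m (m * n)"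
proof -
  note c = top_factor_carrier[OF X, of "(i - 1) * n"] 
    top_factor_inv_carrier[OF uminus_carrier_mat[OF X], of "(i - 1) * n"]
  note cd = c[THEN carrier_matD(1)] c[THEN carrier_matD(2)]
  have e: "(m - i - 1) * n + (n + (n + (i - 1) * n)) = m * n"
    using block_count[OF i, of n] by (simp only: add.assoc)
  show "gelem m n (PosI i) X * gelem m n (NegI i) (- X) = 1\<^sub>m (m * n)"
    "gelem m n (NegI i) (- X) * gelem m n (PosI i) X = 1\<^sub>m (m * n)"
    unfolding gelem_pos_top_factor[OF i(1)] gelem_neg_top_factor[OF i(2)]
    by (subst dsum_mult; simp add: cd top_factor_inverse[OF X] dsum_one e del: diff_diff_left One_nat_def)+
qed

context coeff_ring
begin

lemma gelem_GL:
  assumes i: "0 < i" "i < m" and X: "X \<in> mats S n n"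
  shows "gelem m n (PosI i) X \<in> GL S (m * n)" "gelem m n (NegI i) X \<in> GL S (m * n)"
proof -
  have e: "(m - i - 1) * n + (n + (n + (i - 1) * n)) = m * n"
    using block_count[OF i, of n] by (simp only: add.assoc)
  show "gelem m n (PosI i) X \<in> GL S (m * n)"
    unfolding gelem_pos_top_factor[OF i(1)] 
    using GL_dsum[OF GL_one top_factor_GL(1)[OF X], of "(m - i - 1) * n" "(i - 1) * n"] unfolding e .
  have "- (- X) = X" using mats_carrier[OF X] by (intro eq_matI) simp_all
  then show "gelem m n (NegI i) X \<in> GL S (m * n)"
    unfolding gelem_neg_top_factor[OF i(2)] 
    using GL_dsum[OF GL_one top_factor_GL(2)[OF mats_uminus[OF X]], of "(m - i - 1) * n" "(i - 1) * n"] unfolding e by simp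
qed

end

text \<open>The permutation matrix that reverses the order of the entries. Full reversal, inside the
  blocks as well, is used because it interacts simply with every splitting into blocks; inside the blocks
  it is undone at the end.\<close>

definition antidiag :: "nat \<Rightarrow> 'a :: {zero,one} mat" where
  "antidiag N = mat N N (\<lambda>(i, j). if i + j + 1 = N then 1 else 0)"

lemma antidiag_dim [simp]: "dim_row (antidiag N) = N" "dim_col (antidiag N) = N"
  and antidiag_carrier [simp]: "antidiag N \<in> carrier_mat N N"
  by (simp_all add: antidiag_def)

lemma antidiag_square: "antidiag N * antidiag N = (1\<^sub>m N :: 'a :: comm_ring_1 mat)"
proof (rule eq_matI)
  fix i j assume "i < dim_row (1\<^sub>m N :: 'a mat)" "j < dim_col (1\<^sub>m N :: 'a mat)"
  then have ij: "i < N" "j < N" by simp_all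
  have "(antidiag N * antidiag N) $$ (i, j) =
    (\<Sum>l\<in>{0..<N}. (if i + l + 1 = N then 1 else 0) * (if l + j + 1 = N then 1 else (0 :: 'a)))"
    using ij by (simp add: scalar_prod_def antidiag_def)
  also have "\<dots> = (\<Sum>l\<in>{0..<N}. if l = N - 1 - i then (if i = j then 1 else 0) else 0)"
    by (rule sum.cong) (use ij in auto)
  also have "\<dots> = 1\<^sub>m N $$ (i, j)" using ij by simp
  finally show "(antidiag N * antidiag N) $$ (i, j) = (1\<^sub>m N :: 'a mat) $$ (i, j)" .
qed simp_all

lemma antidiag_add:
  "antidiag (a + b) = (four_block_mat (0\<^sub>m a b) (antidiag a) (antidiag b) (0\<^sub>m b a) :: 'a :: {zero,one} mat)"
proof (rule eq_matI)
  fix i j assume "i < dim_row (four_block_mat (0\<^sub>m a b) (antidiag a) (antidiag b) (0\<^sub>m b a) :: 'a mat)"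
    "j < dim_col (four_block_mat (0\<^sub>m a b) (antidiag a) (antidiag b) (0\<^sub>m b a) :: 'a mat)"
  then have ij: "i < a + b" "j < a + b" by simp_all
  show "antidiag (a + b) $$ (i, j) = (four_block_mat (0\<^sub>m a b) (antidiag a) (antidiag b) (0\<^sub>m b a) :: 'a mat) $$ (i, j)"
    using ij by (cases "i < a"; cases "j < b") (auto simp: antidiag_def)
qed simp_all

definition rev_mat :: "'a :: comm_ring_1 mat \<Rightarrow> 'a mat" where
  "rev_mat A = antidiag (dim_row A) * A * antidiag (dim_col A)"

lemma rev_mat_dim [simp]: "dim_row (rev_mat A) = dim_row A" "dim_col (rev_mat A) = dim_col A"
  by (simp_all add: rev_mat_def)

lemma rev_mat_carrier [simp]: "A \<in> carrier_mat a b \<Longrightarrow> rev_mat A \<in> carrier_mat a b"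
  by (intro carrier_matI) simp_all

lemma antidiag_cancel: "dim_row A = N \<Longrightarrow> antidiag N * (antidiag N * A) = (A :: 'a :: comm_ring_1 mat)"
  by (subst mult_assoc_dim[symmetric]) (simp_all add: antidiag_square left_mult_one_mat')

lemma rev_mat_mult: "dim_col A = dim_row B \<Longrightarrow> rev_mat (A * B) = rev_mat A * rev_mat B"
  by (simp add: rev_mat_def mult_assoc_dim antidiag_cancel)

lemma rev_mat_one [simp]: "rev_mat (1\<^sub>m N) = 1\<^sub>m N"
  by (simp add: rev_mat_def antidiag_square right_mult_one_mat')

lemma rev_mat_rev_mat [simp]: "rev_mat (rev_mat A) = A"
  by (simp add: rev_mat_def mult_assoc_dim antidiag_cancel antidiag_square right_mult_one_mat')

lemma rev_mat_zero [simp]: "rev_mat (0\<^sub>m a b) = 0\<^sub>m a b"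
  by (simp add: rev_mat_def)

lemma rev_mat_index:
  assumes "i < dim_row A" "j < dim_col A"
  shows "rev_mat A $$ (i, j) = A $$ (dim_row A - 1 - i, dim_col A - 1 - j)"
proof -
  have 1: "(B * antidiag (dim_col B)) $$ (i, j) = B $$ (i, dim_col B - 1 - j)"
    if "i < dim_row B" "j < dim_col B" for B :: "'a mat" and i j
  proof -
    have "(B * antidiag (dim_col B)) $$ (i, j) =
      (\<Sum>l\<in>{0..<dim_col B}. B $$ (i, l) * (if l + j + 1 = dim_col B then 1 else 0))"
      using that by (simp add: scalar_prod_def antidiag_def)
    also have "\<dots> = (\<Sum>l\<in>{0..<dim_col B}. if l = dim_col B - 1 - j then B $$ (i, l) else 0)"
      by (rule sum.cong) (use that in auto)
    also have "\<dots> = B $$ (i, dim_col B - 1 - j)" using that by simp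
    finally show ?thesis .
  qed
  have 2: "(antidiag (dim_row B) * B) $$ (i, j) = B $$ (dim_row B - 1 - i, j)"
    if "i < dim_row B" "j < dim_col B" for B :: "'a mat" and i j
  proof -
    have "(antidiag (dim_row B) * B) $$ (i, j) =
      (\<Sum>l\<in>{0..<dim_row B}. (if i + l + 1 = dim_row B then 1 else 0) * B $$ (l, j))"
      using that by (simp add: scalar_prod_def antidiag_def)
    also have "\<dots> = (\<Sum>l\<in>{0..<dim_row B}. if l = dim_row B - 1 - i then B $$ (l, j) else 0)"
      by (rule sum.cong) (use that in auto)
    also have "\<dots> = B $$ (dim_row B - 1 - i, j)" using that by simp
    finally show ?thesis .
  qed
  show ?thesis
    using 1[of i "antidiag (dim_row A) * A" j] 2[of i A "dim_col A - 1 - j"] assms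
    by (simp add: rev_mat_def)
qed

lemma add_zero_mat_dim:
  fixes A :: "'a :: monoid_add mat"
  shows "dim_row A = a \<Longrightarrow> dim_col A = b \<Longrightarrow> 0\<^sub>m a b + A = A"
    and "dim_row A = a \<Longrightarrow> dim_col A = b \<Longrightarrow> A + 0\<^sub>m a b = A"
  by (rule eq_matI; simp)+

lemma rev_mat_four_block:
  assumes "A \<in> carrier_mat a c" "B \<in> carrier_mat a d" "C \<in> carrier_mat b c" "D \<in> carrier_mat b d"
  shows "rev_mat (four_block_mat A B C D) = four_block_mat (rev_mat D) (rev_mat C) (rev_mat B) (rev_mat A)"
proof -
  have "antidiag (b + a) * four_block_mat A B C D
    = four_block_mat (antidiag b * C) (antidiag b * D) (antidiag a * A) (antidiag a * B)"
    unfolding antidiag_add using assms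
    by (subst mult_four_block_mat[where ?nr1.0 = b and ?nr2.0 = a and ?n1.0 = a and ?n2.0 = b and ?nc1.0 = c and ?nc2.0 = d]) (simp_all add: add_zero_mat_dim)
  moreover have "four_block_mat (antidiag b * C) (antidiag b * D) (antidiag a * A) (antidiag a * B) * antidiag (c + d)
    = four_block_mat (antidiag b * D * antidiag d) (antidiag b * C * antidiag c) (antidiag a * B * antidiag d) (antidiag a * A * antidiag c)"
    unfolding antidiag_add using assms
    by (subst mult_four_block_mat[where ?nr1.0 = b and ?nr2.0 = a and ?n1.0 = c and ?n2.0 = d and ?nc1.0 = d and ?nc2.0 = c])
       (simp_all add: mult_carrier_mat[where n = a] mult_carrier_mat[where n = b] add_zero_mat_dim)
  ultimately show ?thesis using assms by (simp add: rev_mat_def add.commute)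
qed

lemma rev_mat_dsum: "rev_mat (A \<oplus>\<^sub>d B) = rev_mat B \<oplus>\<^sub>d rev_mat A"
proof -
  have "rev_mat (A \<oplus>\<^sub>d B) = four_block_mat (rev_mat B) (rev_mat (0\<^sub>m (dim_row B) (dim_col A)))
      (rev_mat (0\<^sub>m (dim_row A) (dim_col B))) (rev_mat A)"
    unfolding dsum_def
    by (rule rev_mat_four_block[where a = "dim_row A" and b = "dim_row B" and c = "dim_col A" and d = "dim_col B"];
        rule carrier_matI; simp)
  then show ?thesis by (simp add: dsum_def)
qed

lemma rev_mat_smult: "rev_mat (a \<cdot>\<^sub>m A) = a \<cdot>\<^sub>m rev_mat A"
  by (rule eq_matI) (simp_all add: rev_mat_index)

lemma rev_mat_minus: "dim_row A = dim_row B \<Longrightarrow> dim_col A = dim_col B \<Longrightarrow> rev_mat (A - B) = rev_mat A - rev_mat B"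
  by (rule eq_matI) (simp_all add: rev_mat_index)

text \<open>Reversal turns negative indices into nonnegative ones; in particular it exchanges the roles
  of the indices \<open>-m\<close> and \<open>0\<close>.\<close>

lemma rev_mat_gelem_neg:
  fixes X :: "'a :: comm_ring_1 mat"
  assumes i: "0 < i" "i \<le> m" and X: "X \<in> carrier_mat n n"
  shows "rev_mat (gelem m n (NegI i) X) = gelem m n (PosI (m - i)) (rev_mat X)"
proof (cases "i = m")
  case True
  then show ?thesis by (simp add: gelem.simps rev_mat_dsum)
next
  case False
  then have "m - i \<noteq> 0" "m - (m - i) - 1 = i - 1" using i by simp_all
  moreover have "rev_mat (four_block_mat (0\<^sub>m n n) (1\<^sub>m n) (1\<^sub>m n) X) = four_block_mat (rev_mat X) (1\<^sub>m n) (1\<^sub>m n) (0\<^sub>m n n)"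
    using X by (subst rev_mat_four_block[where a = n and b = n and c = n and d = n]) simp_all
  ultimately show ?thesis using False
    by (simp add: gelem.simps rev_mat_dsum dsum_assoc del: diff_diff_left)
qed

lemma rev_mat_prod_mats:
  "set Ms \<subseteq> carrier_mat N N \<Longrightarrow> rev_mat (prod_mats N Ms) = prod_mats N (map rev_mat Ms)"
proof (induction Ms)
  case (Cons A As)
  then have "A \<in> carrier_mat N N" "prod_mats N As \<in> carrier_mat N N" using prod_mats_carrier by auto
  then show ?case using Cons by (simp add: rev_mat_mult)
qed simp

lemma (in coeff_ring) antidiag_GL: "antidiag N \<in> GL S N"
  by (rule GL_I[OF _ _ antidiag_square antidiag_square]) (auto simp: mats_def antidiag_def)

lemma (in coeff_ring) mats_rev_mat: "A \<in> mats S a b \<Longrightarrow> rev_mat A \<in> mats S a b"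
  using GL_def antidiag_GL[of a] antidiag_GL[of b] mats_carrier[of A S a b] unfolding rev_mat_def
  by (auto intro!: mats_mult simp: GL_def)

section \<open>The reversed Fiedler pencil\<close>

context coeff_ring
begin

lemma GL_uminus_one: "- 1\<^sub>m k \<in> GL S k"
proof -
  have "- 1\<^sub>m k * - 1\<^sub>m k = (1\<^sub>m k :: 'a mat)"
    by (rule eq_matI) simp_all
  then show ?thesis by (rule GL_I[OF mats_uminus[OF mats_one] mats_uminus[OF mats_one], rotated]) simp
qed

text \<open>Writing the product as \<open>X M_0 Y\<close> and multiplying by the inverses of \<open>X\<close> and \<open>Y\<close> gives
  \<open>X\<inverse> M_{-m} Y\<inverse> - \<mu> M_0\<close>. After reversal this is, up to sign, the Fiedler pencil at \<open>\<mu>\<close> whose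
  coefficients are those of the given one in opposite order, so Horner's scheme applies.\<close>

lemma reversed_pencil_reducible:
  assumes mu: "mu \<in> S" and D: "D \<in> mats S n n" and W: "\<And>i. i \<le> k \<Longrightarrow> W i \<in> mats S n n"
    and dist: "distinct (u @ 0 # v)" and set: "set (u @ 0 # v) = {..k}"
    and Z: "Z = mat n n (\<lambda>ij. D $$ ij - (\<Sum>i\<le>k. mu ^ (Suc k - i) * W i $$ ij))"
  shows "\<exists>U\<in>GL S (n + k * n). \<exists>V\<in>GL S (n + k * n).
    U * ((D \<oplus>\<^sub>d 1\<^sub>m (k * n)) - mu \<cdot>\<^sub>m pprod (Suc k) n W (u @ 0 # v)) * V = 1\<^sub>m (k * n) \<oplus>\<^sub>d Z"
proof -
  let ?m = "Suc k" and ?N = "n + k * n"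
  let ?pos = "\<lambda>i. gelem ?m n (PosI i) (W i)" and ?neg = "\<lambda>i. gelem ?m n (NegI i) (- W i)"
  define X where "X = pprod ?m n W u"
  define Y where "Y = pprod ?m n W v"
  define Xi where "Xi = prod_mats (?m * n) (map ?neg (rev u))"
  define Yi where "Yi = prod_mats (?m * n) (map ?neg (rev v))"
  define M0 where "M0 = 1\<^sub>m (k * n) \<oplus>\<^sub>d W 0"
  define E where "E = D \<oplus>\<^sub>d 1\<^sub>m (k * n)"
  define T where "T = E - mu \<cdot>\<^sub>m pprod ?m n W (u @ 0 # v)"
  define B where "B = Xi * (E * Yi) - mu \<cdot>\<^sub>m M0"
  (* The coefficients of the reversed pencil; the former leading coefficient now belongs to
     index 0. *)
  define W' where "W' = (\<lambda>j. if j = 0 then rev_mat D else rev_mat (- W (?m - j)))"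
  define u' where "u' = map (\<lambda>i. ?m - i) (rev u)"
  define v' where "v' = map (\<lambda>i. ?m - i) (rev v)"
  have u: "1 \<le> i \<and> i \<le> k" if "i \<in> set u" for i
  proof -
    have "i \<noteq> 0" "i \<in> set (u @ 0 # v)" using that dist by auto
    then show ?thesis unfolding set by simp
  qed
  have v: "1 \<le> i \<and> i \<le> k" if "i \<in> set v" for i
  proof -
    have "i \<noteq> 0" "i \<in> set (u @ 0 # v)" using that dist by auto
    then show ?thesis unfolding set by simp
  qed
  have Wc: "W i \<in> carrier_mat n n" if "i \<le> k" for i using mats_carrier[OF W[OF that]] .
  note Dc = mats_carrier[OF D]
  have W0d [simp]: "dim_row (W 0) = n" "dim_col (W 0) = n" "dim_row D = n" "dim_col D = n" using Wc[of 0] Dc by auto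
  have pos_neg: "?pos i \<in> carrier_mat (?m * n) (?m * n) \<and> ?neg i \<in> carrier_mat (?m * n) (?m * n) \<and> ?pos i * ?neg i = 1\<^sub>m (?m * n)"
    "?neg i \<in> carrier_mat (?m * n) (?m * n) \<and> ?pos i \<in> carrier_mat (?m * n) (?m * n) \<and> ?neg i * ?pos i = 1\<^sub>m (?m * n)"
    if "1 \<le> i \<and> i \<le> k" for i
    using that gelem_inverse[of i ?m "W i" n] gelem_pos_dim[of i ?m "W i" n] gelem_neg_dim[of i ?m "- W i" n] Wc[of i]
    by simp_all
  have XXi: "Xi * X = 1\<^sub>m ?N"
  proof -
    have "prod_mats (?m * n) (map ?neg (rev u)) * prod_mats (?m * n) (map ?pos (rev (rev u))) = 1\<^sub>m (?m * n)"
      by (rule prod_mats_inverse[OF pos_neg(2)], rule u) simp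
    then show ?thesis by (simp add: Xi_def X_def pprod_def)
  qed
  have YYi: "Y * Yi = 1\<^sub>m ?N"
  proof -
    have "prod_mats (?m * n) (map ?pos v) * prod_mats (?m * n) (map ?neg (rev v)) = 1\<^sub>m (?m * n)"
      by (rule prod_mats_inverse[OF pos_neg(1)], rule v)
    then show ?thesis by (simp add: Yi_def Y_def pprod_def)
  qed
  have neg_GL: "?neg i \<in> GL S (?m * n)" if "1 \<le> i \<and> i \<le> k" for i
    using that by (intro gelem_GL mats_uminus W) simp_all
  have XiGL: "Xi \<in> GL S ?N" and YiGL: "Yi \<in> GL S ?N"
  proof -
    have "Xi \<in> GL S (?m * n)" "Yi \<in> GL S (?m * n)"
      unfolding Xi_def Yi_def by (rule prod_mats_GL, use neg_GL u v in auto)+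
    then show "Xi \<in> GL S ?N" "Yi \<in> GL S ?N" by simp_all
  qed
  have subs: "set u \<subseteq> {..<?m}" "set v \<subseteq> {..<?m}" "set (0 # v) \<subseteq> {..<?m}"
    using u v by (auto simp: less_Suc_eq_le)
  have Wc': "\<And>i. i < ?m \<Longrightarrow> W i \<in> carrier_mat n n" using Wc by simp
  have Xc: "X \<in> carrier_mat (?m * n) (?m * n)" unfolding X_def by (rule pprod_carrier[OF subs(1) Wc'])
  have Yc: "Y \<in> carrier_mat (?m * n) (?m * n)" unfolding Y_def by (rule pprod_carrier[OF subs(2) Wc'])
  have M0: "gelem ?m n (PosI 0) (W 0) = M0" by (simp add: M0_def gelem.simps)
  have P: "pprod ?m n W (u @ 0 # v) = X * (M0 * Y)"
  proof -
    have "pprod ?m n W (u @ 0 # v) = X * pprod ?m n W (0 # v)"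
      unfolding X_def by (rule pprod_append[OF subs(1,3) Wc'])
    then show ?thesis by (simp add: pprod_Cons M0 Y_def)
  qed
  note d [simp] = Xc[THEN carrier_matD(1), simplified] Xc[THEN carrier_matD(2), simplified]
    Yc[THEN carrier_matD(1), simplified] Yc[THEN carrier_matD(2), simplified]
    GL_carrier[OF XiGL, THEN carrier_matD(1)] GL_carrier[OF XiGL, THEN carrier_matD(2)]
    GL_carrier[OF YiGL, THEN carrier_matD(1)] GL_carrier[OF YiGL, THEN carrier_matD(2)]
  have M0d [simp]: "dim_row M0 = ?N" "dim_col M0 = ?N" "dim_row E = ?N" "dim_col E = ?N"
    by (simp_all add: M0_def E_def add.commute)
  have Td [simp]: "dim_row T = ?N" "dim_col T = ?N" "dim_row B = ?N" "dim_col B = ?N"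
    by (simp_all add: T_def B_def P)
  have c1: "Xi * (X * A) = A" if "dim_row A = ?N" for A
    using that by (subst mult_assoc_dim[symmetric]) (simp_all add: XXi left_mult_one_mat')
  have B: "Xi * (T * Yi) = B"
  proof -
    have 1: "T * Yi = E * Yi - mu \<cdot>\<^sub>m (X * M0)"
    proof -
      have "T * Yi = E * Yi - mu \<cdot>\<^sub>m (X * (M0 * Y)) * Yi"
        unfolding T_def P by (rule minus_mult_distrib_mat[of _ ?N ?N _ _ ?N]; rule carrier_matI; simp)
      also have "mu \<cdot>\<^sub>m (X * (M0 * Y)) * Yi = mu \<cdot>\<^sub>m (X * (M0 * Y) * Yi)"
        by (rule mult_smult_assoc_mat[of _ ?N ?N _ ?N]; rule carrier_matI; simp)
      also have "X * (M0 * Y) * Yi = X * M0"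
        by (simp add: mult_assoc_dim YYi right_mult_one_mat')
      finally show ?thesis .
    qed
    have "Xi * (T * Yi) = Xi * (E * Yi) - Xi * (mu \<cdot>\<^sub>m (X * M0))"
      unfolding 1 by (rule mult_minus_distrib_mat[of _ ?N ?N _ ?N]; rule carrier_matI; simp)
    also have "Xi * (mu \<cdot>\<^sub>m (X * M0)) = mu \<cdot>\<^sub>m (Xi * (X * M0))"
      by (rule mult_smult_distrib[of _ ?N ?N _ ?N]; rule carrier_matI; simp)
    also have "Xi * (X * M0) = M0" by (rule c1) simp
    finally show ?thesis unfolding B_def .
  qed
  have rev_neg: "rev_mat (prod_mats (?m * n) (map ?neg (rev w))) = pprod ?m n W' (map (\<lambda>i. ?m - i) (rev w))"
    if w: "\<And>i. i \<in> set w \<Longrightarrow> 1 \<le> i \<and> i \<le> k" for w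
  proof -
    have "set (map ?neg (rev w)) \<subseteq> carrier_mat (?m * n) (?m * n)"
      using pos_neg(2) w by auto
    then have "rev_mat (prod_mats (?m * n) (map ?neg (rev w))) = prod_mats (?m * n) (map rev_mat (map ?neg (rev w)))"
      by (rule rev_mat_prod_mats)
    also have "map rev_mat (map ?neg (rev w)) = map (\<lambda>i. gelem ?m n (PosI (?m - i)) (W' (?m - i))) (rev w)"
      unfolding map_map
    proof (rule map_cong[OF refl])
      fix i assume "i \<in> set (rev w)"
      then have i: "1 \<le> i" "i \<le> k" using w by auto
      have "rev_mat (?neg i) = gelem ?m n (PosI (?m - i)) (rev_mat (- W i))"
        by (rule rev_mat_gelem_neg) (use i Wc[of i] in simp_all)
      moreover have "W' (?m - i) = rev_mat (- W i)" using i by (simp add: W'_def Suc_diff_le)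
      ultimately show "(rev_mat \<circ> ?neg) i = gelem ?m n (PosI (?m - i)) (W' (?m - i))" by simp
    qed
    finally show ?thesis by (simp add: pprod_def comp_def)
  qed
  have Xi': "rev_mat Xi = pprod ?m n W' u'" unfolding Xi_def u'_def by (rule rev_neg[OF u])
  have Yi': "rev_mat Yi = pprod ?m n W' v'" unfolding Yi_def v'_def by (rule rev_neg[OF v])
  have W'm: "W' j \<in> mats S n n" if "j \<le> k" for j
    using that by (auto simp: W'_def intro!: mats_rev_mat D mats_uminus W)
  have W'c: "\<And>j. j < ?m \<Longrightarrow> W' j \<in> carrier_mat n n" using mats_carrier[OF W'm] by simp
  have aux: "?m - i \<in> {1..k}" if "1 \<le> i \<and> i \<le> k" for i using that by auto
  have u'v': "set u' \<subseteq> {1..k}" "set v' \<subseteq> {1..k}"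
    unfolding u'_def v'_def set_map set_rev by (rule image_subsetI, rule aux, erule u, rule image_subsetI, rule aux, erule v)
  have setuv: "set (u' @ 0 # v') = {..k}"
  proof
    show "set (u' @ 0 # v') \<subseteq> {..k}" using u'v' by auto
    show "{..k} \<subseteq> set (u' @ 0 # v')"
    proof
      fix j assume "j \<in> {..k}"
      show "j \<in> set (u' @ 0 # v')"
      proof (cases "j = 0")
        case False
        then have m: "?m - j \<in> set (u @ 0 # v)" "?m - j \<noteq> 0" "j = ?m - (?m - j)" 
          using \<open>j \<in> {..k}\<close> unfolding set by auto
        have "j \<in> (\<lambda>i. ?m - i) ` set w" if "?m - j \<in> set w" for w
          using imageI[OF that, of "\<lambda>i. ?m - i"] m(3) by simp
        then have "j \<in> set u' \<or> j \<in> set v'" using m(1,2) unfolding u'_def v'_def set_map set_rev by auto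
        then show ?thesis by auto
      qed simp
    qed
  qed
  have distuv: "distinct (u' @ 0 # v')"
  proof -
    have "length (u' @ 0 # v') = length (u @ 0 # v)" by (simp add: u'_def v'_def)
    also have "\<dots> = card {..k}" using distinct_card[OF dist] unfolding set by simp
    finally show ?thesis using setuv by (metis card_distinct)
  qed
  have revB: "rev_mat B = pprod ?m n W' (u' @ 0 # v') - mu \<cdot>\<^sub>m (rev_mat (W 0) \<oplus>\<^sub>d 1\<^sub>m (k * n))"
  proof -
    have "rev_mat B = rev_mat Xi * (rev_mat E * rev_mat Yi) - mu \<cdot>\<^sub>m rev_mat M0"
      unfolding B_def by (simp add: rev_mat_minus rev_mat_mult rev_mat_smult)
    also have "rev_mat E * rev_mat Yi = pprod ?m n W' (0 # v')"
      by (simp add: E_def Yi' pprod_Cons gelem.simps W'_def rev_mat_dsum)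
    also have "rev_mat Xi * \<dots> = pprod ?m n W' (u' @ 0 # v')"
      unfolding Xi' by (rule pprod_append[symmetric]) (use u'v' W'c in auto)
    also have "rev_mat M0 = rev_mat (W 0) \<oplus>\<^sub>d 1\<^sub>m (k * n)" by (simp add: M0_def rev_mat_dsum)
    finally show ?thesis .
  qed
  have fr: "fiedler_reducible k n mu W' (rev_mat (W 0)) u' v'"
  proof (rule fiedler_pencil_reducible[OF mu])
    show "rev_mat (W 0) \<in> mats S n n" by (rule mats_rev_mat[OF W]) simp
    show "W' i \<in> mats S n n" if "i \<le> k" for i by (rule W'm[OF that])
  qed (rule distuv, rule setuv)
  obtain U V where UV: "U \<in> GL S ?N" "V \<in> GL S ?N"
    "U * (mu \<cdot>\<^sub>m (rev_mat (W 0) \<oplus>\<^sub>d 1\<^sub>m (k * n)) - pprod ?m n W' (u' @ 0 # v')) * V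
      = 1\<^sub>m (k * n) \<oplus>\<^sub>d horner k n mu W' (rev_mat (W 0))"
    using fr unfolding fiedler_reducible_def reducible_to_def by blast
  note d2 [simp] = GL_carrier[OF UV(1), THEN carrier_matD(1)] GL_carrier[OF UV(1), THEN carrier_matD(2)]
    GL_carrier[OF UV(2), THEN carrier_matD(1)] GL_carrier[OF UV(2), THEN carrier_matD(2)]
  have Zd [simp]: "dim_row Z = n" "dim_col Z = n" by (simp_all add: Z)
  have H: "horner k n mu W' (rev_mat (W 0)) = - rev_mat Z"
  proof (rule eq_matI)
    fix i j assume "i < dim_row (- rev_mat Z)" "j < dim_col (- rev_mat Z)"
    then have ij: "i < n" "j < n" by simp_all
    define ij' where "ij' = (n - 1 - i, n - 1 - j)"
    have rv: "rev_mat A $$ (i, j) = A $$ ij'" if "A \<in> carrier_mat n n" for A :: "'a mat"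
      using that ij by (simp add: rev_mat_index ij'_def)
    have "(\<Sum>l\<le>k. mu ^ l * W' l $$ (i, j)) = D $$ ij' + (\<Sum>l=1..k. mu ^ l * W' l $$ (i, j))"
      by (simp add: W'_def rv[OF Dc] atMost_atLeast0 sum.atLeast_Suc_atMost)
    also have "(\<Sum>l=1..k. mu ^ l * W' l $$ (i, j)) = (\<Sum>l=1..k. - (mu ^ (?m - l) * W l $$ ij'))"
    proof (rule sum.reindex_bij_witness[of _ "\<lambda>l. ?m - l" "\<lambda>l. ?m - l"])
      fix l assume l: "l \<in> {1..k}"
      then have "?m - l \<le> k" by auto
      then have "(- W (?m - l)) \<in> carrier_mat n n" "W (?m - l) \<in> carrier_mat n n" using Wc[of "?m - l"] by simp_all
      moreover have "ij' = (fst ij', snd ij')" "fst ij' < n" "snd ij' < n" using ij by (simp_all add: ij'_def)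
      ultimately have "rev_mat (- W (?m - l)) $$ (i, j) = - W (?m - l) $$ ij'"
        using rv by (metis carrier_matD index_uminus_mat(1))
      then show "- (mu ^ (?m - (?m - l)) * W (?m - l) $$ ij') = mu ^ l * W' l $$ (i, j)"
        using l by (simp add: W'_def)
    qed auto
    finally have 1: "(\<Sum>l\<le>k. mu ^ l * W' l $$ (i, j)) = D $$ ij' - (\<Sum>l=1..k. mu ^ (?m - l) * W l $$ ij')"
      by (simp add: sum_negf)
    have 2: "(\<Sum>l\<le>k. mu ^ (?m - l) * W l $$ ij') = mu ^ ?m * W 0 $$ ij' + (\<Sum>l=1..k. mu ^ (?m - l) * W l $$ ij')"
      by (simp add: atMost_atLeast0 sum.atLeast_Suc_atMost)
    have "rev_mat Z $$ (i, j) = Z $$ ij'" by (rule rv) (simp add: Z)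
    also have "\<dots> = D $$ ij' - (\<Sum>l\<le>k. mu ^ (?m - l) * W l $$ ij')" using ij by (simp add: Z ij'_def)
    finally show "horner k n mu W' (rev_mat (W 0)) $$ (i, j) = (- rev_mat Z) $$ (i, j)"
      using ij by (simp add: horner_def 1 2 rv[OF Wc[of 0]] del: power_Suc)
  qed (simp_all add: horner_def)
  have UBV: "U * rev_mat B * V = - (1\<^sub>m (k * n) \<oplus>\<^sub>d - rev_mat Z)"
  proof -
    let ?A = "mu \<cdot>\<^sub>m (rev_mat (W 0) \<oplus>\<^sub>d 1\<^sub>m (k * n)) - pprod ?m n W' (u' @ 0 # v')"
    have Pd: "pprod ?m n W' (u' @ 0 # v') \<in> carrier_mat (?m * n) (?m * n)"
      by (rule pprod_carrier) (use u'v' W'c in auto)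
    have "rev_mat B = - ?A"
      unfolding revB by (rule eq_matI) (use carrier_matD[OF Pd] in simp_all)
    moreover have "dim_row ?A = ?N" "dim_col ?A = ?N" using carrier_matD[OF Pd] by simp_all
    ultimately have "U * rev_mat B * V = - (U * ?A * V)" by simp
    then show ?thesis unfolding UV(3) H .
  qed
  (* The reversed pencil has been reduced to diag(I, - rev Z); L and R repair the sign and the
     order inside the last block. *)
  define L :: "'a mat" where "L = (- 1\<^sub>m (k * n)) \<oplus>\<^sub>d antidiag n"
  define R :: "'a mat" where "R = 1\<^sub>m (k * n) \<oplus>\<^sub>d antidiag n"
  have LGL: "L \<in> GL S ?N" and RGL: "R \<in> GL S ?N"
    using GL_dsum[OF GL_uminus_one antidiag_GL[of n], of "k * n"] GL_dsum[OF GL_one antidiag_GL[of n], of "k * n"]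
    by (simp_all add: L_def R_def add.commute)
  have [simp]: "dim_row L = ?N" "dim_col L = ?N" "dim_row R = ?N" "dim_col R = ?N"
    by (simp_all add: L_def R_def add.commute)
  let ?F = "antidiag ?N :: 'a mat"
  have "L * (U * (?F * Xi)) * T * (Yi * ((?F * V) * R)) = L * (U * (?F * (Xi * (T * Yi)) * ?F) * V) * R"
    by (simp add: mult_assoc_dim)
  also have "?F * (Xi * (T * Yi)) * ?F = rev_mat B" unfolding B by (simp add: rev_mat_def)
  also have "L * (U * rev_mat B * V) * R = 1\<^sub>m (k * n) \<oplus>\<^sub>d Z"
  proof -
    have "- (1\<^sub>m (k * n) \<oplus>\<^sub>d - rev_mat Z) = - 1\<^sub>m (k * n) \<oplus>\<^sub>d rev_mat Z"
      unfolding dsum_uminus by simp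
    moreover have "- 1\<^sub>m (k * n) * - 1\<^sub>m (k * n) = (1\<^sub>m (k * n) :: 'a mat)" by simp
    moreover have "antidiag n * rev_mat Z * antidiag n = Z" 
      using rev_mat_rev_mat[of Z] unfolding rev_mat_def[of "rev_mat Z"] rev_mat_dim Zd .
    ultimately show ?thesis unfolding UBV L_def R_def
      by (simp add: dsum_mult)
  qed
  finally have "L * (U * (?F * Xi)) * T * (Yi * ((?F * V) * R)) = 1\<^sub>m (k * n) \<oplus>\<^sub>d Z" .
  moreover have "L * (U * (?F * Xi)) \<in> GL S ?N" "Yi * ((?F * V) * R) \<in> GL S ?N"
    by (intro GL_mult LGL RGL UV antidiag_GL XiGL YiGL)+
  ultimately show ?thesis unfolding T_def E_def by blast
qed

end

section \<open>Index tuples and block columns\<close>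

definition descent :: "nat \<Rightarrow> index list" where
  "descent q = map PosI (rev [0..<Suc q])"

lemma descent_0: "descent 0 = [PosI 0]"
  and descent_Suc: "descent (Suc q) = PosI (Suc q) # descent q"
  by (simp_all add: descent_def)

lemma descent_Cons: "\<exists>xs. descent q = PosI q # xs"
  by (cases q) (simp_all add: descent_0 descent_Suc)

text \<open>The number of inversions at \<open>0\<close> as a relation: this form can be followed through a list
  without ever evaluating the definite description.\<close>

definition inversion_count :: "index list \<Rightarrow> nat \<Rightarrow> bool" where
  "inversion_count \<beta> q \<longleftrightarrow> subseq (descent q) \<beta> \<and> \<not> subseq (descent (Suc q)) \<beta>"

lemma descent_antimono: "subseq (descent q') \<beta> \<Longrightarrow> q \<le> q' \<Longrightarrow> subseq (descent q) \<beta>"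
proof (induction q')
  case (Suc q')
  then show ?case by (cases "q = Suc q'") (auto simp: descent_Suc dest: subseq_Cons')
qed simp

lemma inversion_count_unique: "inversion_count \<beta> q \<Longrightarrow> inversion_count \<beta> q' \<Longrightarrow> q = q'"
  unfolding inversion_count_def by (metis descent_antimono linorder_neqE_nat Suc_leI)

lemma inversion_count_mem: "inversion_count \<beta> q \<Longrightarrow> PosI i \<in> set \<beta>" if "i \<le> q" for i
proof -
  assume "inversion_count \<beta> q"
  then have "subseq (descent q) \<beta>" by (simp add: inversion_count_def)
  moreover have "PosI i \<in> set (descent q)" using that by (auto simp: descent_def)
  ultimately show "PosI i \<in> set \<beta>" by (metis subseq_singleton_left subseq_order.trans)
qed

lemma inversions_eq:
  assumes "inversion_count \<beta> q"
  shows "inversions 0 \<beta> = int q"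
proof -
  have "subseq (map PosI (rev [0..<0 + p + 1])) \<beta> \<and> \<not> subseq (map PosI (rev [0..<0 + p + 2])) \<beta> \<longleftrightarrow> inversion_count \<beta> p" for p
    by (simp add: inversion_count_def descent_def numeral_2_eq_2 del: upt_Suc)
  moreover have "(THE p. inversion_count \<beta> p) = q"
    using assms inversion_count_unique by (intro the_equality) auto
  ultimately show ?thesis
    using inversion_count_mem[OF _ assms, of 0] by (simp add: inversions_def del: upt_Suc)
qed

lemma subseq_rev_iff: "subseq (rev xs) (rev ys) \<longleftrightarrow> subseq xs ys"
proof -
  have "subseq (rev xs) (rev ys)" if "subseq xs ys" for xs ys :: "'a list"
    using that by (induction rule: list_emb.induct) (auto intro: list_emb_append_mono subseq_rev_drop_many)
  from this[of xs ys] this[of "rev xs" "rev ys"] show ?thesis by auto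
qed

lemma consecutions_eq:
  assumes "inversion_count (rev \<beta>) q"
  shows "consecutions 0 \<beta> = int q"
proof -
  have "subseq (map PosI [0..<0 + p + 1]) \<beta> \<and> \<not> subseq (map PosI [0..<0 + p + 2]) \<beta> \<longleftrightarrow> inversion_count (rev \<beta>) p" for p
    using subseq_rev_iff[of "map PosI [0..<p + 1]" \<beta>] subseq_rev_iff[of "map PosI [0..<p + 2]" \<beta>]
    by (simp add: inversion_count_def descent_def numeral_2_eq_2 rev_map del: upt_Suc)
  moreover have "(THE p. inversion_count (rev \<beta>) p) = q"
    using assms inversion_count_unique by (intro the_equality) auto
  ultimately show ?thesis
    using inversion_count_mem[OF _ assms, of 0] by (simp add: consecutions_def del: upt_Suc)
qed

text \<open>The form in which the SIP is applied: the two occurrences are given by a decomposition of the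
  tuple rather than by positions.\<close>

lemma SIP_between:
  assumes "SIP (\<alpha> @ x # \<gamma> @ x # \<beta>)"
  shows "\<exists>s\<in>set \<gamma>. is_succ_index s x"
proof -
  let ?l = "\<alpha> @ x # \<gamma> @ x # \<beta>" and ?a = "length \<alpha>" and ?b = "length \<alpha> + Suc (length \<gamma>)"
  have "?l ! ?a = x" "?l ! ?b = x" by (simp_all add: nth_append)
  then obtain c where c: "?a < c" "c < ?b" "is_succ_index (?l ! c) x"
    using assms[unfolded SIP_def, rule_format, of ?a ?b] by auto
  define d where "d = c - Suc ?a"
  have "c = ?a + Suc d" "d < length \<gamma>" using c by (simp_all add: d_def)
  then have "?l ! c = \<gamma> ! d" by (simp add: nth_append)
  then show ?thesis using c(3) \<open>d < length \<gamma>\<close> by (metis nth_mem)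
qed

lemma SIP_tl: "SIP (x # \<alpha>) \<Longrightarrow> SIP \<alpha>"
  unfolding SIP_def
proof (intro allI impI)
  fix a b
  assume h: "\<forall>a b. a < b \<and> b < length (x # \<alpha>) \<and> (x # \<alpha>) ! a = (x # \<alpha>) ! b \<longrightarrow>
     (\<exists>c. a < c \<and> c < b \<and> is_succ_index ((x # \<alpha>) ! c) ((x # \<alpha>) ! a))"
    and ab: "a < b \<and> b < length \<alpha> \<and> \<alpha> ! a = \<alpha> ! b"
  then obtain c where c: "Suc a < c" "c < Suc b" "is_succ_index ((x # \<alpha>) ! c) (\<alpha> ! a)"
    using h[rule_format, of "Suc a" "Suc b"] by auto
  then show "\<exists>c. a < c \<and> c < b \<and> is_succ_index (\<alpha> ! c) (\<alpha> ! a)"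
    by (intro exI[of _ "c - 1"]) (cases c; auto)
qed

text \<open>The index \<open>j\<close> itself cannot be prepended: by the SIP a \<open>j + 1\<close> would have to occur
  before the first \<open>j\<close>, hence before a whole descent from \<open>j\<close>, and there would be one more inversion.\<close>

lemma inversion_count_Cons:
  assumes inv: "inversion_count \<beta> j" and sip: "SIP (PosI i # \<beta>)"
  shows "i \<noteq> j" "inversion_count (PosI i # \<beta>) (if i = Suc j then Suc j else j)"
proof -
  show ne: "i \<noteq> j"
  proof
    assume ij: "i = j"
    have "PosI j \<in> set \<beta>" by (rule inversion_count_mem[OF _ inv]) simp
    then obtain \<beta>1 \<beta>2 where b: "\<beta> = \<beta>1 @ PosI j # \<beta>2" "PosI j \<notin> set \<beta>1" by (metis split_list_first)
    have "SIP ([] @ PosI j # \<beta>1 @ PosI j # \<beta>2)" using sip b(1) ij by simp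
    from SIP_between[OF this] obtain s where "s \<in> set \<beta>1" "s = PosI (Suc j)" by auto
    then have 1: "subseq [PosI (Suc j)] \<beta>1" by (simp add: subseq_singleton_left)
    obtain xs where xs: "descent j = PosI j # xs" using descent_Cons by blast
    have "subseq (PosI j # xs) (\<beta>1 @ PosI j # \<beta>2)" using inv b(1) xs by (simp add: inversion_count_def)
    then have 2: "subseq (descent j) (PosI j # \<beta>2)"
      unfolding xs using b(2) by (induction \<beta>1) auto
    have "subseq ([PosI (Suc j)] @ descent j) (\<beta>1 @ (PosI j # \<beta>2))"
      by (rule list_emb_append_mono[OF 1 2])
    then show False using inv b(1) by (simp add: inversion_count_def descent_Suc)
  qed
  show "inversion_count (PosI i # \<beta>) (if i = Suc j then Suc j else j)"
  proof (cases "i = Suc j")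
    case True
    have "\<not> subseq (descent (Suc (Suc j))) \<beta>"
      using inv descent_antimono[of "Suc (Suc j)" \<beta> "Suc j"] by (auto simp: inversion_count_def)
    then show ?thesis using inv True by (simp add: inversion_count_def descent_Suc)
  next
    case False
    then show ?thesis using inv ne by (simp add: inversion_count_def descent_Suc subseq_Cons2_iff list_emb_Cons)
  qed
qed

text \<open>The block column \<open>e_{m-j}\<close> of the identity with \<open>m\<close> blocks. Counting from the bottom, from \<open>0\<close>,
  matches the numbering of the elementary matrices.\<close>

definition block_col :: "nat \<Rightarrow> nat \<Rightarrow> nat \<Rightarrow> 'a :: {zero,one} mat" where
  "block_col m n j = 0\<^sub>m ((m - 1 - j) * n) n @\<^sub>r 1\<^sub>m n @\<^sub>r 0\<^sub>m (j * n) n"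

lemma append_rows_assoc:
  "(A @\<^sub>r B) @\<^sub>r C = A @\<^sub>r (B @\<^sub>r C)" if "dim_col A = n" "dim_col B = n" "dim_col C = n"
proof (rule eq_matI)
  fix i j assume "i < dim_row (A @\<^sub>r (B @\<^sub>r C))" "j < dim_col (A @\<^sub>r (B @\<^sub>r C))"
  then have ij: "i < dim_row A + (dim_row B + dim_row C)" "j < n" using that by simp_all
  consider "i < dim_row A" | "dim_row A \<le> i" "i < dim_row A + dim_row B" | "dim_row A + dim_row B \<le> i" by linarith
  then show "((A @\<^sub>r B) @\<^sub>r C) $$ (i, j) = (A @\<^sub>r (B @\<^sub>r C)) $$ (i, j)"
    using ij that by cases (simp_all add: append_rows_index less_diff_conv2)
qed simp_all

lemma append_rows_zero: "0\<^sub>m a n @\<^sub>r 0\<^sub>m b n = 0\<^sub>m (a + b) n"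
  by (rule eq_matI) (simp_all add: append_rows_index)

lemma block_col_dim: "j < m \<Longrightarrow> dim_row (block_col m n j) = m * n" "dim_col (block_col m n j) = n"
proof -
  assume "j < m"
  then have "m = (m - 1 - j) + (1 + j)" by simp
  then have "m * n = ((m - 1 - j) + (1 + j)) * n" by metis
  then show "dim_row (block_col m n j) = m * n" by (simp add: block_col_def add_mult_distrib del: diff_diff_left)
qed (simp add: block_col_def)

lemma block_col_carrier: "j < m \<Longrightarrow> block_col m n j \<in> carrier_mat (m * n) n"
  by (rule carrier_matI) (simp_all add: block_col_dim)

lemma block_col_above: 
  assumes "j < q" shows "block_col (p + q) n j = 0\<^sub>m (p * n) n @\<^sub>r block_col q n j"
proof -
  have "(p + q - 1 - j) * n = p * n + (q - 1 - j) * n"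
    using assms by (simp add: add_mult_distrib[symmetric] del: diff_diff_left)
  then show ?thesis unfolding block_col_def
    by (simp add: append_rows_zero[symmetric] append_rows_assoc[where n = n] del: diff_diff_left)
qed

lemma block_col_below:
  assumes "q \<le> j" "j < p + q" shows "block_col (p + q) n j = block_col p n (j - q) @\<^sub>r 0\<^sub>m (q * n) n"
proof -
  have "p + q - 1 - j = p - 1 - (j - q)" "j * n = (j - q) * n + q * n"
    using assms by (simp_all add: add_mult_distrib[symmetric])
  then show ?thesis unfolding block_col_def
    by (simp only: append_rows_zero[symmetric])
       (simp add: append_rows_assoc[where n = n] del: diff_diff_left)
qed

lemma dsum_block_col_above:
  fixes A :: "'a :: comm_ring_1 mat"
  assumes "A \<in> carrier_mat (p * n) (p * n)" "j < q"
  shows "(A \<oplus>\<^sub>d 1\<^sub>m (q * n)) * block_col (p + q) n j = block_col (p + q) n j"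
  unfolding block_col_above[OF assms(2)] using assms
  by (subst dsum_append_rows) (simp_all add: block_col_dim left_mult_one_mat')

lemma dsum_block_col_below:
  fixes A :: "'a :: comm_ring_1 mat"
  assumes "A \<in> carrier_mat (q * n) (q * n)" "q \<le> j" "j < p + q"
  shows "(1\<^sub>m (p * n) \<oplus>\<^sub>d A) * block_col (p + q) n j = block_col (p + q) n j"
proof -
  have "j - q < p" using assms by simp
  then show ?thesis
  unfolding block_col_below[OF assms(2,3)] using assms
  by (subst dsum_append_rows) (simp_all add: block_col_dim left_mult_one_mat')
qed

text \<open>A matrix that is nontrivial only in the two blocks numbered \<open>i - 1\<close> and \<open>i\<close> from the bottom
  fixes all other block columns.\<close>

lemma mid_block_col:
  fixes A :: "'a :: comm_ring_1 mat"
  assumes i: "0 < i" "i < m" and A: "A \<in> carrier_mat (n + n) (n + n)" 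
    and j: "j < m" "j \<noteq> i" "Suc j \<noteq> i"
  shows "(1\<^sub>m ((m - i - 1) * n) \<oplus>\<^sub>d A \<oplus>\<^sub>d 1\<^sub>m ((i - 1) * n)) * block_col m n j = block_col m n j"
proof (cases "j < i")
  case True
  then have "j < i - 1" using j by simp
  moreover have "1\<^sub>m ((m - i - 1) * n) \<oplus>\<^sub>d A \<in> carrier_mat ((m - i + 1) * n) ((m - i + 1) * n)"
  proof -
    have "(m - i + 1) * n = (m - i - 1) * n + (n + n)"
      using i by (cases "m - i") simp_all
    then show ?thesis using A by (intro carrier_matI) simp_all
  qed
  moreover have "m = (m - i + 1) + (i - 1)" using i by simp
  ultimately show ?thesis
    using dsum_block_col_above[of "1\<^sub>m ((m - i - 1) * n) \<oplus>\<^sub>d A" "m - i + 1" n j "i - 1"]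
    by (simp only: dsum_assoc)
next
  case False
  then have j': "i + 1 \<le> j" using j by simp
  have "A \<oplus>\<^sub>d 1\<^sub>m ((i - 1) * n) \<in> carrier_mat ((i + 1) * n) ((i + 1) * n)"
  proof -
    have "(i + 1) * n = n + n + (i - 1) * n"
      using i by (cases i) simp_all
    then show ?thesis using A by (intro carrier_matI) simp_all
  qed
  moreover have "m = (m - i - 1) + (i + 1)" using i by simp
  ultimately show ?thesis
    using dsum_block_col_below[of "A \<oplus>\<^sub>d 1\<^sub>m ((i - 1) * n)" "i + 1" n j "m - i - 1"] j j'
    by metis
qed

lemma gelem_pos_block_col_fix:
  fixes X :: "'a :: comm_ring_1 mat"
  assumes i: "i < m" and X: "X \<in> carrier_mat n n" and j: "j < m" "j \<noteq> i" "Suc j \<noteq> i"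
  shows "gelem m n (PosI i) X * block_col m n j = block_col m n j"
proof (cases "i = 0")
  case True
  have m: "m = (m - 1) + 1" using i by simp
  have X1: "X \<in> carrier_mat (1 * n) (1 * n)" using X by simp
  have j1: "1 \<le> j" "j < m - 1 + 1" using j True by simp_all
  show ?thesis using dsum_block_col_below[OF X1 j1] True m[symmetric]
    by (simp only: gelem.simps simp_thms if_True)
next
  case False
  have "four_block_mat X (1\<^sub>m n) (1\<^sub>m n) (0\<^sub>m n n) \<in> carrier_mat (n + n) (n + n)"
    using X by simp
  from mid_block_col[OF _ i this j] False show ?thesis by (simp add: gelem.simps)
qed

lemma gelem_neg_block_col_fix:
  fixes X :: "'a :: comm_ring_1 mat"
  assumes i: "0 < i" "i \<le> m" and X: "X \<in> carrier_mat n n" and j: "j < m" "j \<noteq> i" "Suc j \<noteq> i"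
  shows "gelem m n (NegI i) X * block_col m n j = block_col m n j"
proof (cases "i = m")
  case True
  have m: "m = 1 + (m - 1)" using i by simp
  have X1: "X \<in> carrier_mat (1 * n) (1 * n)" using X by simp
  have j1: "j < m - 1" using j True by simp
  show ?thesis using dsum_block_col_above[OF X1 j1] True m[symmetric]
    by (simp only: gelem.simps simp_thms if_True)
next
  case False
  have "four_block_mat (0\<^sub>m n n) (1\<^sub>m n) (1\<^sub>m n) X \<in> carrier_mat (n + n) (n + n)"
    using X by simp
  from mid_block_col[OF i(1) _ this j] False i(2) show ?thesis by (simp add: gelem.simps)
qed

lemma gelem_pos_block_col_shift:
  fixes X :: "'a :: comm_ring_1 mat"
  assumes j: "Suc j < m" and X: "X \<in> carrier_mat n n"
  shows "gelem m n (PosI (Suc j)) X * block_col m n j = block_col m n (Suc j)"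
proof -
  let ?a = "(m - Suc j - 1) * n" and ?F = "four_block_mat X (1\<^sub>m n) (1\<^sub>m n) (0\<^sub>m n n)"
  have "(m - 1 - j) * n = ?a + n" using j by (cases "m - Suc j") simp_all
  then have 1: "block_col m n j = 0\<^sub>m ?a n @\<^sub>r ((0\<^sub>m n n @\<^sub>r 1\<^sub>m n) @\<^sub>r 0\<^sub>m (j * n) n)"
    unfolding block_col_def
    by (simp only: append_rows_zero[symmetric]) (simp add: append_rows_assoc[where n = n])
  have 2: "block_col m n (Suc j) = 0\<^sub>m ?a n @\<^sub>r ((1\<^sub>m n @\<^sub>r 0\<^sub>m n n) @\<^sub>r 0\<^sub>m (j * n) n)"
    unfolding block_col_def
    by (simp add: append_rows_zero[symmetric] append_rows_assoc[where n = n])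
  have "?F * (0\<^sub>m n n @\<^sub>r 1\<^sub>m n) = 1\<^sub>m n @\<^sub>r 0\<^sub>m n n"
    by (subst four_block_append_rows[where a = n and b = n and p = n and q = n and k = n]) (use X in simp_all)
  then have "(1\<^sub>m ?a \<oplus>\<^sub>d (?F \<oplus>\<^sub>d 1\<^sub>m (j * n))) * (0\<^sub>m ?a n @\<^sub>r ((0\<^sub>m n n @\<^sub>r 1\<^sub>m n) @\<^sub>r 0\<^sub>m (j * n) n))
     = 0\<^sub>m ?a n @\<^sub>r ((1\<^sub>m n @\<^sub>r 0\<^sub>m n n) @\<^sub>r 0\<^sub>m (j * n) n)"
    using X by (simp add: dsum_append_rows)
  then show ?thesis unfolding 1 2 by (simp add: gelem.simps)
qed

lemma last_block_eq_block_col: "last_block k n = block_col (Suc k) n 0"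
proof -
  have "1\<^sub>m n @\<^sub>r 0\<^sub>m 0 n = (1\<^sub>m n :: 'a mat)" 
    by (rule eq_matI) (simp_all add: append_rows_index)
  then show ?thesis by (simp add: last_block_def block_col_def)
qed

text \<open>A tuple together with its assignment is kept as one list of pairs, so that the first factor can
  be split off from both at once.\<close>

definition iprod :: "nat \<Rightarrow> nat \<Rightarrow> (index \<times> 'a :: semiring_1 mat) list \<Rightarrow> 'a mat" where
  "iprod m n ps = prod_mats (m * n) (map (\<lambda>(s, X). gelem m n s X) ps)"

lemma iprod_Nil [simp]: "iprod m n [] = 1\<^sub>m (m * n)"
  and iprod_Cons [simp]: "iprod m n ((s, X) # ps) = gelem m n s X * iprod m n ps"
  by (simp_all add: iprod_def)

lemma iprod_carrier:
  assumes "\<And>s X. (s, X) \<in> set ps \<Longrightarrow> gelem m n s X \<in> carrier_mat (m * n) (m * n)"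
  shows "iprod m n ps \<in> carrier_mat (m * n) (m * n)"
  unfolding iprod_def using assms by (intro prod_mats_carrier) auto

text \<open>Multiplication by the matrices of a tuple moves the block exactly as far as the number of
  inversions at \<open>0\<close> grows. The SIP excludes the one index whose factor would produce an entry \<open>X\<close>, so
  the result is the same for every assignment.\<close>

lemma iprod_block_col:
  fixes ps :: "(index \<times> 'a :: comm_ring_1 mat) list"
  assumes "SIP (map fst ps @ \<beta>)" "inversion_count \<beta> j" "j < m"
    and "\<And>s X. (s, X) \<in> set ps \<Longrightarrow> X \<in> carrier_mat n n \<and> (\<exists>i<m. s = PosI i)"
  shows "\<exists>j'<m. inversion_count (map fst ps @ \<beta>) j' \<and> iprod m n ps * block_col m n j = block_col m n j'"
  using assms(1,4)
proof (induction ps)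
  case Nil
  then show ?case using assms(2,3) left_mult_one_mat[OF block_col_carrier[OF assms(3), of n]]
    by (intro exI[of _ j]) simp
next
  case (Cons p ps)
  obtain s X where p: "p = (s, X)" by (cases p)
  obtain i where i: "i < m" "s = PosI i" and X: "X \<in> carrier_mat n n" using Cons.prems(2)[of s X] p by auto
  have sip: "SIP (PosI i # (map fst ps @ \<beta>))" using Cons.prems(1) p i by simp
  obtain j' where j': "j' < m" "inversion_count (map fst ps @ \<beta>) j'" "iprod m n ps * block_col m n j = block_col m n j'"
    using Cons.IH[OF SIP_tl[OF sip]] Cons.prems(2) by (meson list.set_intros(2))
  note st = inversion_count_Cons[OF j'(2) sip]
  have dims: "gelem m n s X \<in> carrier_mat (m * n) (m * n)" unfolding i(2) by (rule gelem_pos_dim[OF i(1) X])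
  have "iprod m n ps \<in> carrier_mat (m * n) (m * n)"
  proof (rule iprod_carrier)
    fix t Y assume "(t, Y) \<in> set ps"
    then have "Y \<in> carrier_mat n n \<and> (\<exists>i<m. t = PosI i)" by (intro Cons.prems(2)) simp
    then show "gelem m n t Y \<in> carrier_mat (m * n) (m * n)" using gelem_pos_dim by blast
  qed
  then have "iprod m n (p # ps) * block_col m n j = gelem m n (PosI i) X * block_col m n j'"
    unfolding j'(3)[symmetric] using p i(2) assoc_mult_mat[OF dims _ block_col_carrier[OF assms(3)]] by simp
  also have "\<dots> = block_col m n (if i = Suc j' then Suc j' else j')"
    using gelem_pos_block_col_shift[of j' m X n] gelem_pos_block_col_fix[OF i(1) X j'(1)] st(1) i(1) X by auto
  finally show ?case using st(2) p i j'(1) by (intro exI[of _ "if i = Suc j' then Suc j' else j'"]) simp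
qed

text \<open>The factors with negative index must avoid the two indices whose elementary matrices touch
  the given block.\<close>

lemma iprod_block_col_fix:
  fixes ps :: "(index \<times> 'a :: comm_ring_1 mat) list"
  assumes "j < m"
    and "\<And>s X. (s, X) \<in> set ps \<Longrightarrow> X \<in> carrier_mat n n \<and> (\<exists>i. 0 < i \<and> i \<le> m \<and> s = NegI i \<and> j \<noteq> i \<and> Suc j \<noteq> i)"
  shows "iprod m n ps * block_col m n j = block_col m n j"
  using assms(2)
proof (induction ps)
  case Nil
  then show ?case using left_mult_one_mat[OF block_col_carrier[OF assms(1), of n]] by simp
next
  case (Cons p ps)
  obtain s X where p: "p = (s, X)" by (cases p)
  obtain i where i: "0 < i" "i \<le> m" "s = NegI i" "j \<noteq> i" "Suc j \<noteq> i" and X: "X \<in> carrier_mat n n" 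
    using Cons.prems[of s X] p by auto
  have IH: "iprod m n ps * block_col m n j = block_col m n j"
    using Cons.prems by (intro Cons.IH) (meson list.set_intros(2))
  have dims: "gelem m n s X \<in> carrier_mat (m * n) (m * n)" unfolding i(3) by (rule gelem_neg_dim[OF i(1,2) X])
  have "iprod m n ps \<in> carrier_mat (m * n) (m * n)"
  proof (rule iprod_carrier)
    fix t Y assume "(t, Y) \<in> set ps"
    then have "Y \<in> carrier_mat n n \<and> (\<exists>i. 0 < i \<and> i \<le> m \<and> t = NegI i \<and> j \<noteq> i \<and> Suc j \<noteq> i)" by (intro Cons.prems) simp
    then show "gelem m n t Y \<in> carrier_mat (m * n) (m * n)" using gelem_neg_dim by blast
  qed
  then have "iprod m n (p # ps) * block_col m n j = gelem m n (NegI i) X * (iprod m n ps * block_col m n j)"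
    using p i(3) assoc_mult_mat[OF dims _ block_col_carrier[OF assms(1)]] by simp
  also have "\<dots> = block_col m n j"
    unfolding IH by (rule gelem_neg_block_col_fix[OF i(1,2) X assms(1) i(4,5)])
  finally show ?case .
qed

section \<open>Proper rational matrices\<close>

lemma at_infinity_complex_neq_bot: "(at_infinity :: complex filter) \<noteq> bot"
proof
  assume "(at_infinity :: complex filter) = bot"
  then have "eventually (\<lambda>_ :: complex. False) at_infinity" by simp
  then obtain b where "\<forall>x :: complex. b \<le> norm x \<longrightarrow> False" by (auto simp: eventually_at_infinity)
  then have "\<not> b \<le> norm (of_real \<bar>b\<bar> :: complex)" by blast
  then show False by simp
qed

lemma eventually_poly_nonzero_at_infinity:
  fixes p :: "complex poly"
  assumes "p \<noteq> 0"
  shows "eventually (\<lambda>z. poly p z \<noteq> 0) at_infinity"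
proof -
  have fin: "finite {z. poly p z = 0}" by (rule poly_roots_finite[OF assms])
  have "eventually (\<lambda>z. z \<noteq> a) at_infinity" for a :: complex
    unfolding eventually_at_infinity by (rule exI[of _ "norm a + 1"]) auto
  then have "eventually (\<lambda>z. \<forall>a\<in>{z. poly p z = 0}. z \<noteq> a) at_infinity"
    by (intro eventually_ball_finite[OF fin]) simp
  then show ?thesis by (rule eventually_mono) auto
qed

text \<open>Near infinity the value of a rational function can be computed from any of its
  representations as a fraction, not only from the reduced one. All limit laws rest on this.\<close>

lemma eval_rat_Fract:
  assumes "q \<noteq> 0"
  shows "eventually (\<lambda>z. eval_rat (Fract p q) z = poly p z / poly q z) at_infinity"
proof -
  let ?a = "fst (quot_of_fract (Fract p q))" and ?b = "snd (quot_of_fract (Fract p q))"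
  have "Fract ?a ?b = Fract p q" by simp
  then have e: "?a * q = p * ?b" using eq_fract(1)[of ?b q ?a p] assms by simp
  have "eventually (\<lambda>z. poly q z \<noteq> 0 \<and> poly ?b z \<noteq> 0) at_infinity"
    using eventually_poly_nonzero_at_infinity[OF assms] eventually_poly_nonzero_at_infinity[of ?b]
    by (simp add: eventually_conj)
  then show ?thesis
  proof (rule eventually_mono)
    fix z assume nz: "poly q z \<noteq> 0 \<and> poly ?b z \<noteq> 0"
    have "poly ?a z * poly q z = poly p z * poly ?b z" using arg_cong[OF e, of "\<lambda>x. poly x z"] by simp
    then show "eval_rat (Fract p q) z = poly p z / poly q z"
      using nz by (simp add: eval_rat_def frac_eq_eq)
  qed
qed

text \<open>A rational function is proper if it has a limit. A relation is used because the limit need not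
  exist.\<close>

definition limit_at_infinity :: "complex poly fract \<Rightarrow> complex \<Rightarrow> bool" where
  "limit_at_infinity f c \<longleftrightarrow> (eval_rat f \<longlongrightarrow> c) at_infinity"

lemma limit_add_mult:
  assumes "limit_at_infinity f c" "limit_at_infinity g d"
  shows "limit_at_infinity (f + g) (c + d)" "limit_at_infinity (f * g) (c * d)"
proof -
  obtain p q where f: "f = Fract p q" "q \<noteq> 0" by (cases f)
  obtain s t where g: "g = Fract s t" "t \<noteq> 0" by (cases g)
  have ev: "eventually (\<lambda>z. (eval_rat f z = poly p z / poly q z \<and> eval_rat g z = poly s z / poly t z) \<and> (poly q z \<noteq> 0 \<and> poly t z \<noteq> 0)) at_infinity"
    unfolding f g
    by (intro eventually_conj eval_rat_Fract eventually_poly_nonzero_at_infinity f g)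
  have fg: "f + g = Fract (p * t + s * q) (q * t)" "f * g = Fract (p * s) (q * t)" "q * t \<noteq> 0"
    using f g by simp_all
  have "eventually (\<lambda>z. eval_rat f z + eval_rat g z = eval_rat (f + g) z) at_infinity"
    using eventually_conj[OF ev eval_rat_Fract[OF fg(3), of "p * t + s * q"]] unfolding fg(1)
    by (rule eventually_mono) (auto simp: add_frac_eq)
  moreover have "((\<lambda>z. eval_rat f z + eval_rat g z) \<longlongrightarrow> c + d) at_infinity"
    using assms unfolding limit_at_infinity_def by (rule tendsto_add)
  ultimately show "limit_at_infinity (f + g) (c + d)" unfolding limit_at_infinity_def by (rule Lim_transform_eventually[rotated])
  have "eventually (\<lambda>z. eval_rat f z * eval_rat g z = eval_rat (f * g) z) at_infinity"
    using eventually_conj[OF ev eval_rat_Fract[OF fg(3), of "p * s"]] unfolding fg(2)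
    by (rule eventually_mono) auto
  moreover have "((\<lambda>z. eval_rat f z * eval_rat g z) \<longlongrightarrow> c * d) at_infinity"
    using assms unfolding limit_at_infinity_def by (rule tendsto_mult)
  ultimately show "limit_at_infinity (f * g) (c * d)" unfolding limit_at_infinity_def by (rule Lim_transform_eventually[rotated])
qed

lemma limit_const: "limit_at_infinity (to_fract [:c:]) c"
proof -
  have "eventually (\<lambda>z. c = eval_rat (to_fract [:c:]) z) at_infinity"
    using eval_rat_Fract[of 1 "[:c:]"] unfolding to_fract_def by (auto elim: eventually_mono)
  then show ?thesis unfolding limit_at_infinity_def by (rule Lim_transform_eventually[OF tendsto_const])
qed

lemma to_fract_const_simps: "to_fract [:0:] = (0 :: complex poly fract)" "to_fract [:1:] = (1 :: complex poly fract)"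
  "to_fract [:- 1:] = (- 1 :: complex poly fract)"
  by (simp_all add: to_fract_def Zero_fract_def One_fract_def one_pCons)

lemma limit_0: "limit_at_infinity 0 0" and limit_1: "limit_at_infinity 1 1" and limit_m1: "limit_at_infinity (- 1) (- 1)"
  using limit_const[of 0] limit_const[of 1] limit_const[of "- 1"] unfolding to_fract_const_simps .

lemma limit_uminus: "limit_at_infinity f c \<Longrightarrow> limit_at_infinity (- f) (- c)"
  using limit_add_mult(2)[OF limit_m1, of f c] by simp

lemma limit_unique: "limit_at_infinity f c \<Longrightarrow> limit_at_infinity f d \<Longrightarrow> c = d"
  unfolding limit_at_infinity_def by (rule tendsto_unique[OF at_infinity_complex_neq_bot])

lemma limit_sum: "(\<And>i. i \<in> I \<Longrightarrow> limit_at_infinity (f i) (g i)) \<Longrightarrow> limit_at_infinity (sum f I) (sum g I)"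
  by (induction I rule: infinite_finite_induct) (auto intro: limit_0 limit_add_mult)

lemma limit_prod: "(\<And>i. i \<in> I \<Longrightarrow> limit_at_infinity (f i) (g i)) \<Longrightarrow> limit_at_infinity (prod f I) (prod g I)"
  by (induction I rule: infinite_finite_induct) (auto intro: limit_1 limit_add_mult)

lemma limit_inverse_lam: "limit_at_infinity (inverse lam_rat) 0"
proof -
  have "inverse lam_rat = Fract 1 lam" by (simp add: to_fract_def)
  then have "eventually (\<lambda>z. eval_rat (inverse lam_rat) z = poly 1 z / poly lam z) at_infinity"
    using eval_rat_Fract[of lam 1] by simp
  then have "eventually (\<lambda>z. inverse z = eval_rat (inverse lam_rat) z) at_infinity"
    by (rule eventually_mono) (simp add: field_simps)
  then show ?thesis unfolding limit_at_infinity_def by (rule Lim_transform_eventually[OF tendsto_inverse_0])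
qed

lemma limit_inverse:
  assumes f: "limit_at_infinity f c" and c: "c \<noteq> 0"
  shows "f \<noteq> 0" "limit_at_infinity (inverse f) (inverse c)"
proof -
  show f0: "f \<noteq> 0" using limit_unique[OF f] limit_0 c by blast
  obtain p q where pq: "f = Fract p q" "q \<noteq> 0" by (cases f)
  have p0: "p \<noteq> 0" using f0 pq by (auto simp: fract_collapse)
  have "inverse f = Fract q p" using pq by simp
  then have "eventually (\<lambda>z. eval_rat f z = poly p z / poly q z \<and> eval_rat (inverse f) z = poly q z / poly p z) at_infinity"
    using eventually_conj[OF eval_rat_Fract[OF pq(2), of p] eval_rat_Fract[OF p0, of q]] pq(1) by simp
  then have "eventually (\<lambda>z. inverse (eval_rat f z) = eval_rat (inverse f) z) at_infinity"
    by (rule eventually_mono) simp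
  then show "limit_at_infinity (inverse f) (inverse c)"
    using f c unfolding limit_at_infinity_def by (blast intro: Lim_transform_eventually tendsto_inverse)
qed

definition proper :: "complex poly fract set" where
  "proper = {f. \<exists>c. limit_at_infinity f c}"

interpretation proper: coeff_ring proper
  by unfold_locales (auto simp: proper_def intro: limit_0 limit_1 limit_add_mult limit_uminus)

lemma limit_signof: "limit_at_infinity (signof p) (signof p)"
  by (simp add: sign_def limit_1 limit_m1)

lemma limit_det:
  assumes F: "F \<in> carrier_mat N N" and F0: "F0 \<in> carrier_mat N N"
    and lim: "\<And>i j. i < N \<Longrightarrow> j < N \<Longrightarrow> limit_at_infinity (F $$ (i, j)) (F0 $$ (i, j))"
  shows "limit_at_infinity (det F) (det F0)"
  unfolding det_def'[OF F] det_def'[OF F0]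
proof (intro limit_sum limit_add_mult limit_signof limit_prod lim)
  fix p i assume "p \<in> {p. p permutes {0..<N}}" "i \<in> {0..<N}"
  then show "i < N" "p i < N" using permutes_in_image[of p "{0..<N}" i] by auto
qed

lemma (in coeff_ring) det_in:
  assumes "A \<in> mats S N N" shows "det A \<in> S"
  unfolding det_def'[OF mats_carrier[OF assms]]
proof (intro sum_in mult_in)
  fix p assume p: "p \<in> {p. p permutes {0..<N}}"
  show "signof p \<in> S" by (simp add: sign_def uminus_in)
  have "prod (\<lambda>i. A $$ (i, p i)) I \<in> S" if "I \<subseteq> {0..<N}" for I
    using that
  proof (induction I rule: infinite_finite_induct)
    case (insert i I)
    then have "i < N" "p i < N" using p permutes_in_image[of p "{0..<N}" i] by auto
    then have "A $$ (i, p i) \<in> S" using assms by (simp add: mats_def)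
    then show ?case using insert by (simp add: mult_in)
  qed simp_all
  then show "(\<Prod>i = 0..<N. A $$ (i, p i)) \<in> S" by simp
qed

lemma (in coeff_ring) adj_mat_in:
  assumes "A \<in> mats S N N" shows "adj_mat A \<in> mats S N N"
proof -
  note c = mats_carrier[OF assms]
  have "cofactor A j i \<in> S" if "i < N" "j < N" for i j
  proof -
    have "mat_delete A j i \<in> mats S (N - 1) (N - 1)"
      using assms that c by (auto simp: mats_def mat_delete_def)
    then have "det (mat_delete A j i) \<in> S" by (rule det_in)
    then show ?thesis by (simp add: cofactor_def mult_in power_in uminus_in)
  qed
  then show ?thesis using c by (auto simp: mats_def adj_mat_def)
qed

text \<open>Limits are compatible with products, so the limits of a matrix and of its inverse are
  inverse to each other.\<close>

lemma GL_proper_biproper: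
  assumes "U \<in> GL proper N"
  shows "biproper U"
proof -
  have lim: "\<exists>F0\<in>carrier_mat N N. \<forall>i<N. \<forall>j<N. limit_at_infinity (F $$ (i, j)) (F0 $$ (i, j))" if "F \<in> mats proper N N" for F
  proof -
    have "\<forall>ij. \<exists>c. fst ij < N \<longrightarrow> snd ij < N \<longrightarrow> limit_at_infinity (F $$ ij) c"
      using that by (auto simp: mats_def proper_def)
    then obtain g where "\<forall>ij. fst ij < N \<longrightarrow> snd ij < N \<longrightarrow> limit_at_infinity (F $$ ij) (g ij)" by metis
    then show ?thesis by (intro bexI[of _ "mat N N g"]) auto
  qed
  have prod: "limit_at_infinity ((F * G) $$ (i, j)) ((F0 * G0) $$ (i, j))"
    if "F \<in> carrier_mat N N" "G \<in> carrier_mat N N" "F0 \<in> carrier_mat N N" "G0 \<in> carrier_mat N N"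
      "\<forall>i<N. \<forall>j<N. limit_at_infinity (F $$ (i, j)) (F0 $$ (i, j))" "\<forall>i<N. \<forall>j<N. limit_at_infinity (G $$ (i, j)) (G0 $$ (i, j))"
      "i < N" "j < N" for F G F0 G0 i j
    using that by (auto simp: scalar_prod_def intro!: limit_sum limit_add_mult)
  obtain V where V: "V \<in> GL proper N" "U * V = 1\<^sub>m N" "V * U = 1\<^sub>m N" using assms by (rule GL_E)
  have m: "U \<in> mats proper N N" "V \<in> mats proper N N" using assms V(1) by (auto simp: GL_def)
  obtain U0 where U0: "U0 \<in> carrier_mat N N" "\<forall>i<N. \<forall>j<N. limit_at_infinity (U $$ (i, j)) (U0 $$ (i, j))" using lim[OF m(1)] by blast
  obtain V0 where V0: "V0 \<in> carrier_mat N N" "\<forall>i<N. \<forall>j<N. limit_at_infinity (V $$ (i, j)) (V0 $$ (i, j))" using lim[OF m(2)] by blast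
  note c = mats_carrier[OF m(1)] mats_carrier[OF m(2)]
  have one: "limit_at_infinity ((1\<^sub>m N :: complex poly fract mat) $$ (i, j)) ((1\<^sub>m N :: complex mat) $$ (i, j))" if "i < N" "j < N" for i j
    using that by (simp add: limit_0 limit_1)
  have "U0 * V0 = 1\<^sub>m N"
  proof (rule eq_matI)
    fix i j assume "i < dim_row (1\<^sub>m N :: complex mat)" "j < dim_col (1\<^sub>m N :: complex mat)"
    then have ij: "i < N" "j < N" by simp_all
    show "(U0 * V0) $$ (i, j) = (1\<^sub>m N :: complex mat) $$ (i, j)"
      by (rule limit_unique[OF prod[OF c U0(1) V0(1) U0(2) V0(2) ij, unfolded V(2)] one[OF ij]])
  qed (use U0(1) V0(1) in simp_all)
  moreover have "V0 * U0 = 1\<^sub>m N"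
  proof (rule eq_matI)
    fix i j assume "i < dim_row (1\<^sub>m N :: complex mat)" "j < dim_col (1\<^sub>m N :: complex mat)"
    then have ij: "i < N" "j < N" by simp_all
    show "(V0 * U0) $$ (i, j) = (1\<^sub>m N :: complex mat) $$ (i, j)"
      by (rule limit_unique[OF prod[OF c(2,1) V0(1) U0(1) V0(2) U0(2) ij, unfolded V(3)] one[OF ij]])
  qed (use U0(1) V0(1) in simp_all)
  ultimately have "invertible_mat U0"
    using U0(1) V0(1) by (auto simp: invertible_mat_def inverts_mat_def intro!: exI[of _ V0])
  moreover have "tends_to_at_infinity U U0"
    using U0 c(1) by (auto simp: tends_to_at_infinity_def limit_at_infinity_def)
  ultimately show ?thesis using c(1) by (auto simp: biproper_def)
qed

lemma invertible_mat_E: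
  fixes E :: "'a :: field mat"
  assumes "invertible_mat E" "E \<in> carrier_mat N N"
  obtains F where "F \<in> carrier_mat N N" "E * F = 1\<^sub>m N" "F * E = 1\<^sub>m N"
proof -
  obtain F where F: "inverts_mat E F" "inverts_mat F E" using assms(1) by (auto simp: invertible_mat_def)
  then have e: "E * F = 1\<^sub>m N" "F * E = 1\<^sub>m (dim_row F)" using assms(2) by (auto simp: inverts_mat_def)
  have "dim_col F = N" using arg_cong[OF e(1), of dim_col] by simp
  moreover have "dim_row F = N" using arg_cong[OF e(2), of dim_col] assms(2) by simp
  ultimately show ?thesis using that[of F] e by (auto intro: carrier_matI)
qed

lemma one_smult_mat: "1 \<cdot>\<^sub>m A = (A :: 'a :: comm_semiring_1 mat)"
  by (rule eq_matI) simp_all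

lemma inv_mat_eq:
  fixes A :: "'a :: field mat"
  assumes A: "A \<in> carrier_mat N N" and B: "B \<in> carrier_mat N N" and AB: "A * B = 1\<^sub>m N" "B * A = 1\<^sub>m N"
  shows "inv_mat A = B"
proof (cases "mat_inverse A")
  case None
  have "A \<in> Units (ring_mat TYPE('a) N ())"
    using A B AB by (auto simp: Units_def ring_mat_def)
  then show ?thesis using mat_inverse(1)[OF A None, of "()"] by blast
next
  case (Some C)
  then have C: "A * C = 1\<^sub>m N" "C * A = 1\<^sub>m N" "C \<in> carrier_mat N N" using mat_inverse(2)[OF A Some] by auto
  have "C = C * (A * B)" using AB C by simp
  also have "\<dots> = (C * A) * B" using assoc_mult_mat[OF C(3) A B] by simp
  also have "\<dots> = B" using C B by simp
  finally show ?thesis using Some by simp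
qed

text \<open>With \<open>\<mu> = 1/\<lambda>\<close> one has \<open>\<lambda>E - A = \<lambda> (E - \<mu>A)\<close>. The determinant of \<open>E - \<mu>A\<close> tends to that of \<open>E\<close>, which is
  not zero, so its inverse is proper, and so is the inverse of the matrix by the adjugate formula.\<close>

lemma resolvent_proper:
  assumes A: "A \<in> carrier_mat r r" and E: "E \<in> carrier_mat r r" and inv: "invertible_mat E"
  shows "inv_mat (lam_rat \<cdot>\<^sub>m rat_mat (poly_mat E) - rat_mat (poly_mat A)) \<in> mats proper r r"
proof -
  let ?E = "rat_mat (poly_mat E)" and ?A = "rat_mat (poly_mat A)" and ?mu = "inverse lam_rat"
  define K where "K = ?E - ?mu \<cdot>\<^sub>m ?A"
  have lm: "lam_rat * ?mu = 1" by simp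
  have mu: "?mu \<in> proper" using limit_inverse_lam by (auto simp: proper_def)
  have const: "rat_mat (poly_mat X) \<in> mats proper a b" if "X \<in> carrier_mat a b" for X a b
    using that limit_const by (auto simp: mats_def proper_def)
  have Km: "K \<in> mats proper r r"
    unfolding K_def by (intro proper.mats_minus proper.mats_smult const A E mu)
  note Kc = mats_carrier[OF Km]
  have "limit_at_infinity (det K) (det E)"
  proof (rule limit_det[OF Kc E])
    fix i j assume ij: "i < r" "j < r"
    have "limit_at_infinity (to_fract [:E $$ (i, j):] + - (?mu * to_fract [:A $$ (i, j):])) (E $$ (i, j) + - (0 * A $$ (i, j)))"
      by (intro limit_add_mult limit_uminus limit_const limit_inverse_lam)
    then show "limit_at_infinity (K $$ (i, j)) (E $$ (i, j))" using ij A E by (simp add: K_def)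
  qed
  moreover have "det E \<noteq> 0"
  proof -
    obtain F where F: "F \<in> carrier_mat r r" "E * F = 1\<^sub>m r" using invertible_mat_E[OF inv E] by blast
    have "det E * det F = 1" using det_mult[OF E F(1)] F(2) by simp
    then show ?thesis by auto
  qed
  ultimately have detK: "det K \<noteq> 0" "inverse (det K) \<in> proper" 
    using limit_inverse[of "det K" "det E"] by (auto simp: proper_def)
  define W where "W = ?mu \<cdot>\<^sub>m (inverse (det K) \<cdot>\<^sub>m adj_mat K)"
  have Wm: "W \<in> mats proper r r"
    unfolding W_def by (intro proper.mats_smult mu detK proper.adj_mat_in Km)
  note Wc = mats_carrier[OF Wm] and adj = adj_mat[OF Kc]
  have eq: "lam_rat \<cdot>\<^sub>m ?E - ?A = lam_rat \<cdot>\<^sub>m K"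
  proof (rule eq_matI)
    fix i j assume "i < dim_row (lam_rat \<cdot>\<^sub>m K)" "j < dim_col (lam_rat \<cdot>\<^sub>m K)"
    then have ij: "i < r" "j < r" using Kc by simp_all
    have "lam_rat * (e - ?mu * a) = lam_rat * e - (lam_rat * ?mu) * a" for e a :: "complex poly fract"
      by (simp only: right_diff_distrib mult.assoc)
    then show "(lam_rat \<cdot>\<^sub>m ?E - ?A) $$ (i, j) = (lam_rat \<cdot>\<^sub>m K) $$ (i, j)"
      using ij A E unfolding lm K_def by simp
  qed (use A E Kc in simp_all)
  have s: "lam_rat * (?mu * (inverse (det K) * det K)) = 1" using detK(1) lm by simp
  have KW: "(lam_rat \<cdot>\<^sub>m K) * W = 1\<^sub>m r"
  proof -
    have "(lam_rat \<cdot>\<^sub>m K) * W = (?mu * (inverse (det K) * lam_rat)) \<cdot>\<^sub>m (K * adj_mat K)"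
      unfolding W_def using Kc adj(1)
      by (simp add: mult_smult_assoc_mat[of _ r r _ r] mult_smult_distrib[of _ r r _ r] smult_smult_mat mult.assoc)
    moreover have "?mu * (inverse (det K) * lam_rat) * det K = 1"
      using s by (simp only: mult_ac)
    ultimately show ?thesis by (simp only: adj(2) smult_smult_mat one_smult_mat)
  qed
  have WK: "W * (lam_rat \<cdot>\<^sub>m K) = 1\<^sub>m r"
  proof -
    have "W * (lam_rat \<cdot>\<^sub>m K) = (lam_rat * (?mu * inverse (det K))) \<cdot>\<^sub>m (adj_mat K * K)"
      unfolding W_def using Kc adj(1)
      by (simp add: mult_smult_assoc_mat[of _ r r _ r] mult_smult_distrib[of _ r r _ r] smult_smult_mat mult.assoc)
    moreover have "lam_rat * (?mu * inverse (det K)) * det K = 1"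
      using s by (simp only: mult_ac)
    ultimately show ?thesis by (simp only: adj(3) smult_smult_mat one_smult_mat)
  qed
  have "inv_mat (lam_rat \<cdot>\<^sub>m K) = W"
    by (rule inv_mat_eq[OF _ Wc KW WK]) (use Kc in simp)
  then show ?thesis unfolding eq using Wm by simp
qed

section \<open>Irreducibility\<close>

lemma mat_mult_unit_vec:
  fixes A :: "'a :: semiring_1 mat"
  assumes "A \<in> carrier_mat n nc" "i < nc"
  shows "A *\<^sub>v unit_vec nc i = col A i"
  using assms by (intro eq_vecI) simp_all

text \<open>Full column rank means trivial kernel; repeated columns are excluded on both sides.\<close>

lemma rank_eq_dim_col_iff:
  fixes A :: "'a :: field mat"
  assumes A: "A \<in> carrier_mat n nc"
  shows "vec_space.rank n A = nc \<longleftrightarrow> (\<forall>v\<in>carrier_vec nc. A *\<^sub>v v = 0\<^sub>v n \<longrightarrow> v = 0\<^sub>v nc)"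
proof -
  interpret vec_space "TYPE('a)" n .
  have len: "length (cols A) = nc" using A by simp
  show ?thesis
  proof
    assume r: "rank A = nc"
    have dist: "distinct (cols A)"
    proof (rule ccontr)
      assume nd: "\<not> distinct (cols A)"
      have "lin_indpt {}" unfolding lin_dep_def by auto
      then obtain S where S: "maximal S (\<lambda>T. T \<subseteq> set (cols A) \<and> lin_indpt T)"
        using maximal_exists_superset[of "set (cols A)" "\<lambda>T. T \<subseteq> set (cols A) \<and> lin_indpt T" "{}"] by auto
      then have "S \<subseteq> set (cols A)" by (simp add: maximal_def)
      then have "card S \<le> card (set (cols A))" by (intro card_mono) simp_all
      also have "\<dots> < nc" using nd card_length[of "cols A"] card_distinct[of "cols A"] len by linarith
      finally show False using rank_card_indpt[OF A S] r by simp
    qed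
    show "\<forall>v\<in>carrier_vec nc. A *\<^sub>v v = 0\<^sub>v n \<longrightarrow> v = 0\<^sub>v nc"
      using lin_depI[OF A _ _ _ dist] full_rank_lin_indpt[OF A r dist] by blast
  next
    assume inj: "\<forall>v\<in>carrier_vec nc. A *\<^sub>v v = 0\<^sub>v n \<longrightarrow> v = 0\<^sub>v nc"
    have dist: "distinct (cols A)"
    proof (rule ccontr)
      assume "\<not> distinct (cols A)"
      then obtain i j where ij: "i < nc" "j < nc" "i \<noteq> j" "col A i = col A j"
        using A by (auto simp: distinct_conv_nth)
      let ?v = "unit_vec nc i - unit_vec nc j :: 'a vec"
      have "A *\<^sub>v ?v = A *\<^sub>v unit_vec nc i - A *\<^sub>v unit_vec nc j"
        by (rule mult_minus_distrib_mat_vec[OF A]) simp_all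
      also have "\<dots> = 0\<^sub>v n" using A ij by (simp add: mat_mult_unit_vec)
      finally have "?v = 0\<^sub>v nc" using inj by simp
      then have "?v $ i = 0" using ij by simp
      then show False using ij by simp
    qed
    have "lin_indpt (set (cols A))"
      using lin_depE[OF A _ dist] inj by metis
    then show "rank A = nc" by (rule lin_indpt_full_rank[OF A dist])
  qed
qed

lemma full_row_rank_mono:
  fixes A A' :: "'a :: field mat"
  assumes A: "A \<in> carrier_mat n nc" and A': "A' \<in> carrier_mat n nc'"
    and sub: "set (cols A) \<subseteq> set (cols A')" and rank: "vec_space.rank n A = n"
  shows "vec_space.rank n A' = n"
proof -
  interpret vec_space "TYPE('a)" n .
  have ex: "\<exists>S. maximal S (\<lambda>T. T \<subseteq> set (cols X) \<and> lin_indpt T)" for X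
  proof -
    have "lin_indpt {}" unfolding lin_dep_def by auto
    then show ?thesis
      using maximal_exists_superset[of "set (cols X)" "\<lambda>T. T \<subseteq> set (cols X) \<and> lin_indpt T" "{}"] by auto
  qed
  obtain S where S: "maximal S (\<lambda>T. T \<subseteq> set (cols A) \<and> lin_indpt T)" using ex by blast
  then have S': "S \<subseteq> set (cols A)" "lin_indpt S" by (simp_all add: maximal_def)
  have "n = card S" using rank_card_indpt[OF A S] rank by simp
  also have "\<dots> \<le> rank A'" by (rule rank_ge_card_indpt[OF A' _ S'(2)]) (use S'(1) sub in blast)
  finally have 1: "n \<le> rank A'" .
  obtain T where T: "maximal T (\<lambda>T. T \<subseteq> set (cols A') \<and> lin_indpt T)" using ex by blast
  then have T': "T \<subseteq> set (cols A')" "lin_indpt T" by (simp_all add: maximal_def)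
  have "T \<subseteq> carrier_vec n" using T'(1) cols_dim[of A'] A' by auto
  then have "card T \<le> n" using li_le_dim(2)[OF fin_dim _ T'(2)] dim_is_n by simp
  then show ?thesis using 1 rank_card_indpt[OF A' T] by simp
qed

lemma zero_append_vec: "0\<^sub>v a @\<^sub>v 0\<^sub>v b = 0\<^sub>v (a + b)"
  by (rule eq_vecI) auto

lemma block_col_mult:
  fixes C :: "'a :: comm_ring_1 mat"
  assumes "C \<in> carrier_mat n r"
  shows "block_col m n j * C = 0\<^sub>m ((m - 1 - j) * n) r @\<^sub>r C @\<^sub>r 0\<^sub>m (j * n) (r :: nat)"
  using assms left_mult_one_mat[OF assms] unfolding block_col_def by (simp add: append_rows_mult)

lemma stacked_rank:
  fixes C H :: "complex mat"
  assumes C: "C \<in> carrier_mat n r" and H: "H \<in> carrier_mat r r" and j: "j < m"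
    and rank: "vec_space.rank (n + r) (C @\<^sub>r H) = r"
  shows "vec_space.rank (m * n + r) (block_col m n j * C @\<^sub>r H) = r"
proof -
  have CH: "C @\<^sub>r H \<in> carrier_mat (n + r) r" using C H by simp
  have bC: "block_col m n j * C \<in> carrier_mat (m * n) r"
    using block_col_carrier[OF j] C by (rule mult_carrier_mat)
  then have bCH: "block_col m n j * C @\<^sub>r H \<in> carrier_mat (m * n + r) r" using H by simp
  show ?thesis unfolding rank_eq_dim_col_iff[OF bCH]
  proof (intro ballI impI)
    fix v :: "complex vec" assume v: "v \<in> carrier_vec r" and z: "(block_col m n j * C @\<^sub>r H) *\<^sub>v v = 0\<^sub>v (m * n + r)"
    have "(block_col m n j * C) *\<^sub>v v @\<^sub>v H *\<^sub>v v = 0\<^sub>v (m * n) @\<^sub>v 0\<^sub>v r"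
      using z unfolding mat_mult_append[OF bC H v] zero_append_vec .
    then have 1: "(block_col m n j * C) *\<^sub>v v = 0\<^sub>v (m * n)" "H *\<^sub>v v = 0\<^sub>v r"
      using append_vec_eq[of "(block_col m n j * C) *\<^sub>v v" "m * n" "0\<^sub>v (m * n)"] mult_mat_vec_carrier[OF bC v] by auto
    let ?a = "(m - 1 - j) * n" and ?b = "j * n"
    have m: "m * n = ?a + (n + ?b)" using block_col_dim(1)[OF j, of n] by (simp add: block_col_def)
    have e1: "(block_col m n j * C) *\<^sub>v v = 0\<^sub>m ?a r *\<^sub>v v @\<^sub>v (C *\<^sub>v v @\<^sub>v 0\<^sub>m ?b r *\<^sub>v v)"
      unfolding block_col_mult[OF C]
      by (subst mat_mult_append[of _ ?a r _ "n + ?b"], simp, use C in simp, rule v, 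
          subst mat_mult_append[of _ n r _ ?b], rule C, simp, rule v, rule refl)
    have e2: "0\<^sub>v (m * n) = 0\<^sub>v ?a @\<^sub>v (0\<^sub>v n @\<^sub>v (0\<^sub>v ?b :: complex vec))" unfolding m zero_append_vec ..
    have "0\<^sub>m ?a r *\<^sub>v v @\<^sub>v (C *\<^sub>v v @\<^sub>v 0\<^sub>m ?b r *\<^sub>v v) = 0\<^sub>v ?a @\<^sub>v (0\<^sub>v n @\<^sub>v (0\<^sub>v ?b :: complex vec))"
      by (rule trans[OF e1[symmetric] trans[OF 1(1) e2]])
    then have "C *\<^sub>v v @\<^sub>v 0\<^sub>m ?b r *\<^sub>v v = 0\<^sub>v n @\<^sub>v (0\<^sub>v ?b :: complex vec)"
      using append_vec_eq[of "0\<^sub>m ?a r *\<^sub>v v" ?a "0\<^sub>v ?a"] mult_mat_vec_carrier[of "0\<^sub>m ?a r" ?a r v] v by auto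
    then have "C *\<^sub>v v = 0\<^sub>v n"
      using append_vec_eq[of "C *\<^sub>v v" n "0\<^sub>v n"] mult_mat_vec_carrier[OF C v] by auto
    then have "(C @\<^sub>r H) *\<^sub>v v = 0\<^sub>v (n + r)"
      unfolding mat_mult_append[OF C H v] 1(2) by (simp add: zero_append_vec)
    then show "v = 0\<^sub>v r" using rank[unfolded rank_eq_dim_col_iff[OF CH]] v by blast
  qed
qed

lemma rows_append_rows:
  assumes "dim_col B = dim_col A"
  shows "set (rows (A @\<^sub>r B)) = set (rows A) \<union> set (rows B)"
proof -
  have r: "row (A @\<^sub>r B) i = (if i < dim_row A then row A i else row B (i - dim_row A))" if "i < dim_row A + dim_row B" for i
    using that assms by (intro eq_vecI) (auto simp: append_rows_index)
  show ?thesis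
  proof (intro equalityI subsetI)
    fix x assume "x \<in> set (rows (A @\<^sub>r B))"
    then obtain i where "i < dim_row A + dim_row B" "x = row (A @\<^sub>r B) i" by (auto simp: rows_def)
    then show "x \<in> set (rows A) \<union> set (rows B)" using r[of i] by (auto simp: rows_def)
  next
    fix x assume "x \<in> set (rows A) \<union> set (rows B)"
    then consider i where "i < dim_row A" "x = row A i" | i where "i < dim_row B" "x = row B i" by (auto simp: rows_def)
    then show "x \<in> set (rows (A @\<^sub>r B))"
    proof cases
      case 1
      then show ?thesis using r[of i] by (auto simp: rows_def intro!: image_eqI[of _ _ i])
    next
      case 2
      then show ?thesis using r[of "dim_row A + i"] by (auto simp: rows_def intro!: image_eqI[of _ _ "dim_row A + i"])
    qed
  qed
qed

lemma adjoined_rank: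
  fixes B H :: "complex mat"
  assumes B: "B \<in> carrier_mat r n" and H: "H \<in> carrier_mat r r" and j: "j < m"
    and rank: "vec_space.rank r (B\<^sup>T @\<^sub>r H\<^sup>T)\<^sup>T = r"
  shows "vec_space.rank r (block_col m n j * B\<^sup>T @\<^sub>r H\<^sup>T)\<^sup>T = r"
proof -
  have BT: "B\<^sup>T \<in> carrier_mat n r" using B by simp
  have bB: "block_col m n j * B\<^sup>T \<in> carrier_mat (m * n) r"
    using block_col_carrier[OF j] BT by (rule mult_carrier_mat)
  have 1: "(B\<^sup>T @\<^sub>r H\<^sup>T)\<^sup>T \<in> carrier_mat r (n + r)" "(block_col m n j * B\<^sup>T @\<^sub>r H\<^sup>T)\<^sup>T \<in> carrier_mat r (m * n + r)"
    using BT bB H by simp_all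
  have "set (rows B\<^sup>T) \<subseteq> set (rows (block_col m n j * B\<^sup>T))"
    unfolding block_col_mult[OF BT] using B by (auto simp: rows_append_rows)
  then have "set (cols (B\<^sup>T @\<^sub>r H\<^sup>T)\<^sup>T) \<subseteq> set (cols (block_col m n j * B\<^sup>T @\<^sub>r H\<^sup>T)\<^sup>T)"
    using B H bB by (simp add: cols_transpose rows_append_rows) blast
  from full_row_rank_mono[OF 1 this rank] show ?thesis .
qed

text \<open>Padding \<open>C\<close> by zero rows does not change the kernel of the stacked matrix, and padding
  \<open>B\<close> by zero columns only adds zero columns to the matrix formed by \<open>B\<close> and \<open>H - zK\<close>.\<close>

lemma irreducible_embed:
  assumes irr: "irreducible_system n r C B H K" and j: "j < m" and i: "i < m"
  shows "irreducible_system (m * n) r (block_col m n j * C) (B * (block_col m n i)\<^sup>T) H K"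
proof -
  have c: "C \<in> carrier_mat n r" "B \<in> carrier_mat r n" "H \<in> carrier_mat r r" "K \<in> carrier_mat r r"
    using irr by (simp_all add: irreducible_system_def)
  have bt: "(B * (block_col m n i)\<^sup>T)\<^sup>T = block_col m n i * B\<^sup>T"
    using c(2) by (subst transpose_mult_dim) (simp_all add: block_col_dim(1)[OF i] block_col_dim(2))
  have Hz: "H - z \<cdot>\<^sub>m K \<in> carrier_mat r r" for z using c by (intro carrier_matI) simp_all
  show ?thesis
    unfolding irreducible_system_def bt
    using irr stacked_rank[OF c(1) Hz j] adjoined_rank[OF c(2) Hz i] c 
      mult_carrier_mat[OF block_col_carrier[OF j] c(1)] 
      mult_carrier_mat[OF c(2) transpose_carrier_mat[THEN iffD2, OF block_col_carrier[OF i]]]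
    by (simp add: irreducible_system_def)
qed

section \<open>Kronecker products\<close>

lemma kronecker_unit_col:
  assumes C: "C \<in> carrier_mat n r" and j: "j < m"
  shows "kronecker (unit_col m (m - j)) C = block_col m n j * C"
proof (rule eq_matI)
  let ?a = "(m - 1 - j) * n"
  have d: "dim_row (unit_col m (m - j)) = m" "dim_col (unit_col m (m - j)) = 1" by (simp_all add: unit_col_def)
  have m: "m * n = ?a + (n + j * n)" using block_col_dim(1)[OF j, of n] by (simp add: block_col_def)
  show "dim_row (kronecker (unit_col m (m - j)) C) = dim_row (block_col m n j * C)"
    "dim_col (kronecker (unit_col m (m - j)) C) = dim_col (block_col m n j * C)"
    using C d by (simp_all add: kronecker_def block_col_dim(1)[OF j] block_col_dim(2))
  fix p q assume "p < dim_row (block_col m n j * C)" "q < dim_col (block_col m n j * C)"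
  then have pq: "p < m * n" "q < r" using C by (simp_all add: block_col_dim(1)[OF j] block_col_dim(2))
  then have n0: "0 < n" by (cases n) simp_all
  have pm: "p div n < m" using pq(1) by (simp add: less_mult_imp_div_less)
  have L: "kronecker (unit_col m (m - j)) C $$ (p, q) = (if p div n = m - 1 - j then C $$ (p mod n, q) else 0)"
    using pq C d pm by (simp add: kronecker_def unit_col_def mat_of_cols_index unit_vec_def)
  consider "p < ?a" | "?a \<le> p" "p < ?a + n" | "?a + n \<le> p" by linarith
  then show "kronecker (unit_col m (m - j)) C $$ (p, q) = (block_col m n j * C) $$ (p, q)"
  proof cases
    case 1
    then have "p div n < m - 1 - j" by (simp add: less_mult_imp_div_less)
    then have "p div n \<noteq> m - 1 - j" by simp
    then show ?thesis using 1 pq C m unfolding L block_col_mult[OF C] by (simp add: append_rows_index del: diff_diff_left)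
  next
    case 2
    then obtain i where i: "p = ?a + i" "i < n" by (metis le_Suc_ex nat_add_left_cancel_less)
    then have "p div n = m - 1 - j" "p mod n = i" using n0 by (simp_all del: diff_diff_left)
    then show ?thesis using i pq C m unfolding L block_col_mult[OF C] by (simp add: append_rows_index del: diff_diff_left)
  next
    case 3
    then have "(m - 1 - j + 1) * n \<le> p" by simp
    then have "m - 1 - j + 1 \<le> p div n" using n0 by (simp add: less_eq_div_iff_mult_less_eq del: diff_diff_left)
    then have "p div n \<noteq> m - 1 - j" by simp
    moreover obtain i where "p = ?a + n + i" using 3 by (metis le_Suc_ex)
    ultimately show ?thesis using pq C m unfolding L block_col_mult[OF C] by (simp add: append_rows_index del: diff_diff_left)
  qed
qed

lemma kronecker_transpose: "kronecker M\<^sup>T N = (kronecker M N\<^sup>T)\<^sup>T"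
proof (rule eq_matI)
  fix i j assume "i < dim_row (kronecker M N\<^sup>T)\<^sup>T" "j < dim_col (kronecker M N\<^sup>T)\<^sup>T"
  then have ij: "i < dim_col M * dim_row N" "j < dim_row M * dim_col N" by (simp_all add: kronecker_def)
  then have "i div dim_row N < dim_col M" "j div dim_col N < dim_row M" "i mod dim_row N < dim_row N" "j mod dim_col N < dim_col N"
    by (auto simp: less_mult_imp_div_less intro!: mod_less_divisor gr0I)
  then show "kronecker M\<^sup>T N $$ (i, j) = (kronecker M N\<^sup>T)\<^sup>T $$ (i, j)"
    using ij by (simp add: kronecker_def)
qed (simp_all add: kronecker_def)

lemma kronecker_unit_row:
  fixes B :: "complex mat"
  assumes B: "B \<in> carrier_mat r n" and j: "j < m"
  shows "kronecker (unit_col m (m - j))\<^sup>T B = B * (block_col m n j)\<^sup>T"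
proof -
  have "kronecker (unit_col m (m - j))\<^sup>T B = (block_col m n j * B\<^sup>T)\<^sup>T"
    unfolding kronecker_transpose using kronecker_unit_col[of "B\<^sup>T" n r j m] B j by simp
  also have "\<dots> = B * (block_col m n j)\<^sup>T" using B by (subst transpose_mult_dim) (simp_all add: block_col_dim)
  finally show ?thesis .
qed

section \<open>Ring homomorphisms\<close>

lemma (in comm_ring_hom) mat_hom_zero: "map_mat hom (0\<^sub>m a b) = 0\<^sub>m a b"
  by (rule eq_matI) simp_all

lemma (in comm_ring_hom) mat_hom_gelem_pos:
  assumes "X \<in> carrier_mat n n"
  shows "map_mat hom (gelem m n (PosI i) X) = gelem m n (PosI i) (map_mat hom X)"
proof -
  have "map_mat hom (four_block_mat X (1\<^sub>m n) (1\<^sub>m n) (0\<^sub>m n n)) = four_block_mat (map_mat hom X) (1\<^sub>m n) (1\<^sub>m n) (0\<^sub>m n n)"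
    using assms by (subst map_four_block_mat[where ?nr1.0 = n and ?nr2.0 = n and ?nc1.0 = n and ?nc2.0 = n])
      (simp_all add: mat_hom_one mat_hom_zero)
  then show ?thesis by (simp add: gelem.simps dsum_map mat_hom_one)
qed

lemma (in comm_ring_hom) mat_hom_pprod:
  assumes "set \<alpha> \<subseteq> {..<m}" "\<And>i. i < m \<Longrightarrow> X i \<in> carrier_mat n n"
  shows "map_mat hom (pprod m n X \<alpha>) = pprod m n (\<lambda>i. map_mat hom (X i)) \<alpha>"
  using assms(1)
proof (induction \<alpha>)
  case (Cons i \<alpha>)
  have X: "X i \<in> carrier_mat n n" using Cons.prems assms(2) by auto
  have c: "gelem m n (PosI i) (X i) \<in> carrier_mat (m * n) (m * n)" using Cons.prems by (intro gelem_pos_dim X) auto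
  have "set \<alpha> \<subseteq> {..<m}" using Cons.prems by auto
  then have d: "pprod m n X \<alpha> \<in> carrier_mat (m * n) (m * n)" by (rule pprod_carrier[OF _ assms(2)])
  show ?case using Cons mat_hom_mult[OF c d] by (simp add: pprod_Cons mat_hom_gelem_pos[OF X])
qed (simp add: mat_hom_one)

lemma (in comm_ring_hom) mat_hom_append_rows:
  "dim_col B = dim_col A \<Longrightarrow> map_mat hom (A @\<^sub>r B) = map_mat hom A @\<^sub>r map_mat hom B"
  by (rule eq_matI) (simp_all add: append_rows_index)

lemma (in comm_ring_hom) mat_hom_GL:
  assumes "coeff_ring S" "range hom \<subseteq> S" "U \<in> GL UNIV N"
  shows "map_mat hom U \<in> GL S N"
proof -
  interpret coeff_ring S by fact
  obtain V where V: "V \<in> GL UNIV N" "U * V = 1\<^sub>m N" "V * U = 1\<^sub>m N" using assms(3) by (rule GL_E)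
  note c = GL_carrier[OF assms(3)] GL_carrier[OF V(1)]
  have "map_mat hom X \<in> mats S N N" if "X \<in> carrier_mat N N" for X
    using that assms(2) by (auto simp: mats_def)
  then show ?thesis
    using mat_hom_mult[OF c] mat_hom_mult[OF c(2,1)] c unfolding V(2,3) mat_hom_one
    by (intro GL_I[of _ N "map_mat hom V"]) simp_all
qed

lemma coeff_ring_UNIV: "coeff_ring UNIV"
  by unfold_locales simp_all

interpretation const_poly: comm_ring_hom "\<lambda>c :: complex. [:c:]"
  by unfold_locales (simp_all add: one_pCons)

interpretation fract_hom: comm_ring_hom "to_fract :: complex poly \<Rightarrow> _"
  by unfold_locales simp_all

interpretation const_fract: comm_ring_hom "\<lambda>c :: complex. to_fract [:c:]"
  by unfold_locales (simp_all only: const_poly.hom_zero const_poly.hom_one const_poly.hom_add const_poly.hom_mult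
      to_fract_0 to_fract_1 to_fract_add to_fract_mult)

section \<open>Factorization of an EGFP\<close>

lemma SIP_append_left: "SIP (\<alpha> @ \<beta>) \<Longrightarrow> SIP \<alpha>"
  unfolding SIP_def
proof (intro allI impI)
  fix a b
  assume h: "\<forall>a b. a < b \<and> b < length (\<alpha> @ \<beta>) \<and> (\<alpha> @ \<beta>) ! a = (\<alpha> @ \<beta>) ! b \<longrightarrow>
     (\<exists>c. a < c \<and> c < b \<and> is_succ_index ((\<alpha> @ \<beta>) ! c) ((\<alpha> @ \<beta>) ! a))"
    and ab: "a < b \<and> b < length \<alpha> \<and> \<alpha> ! a = \<alpha> ! b"
  then obtain c where "a < c" "c < b" "is_succ_index ((\<alpha> @ \<beta>) ! c) ((\<alpha> @ \<beta>) ! a)"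
    using h[rule_format, of a b] by (auto simp: nth_append)
  then show "\<exists>c. a < c \<and> c < b \<and> is_succ_index (\<alpha> ! c) (\<alpha> ! a)"
    using ab by (intro exI[of _ c]) (simp add: nth_append)
qed

lemma SIP_append_right: "SIP (\<alpha> @ \<beta>) \<Longrightarrow> SIP \<beta>"
  by (induction \<alpha>) (auto dest: SIP_tl)

lemma SIP_rev:
  assumes "SIP \<alpha>" shows "SIP (rev \<alpha>)"
  unfolding SIP_def
proof (intro allI impI)
  fix a b
  assume ab: "a < b \<and> b < length (rev \<alpha>) \<and> rev \<alpha> ! a = rev \<alpha> ! b"
  let ?l = "length \<alpha> - 1"
  have lt: "a < length \<alpha>" "b < length \<alpha>" using ab by auto
  have o: "?l - b < ?l - a" "?l - a < length \<alpha>" using ab lt by linarith+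
  have e: "\<alpha> ! (?l - a) = \<alpha> ! (?l - b)" using ab rev_nth[OF lt(1)] rev_nth[OF lt(2)] by simp
  then obtain c where c: "?l - b < c" "c < ?l - a" "is_succ_index (\<alpha> ! c) (\<alpha> ! (?l - b))"
    using assms[unfolded SIP_def, rule_format, of "?l - b" "?l - a"] o e by metis
  then show "\<exists>c. a < c \<and> c < b \<and> is_succ_index (rev \<alpha> ! c) (rev \<alpha> ! a)"
    using ab e by (intro exI[of _ "?l - c"]) (auto simp: rev_nth)
qed

text \<open>If the successor of an index does not occur at all, then the SIP forbids the index to
  occur twice.\<close>

lemma SIP_succ_mem:
  assumes "SIP (\<alpha> @ \<beta>)" "x \<in> set \<alpha>" "x \<in> set \<beta>"
  shows "\<exists>s\<in>set \<alpha> \<union> set \<beta>. is_succ_index s x"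
proof -
  obtain a b where a: "\<alpha> = a @ x # b" using assms(2) by (meson split_list)
  obtain c d where c: "\<beta> = c @ x # d" using assms(3) by (meson split_list)
  have "SIP (a @ x # (b @ c) @ x # d)" using assms(1) a c by simp
  from SIP_between[OF this] show ?thesis using a c by auto
qed

lemma gelem_neg_transpose:
  assumes "X \<in> carrier_mat n n"
  shows "(gelem m n (NegI i) X)\<^sup>T = gelem m n (NegI i) X\<^sup>T"
proof -
  have "(four_block_mat (0\<^sub>m n n) (1\<^sub>m n) (1\<^sub>m n) X)\<^sup>T = four_block_mat (0\<^sub>m n n) (1\<^sub>m n) (1\<^sub>m n) X\<^sup>T"
    using transpose_four_block_mat[OF zero_carrier_mat one_carrier_mat one_carrier_mat assms] by simp
  then show ?thesis by (simp add: gelem.simps dsum_transpose)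
qed

lemma gelem_transpose:
  "X \<in> carrier_mat n n \<Longrightarrow> (gelem m n s X)\<^sup>T = gelem m n s X\<^sup>T"
  by (cases s) (simp_all only: gelem_pos_transpose gelem_neg_transpose)

lemma iprod_append:
  assumes "\<And>s X. (s, X) \<in> set (ps @ qs) \<Longrightarrow> gelem m n s X \<in> carrier_mat (m * n) (m * n)"
  shows "iprod m n (ps @ qs) = iprod m n ps * iprod m n qs"
  unfolding iprod_def map_append by (rule prod_mats_append) (use assms in auto)

lemma iprod_transpose:
  fixes ps :: "(index \<times> 'a :: comm_ring_1 mat) list"
  assumes "\<And>s X. (s, X) \<in> set ps \<Longrightarrow> X \<in> carrier_mat n n \<and> gelem m n s X \<in> carrier_mat (m * n) (m * n)"
  shows "(iprod m n ps)\<^sup>T = iprod m n (rev (map (\<lambda>(s, X). (s, X\<^sup>T)) ps))"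
proof -
  have "set (map (\<lambda>(s, X). gelem m n s X) ps) \<subseteq> carrier_mat (m * n) (m * n)" using assms by auto
  from prod_mats_transpose[OF this]
  have "(iprod m n ps)\<^sup>T = prod_mats (m * n) (rev (map transpose_mat (map (\<lambda>(s, X). gelem m n s X) ps)))"
    unfolding iprod_def .
  also have "map transpose_mat (map (\<lambda>(s, X). gelem m n s X) ps)
      = map (\<lambda>(s, X). gelem m n s X) (map (\<lambda>(s, X). (s, X\<^sup>T)) ps)"
    unfolding map_map
  proof (rule map_cong[OF refl])
    fix p assume p: "p \<in> set ps"
    obtain s X where sX: "p = (s, X)" by (cases p)
    then have "X \<in> carrier_mat n n" using assms[of s X] p by simp
    from gelem_transpose[OF this] show "(transpose_mat \<circ> (\<lambda>(s, X). gelem m n s X)) p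
        = ((\<lambda>(s, X). gelem m n s X) \<circ> (\<lambda>(s, X). (s, X\<^sup>T))) p"
      by (simp add: sX)
  qed
  finally show ?thesis unfolding iprod_def rev_map .
qed

lemma (in coeff_ring) iprod_GL:
  "(\<And>s X. (s, X) \<in> set ps \<Longrightarrow> gelem m n s X \<in> GL S (m * n)) \<Longrightarrow> iprod m n ps \<in> GL S (m * n)"
  unfolding iprod_def by (rule prod_mats_GL) auto

lemma pprod_eq_iprod: "pprod m n W \<alpha> = iprod m n (map (\<lambda>i. (PosI i, W i)) \<alpha>)"
  by (simp add: pprod_def iprod_def comp_def)

lemma elem_prod_eq_iprod: "elem_prod m n t X = iprod m n (zip t X)"
  unfolding elem_prod_def iprod_def using elem_mat_eq_gelem by (metis (no_types, lifting) case_prod_beta' map_eq_conv)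

lemma invertible_GL:
  fixes X :: "complex mat"
  assumes "X \<in> carrier_mat N N" "invertible_mat X" shows "X \<in> GL UNIV N"
proof -
  obtain F where "F \<in> carrier_mat N N" "X * F = 1\<^sub>m N" "F * X = 1\<^sub>m N" using invertible_mat_E[OF assms(2,1)] .
  then show ?thesis using assms(1) by (auto simp: GL_def)
qed

lemma gelem_GL_complex:
  fixes X :: "complex mat"
  assumes X: "X \<in> carrier_mat n n"
    and s: "(\<exists>i<m. s = PosI i) \<or> (\<exists>i. 0 < i \<and> i \<le> m \<and> s = NegI i)"
    and inv: "s \<in> {PosI 0, NegI m} \<Longrightarrow> invertible_mat X"
  shows "gelem m n s X \<in> GL UNIV (m * n)"
proof -
  interpret U: coeff_ring "UNIV :: complex set" by (rule coeff_ring_UNIV)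
  consider i where "0 < i" "i < m" "s = PosI i \<or> s = NegI i" | "s = PosI 0" "0 < m" | "s = NegI m" "0 < m"
    using s by (metis le_neq_implies_less gr0I)
  then show ?thesis
  proof cases
    case 1
    then show ?thesis using U.gelem_GL[of i m X n] X by auto
  next
    case 2
    have "(m - 1) * n + n = m * n" using 2 by (cases m) simp_all
    moreover have "1\<^sub>m ((m - 1) * n) \<oplus>\<^sub>d X \<in> GL UNIV ((m - 1) * n + n)"
      by (rule U.GL_dsum[OF U.GL_one invertible_GL[OF X inv]]) (simp add: 2)
    ultimately show ?thesis using 2 by (simp add: gelem.simps)
  next
    case 3
    have "n + (m - 1) * n = m * n" using 3 by (cases m) simp_all
    moreover have "X \<oplus>\<^sub>d 1\<^sub>m ((m - 1) * n) \<in> GL UNIV (n + (m - 1) * n)"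
      by (rule U.GL_dsum[OF invertible_GL[OF X inv] U.GL_one]) (simp add: 3)
    ultimately show ?thesis using 3 by (simp add: gelem.simps)
  qed
qed

lemma nonsingular_assignment_D:
  assumes "nonsingular_assignment m n t X" "(s, Y) \<in> set (zip t X)"
  shows "s \<in> set t" "Y \<in> carrier_mat n n" "s \<in> {PosI 0, NegI m} \<Longrightarrow> invertible_mat Y"
proof -
  obtain k where k: "k < length t" "k < length X" "t ! k = s" "X ! k = Y"
    using assms(2) by (auto simp: in_set_zip)
  then show "s \<in> set t" "Y \<in> carrier_mat n n" "s \<in> {PosI 0, NegI m} \<Longrightarrow> invertible_mat Y"
    using assms(1) nth_mem[of k X] nth_mem[of k t] unfolding nonsingular_assignment_def matrix_assignment_def by auto
qed

text \<open>The starting point for following the block: the part of a permutation from \<open>0\<close> on.\<close>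

lemma inversion_count_base:
  "PosI 0 \<notin> set \<beta> \<Longrightarrow> inversion_count (PosI 0 # \<beta>) 0"
  using list_emb_set[of "(=)" "[PosI (Suc 0), PosI 0]" \<beta> "PosI 0"]
  by (auto simp: inversion_count_def descent_0 descent_Suc)

lemma mem_transposed_pairs:
  "(t, X) \<in> set (rev (map (\<lambda>(s, X). (s, X\<^sup>T)) ps)) \<Longrightarrow> \<exists>X'. (t, X') \<in> set ps \<and> X = X'\<^sup>T"
  by auto

lemma sandwich_minus:
  fixes G H X Y :: "'a :: comm_ring_1 mat"
  assumes "G \<in> carrier_mat N N" "H \<in> carrier_mat N N" "X \<in> carrier_mat N N" "Y \<in> carrier_mat N N"
  shows "G * (X - Y) * H = G * X * H - G * Y * H"
  by (subst mult_minus_distrib_mat[OF assms(1,3,4)], 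
      rule minus_mult_distrib_mat[of _ N N _ _ N]) (use assms in \<open>simp_all add: mult_carrier_mat[of _ N N _ N]\<close>)

lemma sandwich_smult:
  fixes G H X :: "'a :: comm_ring_1 mat"
  assumes "G \<in> carrier_mat N N" "H \<in> carrier_mat N N" "X \<in> carrier_mat N N"
  shows "G * (a \<cdot>\<^sub>m X) * H = a \<cdot>\<^sub>m (G * X * H)"
  by (subst mult_smult_distrib[OF assms(1,3)], rule mult_smult_assoc_mat[of _ N N _ N])
     (use assms in \<open>simp_all add: mult_carrier_mat[of _ N N _ N]\<close>)

lemma EGFP_eq:
  assumes T: "elem_prod m n \<tau>1 Y1 \<in> carrier_mat N N" "elem_prod m n \<sigma>1 X1 \<in> carrier_mat N N"
      "elem_prod m n \<sigma>2 X2 \<in> carrier_mat N N" "elem_prod m n \<tau>2 Y2 \<in> carrier_mat N N"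
    and F: "fiedler_prod m n Ac \<tau> \<in> carrier_mat N N" "fiedler_prod m n Ac \<sigma> \<in> carrier_mat N N"
  shows "EGFP m n Ac \<sigma> \<tau> \<sigma>1 \<sigma>2 \<tau>1 \<tau>2 X1 X2 Y1 Y2 =
    lam \<cdot>\<^sub>m poly_mat (elem_prod m n \<tau>1 Y1 * elem_prod m n \<sigma>1 X1 * fiedler_prod m n Ac \<tau> * elem_prod m n \<sigma>2 X2 * elem_prod m n \<tau>2 Y2)
    - poly_mat (elem_prod m n \<tau>1 Y1 * elem_prod m n \<sigma>1 X1 * fiedler_prod m n Ac \<sigma> * elem_prod m n \<sigma>2 X2 * elem_prod m n \<tau>2 Y2)"
proof -
  let ?T1 = "elem_prod m n \<tau>1 Y1" and ?S1 = "elem_prod m n \<sigma>1 X1" and ?S2 = "elem_prod m n \<sigma>2 X2" and ?T2 = "elem_prod m n \<tau>2 Y2"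
  have hom: "poly_mat (?T1 * ?S1 * F * ?S2 * ?T2) = poly_mat ?T1 * poly_mat ?S1 * poly_mat F * (poly_mat ?S2 * poly_mat ?T2)"
    if "F \<in> carrier_mat N N" for F
  proof -
    note c = mult_carrier_mat[OF T(1,2)] mult_carrier_mat[OF mult_carrier_mat[OF T(1,2)] that]
      mult_carrier_mat[OF mult_carrier_mat[OF mult_carrier_mat[OF T(1,2)] that] T(3)]
    have "poly_mat (?T1 * ?S1 * F * ?S2 * ?T2) = poly_mat ?T1 * poly_mat ?S1 * poly_mat F * poly_mat ?S2 * poly_mat ?T2"
      unfolding const_poly.mat_hom_mult[OF c(3) T(4)] const_poly.mat_hom_mult[OF c(2) T(3)]
        const_poly.mat_hom_mult[OF c(1) that] const_poly.mat_hom_mult[OF T(1,2)] by (rule refl)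
    also have "\<dots> = poly_mat ?T1 * poly_mat ?S1 * poly_mat F * (poly_mat ?S2 * poly_mat ?T2)"
      by (rule mult_assoc_dim) (use T that in simp_all)
    finally show ?thesis .
  qed
  have "EGFP m n Ac \<sigma> \<tau> \<sigma>1 \<sigma>2 \<tau>1 \<tau>2 X1 X2 Y1 Y2 = (poly_mat ?T1 * poly_mat ?S1)
     * (lam \<cdot>\<^sub>m poly_mat (fiedler_prod m n Ac \<tau>) - poly_mat (fiedler_prod m n Ac \<sigma>)) * (poly_mat ?S2 * poly_mat ?T2)"
    unfolding EGFP_def by (rule mult_assoc_dim) (use T F in simp_all)
  also have "\<dots> = lam \<cdot>\<^sub>m (poly_mat ?T1 * poly_mat ?S1 * poly_mat (fiedler_prod m n Ac \<tau>) * (poly_mat ?S2 * poly_mat ?T2))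
      - poly_mat ?T1 * poly_mat ?S1 * poly_mat (fiedler_prod m n Ac \<sigma>) * (poly_mat ?S2 * poly_mat ?T2)"
  proof -
    let ?g = "poly_mat ?T1 * poly_mat ?S1" and ?h = "poly_mat ?S2 * poly_mat ?T2"
    have gh: "?g \<in> carrier_mat N N" "?h \<in> carrier_mat N N" by (rule carrier_matI; use T in simp)+
    have Fc: "poly_mat (fiedler_prod m n Ac \<tau>) \<in> carrier_mat N N" "poly_mat (fiedler_prod m n Ac \<sigma>) \<in> carrier_mat N N"
      using F by simp_all
    show ?thesis
      unfolding sandwich_minus[OF gh smult_carrier_mat[OF Fc(1)] Fc(2)] sandwich_smult[OF gh Fc(1)] by (rule refl)
  qed
  finally show ?thesis unfolding hom[OF F(1)] hom[OF F(2)] .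
qed

text \<open>An EGFP is strictly equivalent to a Fiedler pencil, in such a way that the block column and
  block row of the Fiedler pencil become the ones in the definition of an EGFP of a rational matrix. All
  factors of \<open>M_\<tau>\<close> except the one with index \<open>-m\<close> go into \<open>G\<close> and \<open>H\<close>; their inverses join \<open>M_\<sigma>\<close>.\<close>

lemma EGFP_factorization:
  assumes m: "2 \<le> m" and Ac: "\<And>i. i \<le> m \<Longrightarrow> Ac i \<in> carrier_mat n n"
    and data: "EGFP_data m n Ac \<sigma> \<tau> \<sigma>1 \<sigma>2 \<tau>1 \<tau>2 X1 X2 Y1 Y2"
    and zero: "PosI 0 \<in> set \<sigma>" and top: "NegI m \<in> set \<tau>"
  obtains p q G H j c where
    "distinct (p @ 0 # q)" "set (p @ 0 # q) = {..<m}"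
    "G \<in> GL UNIV (m * n)" "H \<in> GL UNIV (m * n)"
    "EGFP m n Ac \<sigma> \<tau> \<sigma>1 \<sigma>2 \<tau>1 \<tau>2 X1 X2 Y1 Y2 =
      lam \<cdot>\<^sub>m poly_mat (G * (Ac m \<oplus>\<^sub>d 1\<^sub>m ((m - 1) * n)) * H)
      - poly_mat (G * pprod m n (\<lambda>i. - Ac i) (p @ 0 # q) * H)"
    "j < m" "inversions 0 (\<sigma>1 @ \<sigma>) = int j"
    "G * (pprod m n (\<lambda>i. - Ac i) p * block_col m n 0) = block_col m n j"
    "c < m" "consecutions 0 (\<sigma> @ \<sigma>2) = int c"
    "H\<^sup>T * ((pprod m n (\<lambda>i. - Ac i) q)\<^sup>T * block_col m n 0) = block_col m n c"
proof -
  interpret U: coeff_ring "UNIV :: complex set" by (rule coeff_ring_UNIV)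
  let ?N = "m * n" and ?W = "\<lambda>i. - Ac i"
  obtain \<omega> where \<omega>: "distinct (\<sigma> @ \<omega>)" "set (\<sigma> @ \<omega>) = PosI ` {0..m}" "\<tau> = map neg_index \<omega>"
    using data unfolding EGFP_data_def by blast
  have sub: "set \<sigma>1 \<subseteq> set \<sigma>" "set \<sigma>2 \<subseteq> set \<sigma>" "set \<tau>1 \<subseteq> set \<tau>" "set \<tau>2 \<subseteq> set \<tau>"
    and sip: "SIP (\<sigma>1 @ \<sigma> @ \<sigma>2)" "SIP (\<tau>1 @ \<tau> @ \<tau>2)"
    and ns: "nonsingular_assignment m n \<sigma>1 X1" "nonsingular_assignment m n \<sigma>2 X2"
      "nonsingular_assignment m n \<tau>1 Y1" "nonsingular_assignment m n \<tau>2 Y2"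
    using data unfolding EGFP_data_def by blast+
  have "\<exists>s. \<sigma> = map PosI s" "\<exists>w. \<omega> = map PosI w"
    unfolding ex_map_conv using \<omega>(2) by auto
  then obtain s w where sw: "\<sigma> = map PosI s" "\<omega> = map PosI w" by blast
  have \<tau>: "\<tau> = map NegI w" unfolding \<omega>(3) sw(2) by simp
  have dist: "distinct s" "distinct w" "set s \<inter> set w = {}"
    using \<omega>(1) unfolding sw by (auto simp: distinct_map)
  have un: "set s \<union> set w = {0..m}"
  proof -
    have "PosI ` (set s \<union> set w) = PosI ` {0..m}" using \<omega>(2) unfolding sw by (simp add: image_Un)
    moreover have "inj PosI" by (rule injI) simp
    ultimately show ?thesis by (simp add: inj_image_eq_iff)
  qed
  have "0 \<in> set s" "m \<in> set w" using zero top unfolding sw \<tau> by auto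
  then obtain u v a b where s: "s = u @ 0 # v" and w: "w = a @ m # b" by (meson split_list)
  have s_lt: "i < m" if "i \<in> set s" for i
    using that un dist(3) \<open>m \<in> set w\<close> by (metis Un_iff atLeastAtMost_iff disjoint_iff le_neq_implies_less)
  have w_pos: "0 < i \<and> i \<le> m" if "i \<in> set w" for i
    using that un dist(3) \<open>0 \<in> set s\<close> by (metis Un_iff atLeastAtMost_iff disjoint_iff gr0I)
  have ab_lt: "0 < i \<and> i < m" if "i \<in> set a \<union> set b" for i
    using that w_pos[of i] dist(2) unfolding w by (cases "i = m") auto
  have u_lt: "set u \<subseteq> {..<m}" "set v \<subseteq> {..<m}" using s_lt unfolding s by auto
  have a_lt: "set (rev a) \<subseteq> {..<m}" "set (rev b) \<subseteq> {..<m}" using ab_lt by auto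
  have Wc: "?W i \<in> carrier_mat n n" if "i < m" for i using Ac[of i] that by simp
  (* rev a and rev b are the indices of the inverses of the factors that were split off on the left
     and on the right. *)
  define p q where "p = rev a @ u" and "q = v @ rev b"
  have dpq: "distinct (p @ 0 # q)"
    using dist unfolding p_def q_def s w by auto
  have spq: "set (p @ 0 # q) = {..<m}"
  proof -
    have "set (p @ 0 # q) = (set s \<union> set w) - {m}"
      using dist unfolding p_def q_def s w by auto
    also have "\<dots> = {..<m}" unfolding un by auto
    finally show ?thesis .
  qed
  define S1 S2 T1 T2 where "S1 = iprod m n (zip \<sigma>1 X1)" and "S2 = iprod m n (zip \<sigma>2 X2)"
    and "T1 = iprod m n (zip \<tau>1 Y1)" and "T2 = iprod m n (zip \<tau>2 Y2)"
  let ?neg = "\<lambda>i. gelem m n (NegI i) (Ac i)" and ?pos = "\<lambda>i. gelem m n (PosI i) (?W i)"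
  define Na Nb where "Na = prod_mats ?N (map ?neg a)" and "Nb = prod_mats ?N (map ?neg b)"
  define Pa Pb where "Pa = pprod m n ?W (rev a)" and "Pb = pprod m n ?W (rev b)"
  define Pu Pv where "Pu = pprod m n ?W u" and "Pv = pprod m n ?W v"
  define M0 where "M0 = pprod m n ?W (u @ 0 # v)"
  define DD where "DD = Ac m \<oplus>\<^sub>d 1\<^sub>m ((m - 1) * n)"
  have pos_pair: "Y \<in> carrier_mat n n \<and> (\<exists>i<m. t = PosI i)" "gelem m n t Y \<in> GL UNIV ?N"
    if "(t, Y) \<in> set (zip \<alpha> X)" "nonsingular_assignment m n \<alpha> X" "set \<alpha> \<subseteq> set \<sigma>" for t Y \<alpha> X
  proof -
    note D = nonsingular_assignment_D[OF that(2,1)]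
    have "t \<in> PosI ` set s" using D(1) that(3) sw(1) by auto
    then show 1: "Y \<in> carrier_mat n n \<and> (\<exists>i<m. t = PosI i)" using D(2) s_lt by auto
    show "gelem m n t Y \<in> GL UNIV ?N" by (rule gelem_GL_complex) (use 1 D(3) in auto)
  qed
  have neg_pair: "Y \<in> carrier_mat n n \<and> t \<in> set \<alpha> \<and> (\<exists>i\<in>set w. t = NegI i)" "gelem m n t Y \<in> GL UNIV ?N"
    if "(t, Y) \<in> set (zip \<alpha> X)" "nonsingular_assignment m n \<alpha> X" "set \<alpha> \<subseteq> set \<tau>" for t Y \<alpha> X
  proof -
    note D = nonsingular_assignment_D[OF that(2,1)]
    have "t \<in> NegI ` set w" using D(1) that(3) \<tau> by auto
    then show 1: "Y \<in> carrier_mat n n \<and> t \<in> set \<alpha> \<and> (\<exists>i\<in>set w. t = NegI i)" using D(1,2) by auto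
    show "gelem m n t Y \<in> GL UNIV ?N" by (rule gelem_GL_complex) (use 1 D(3) w_pos in auto)
  qed
  have GLs: "S1 \<in> GL UNIV ?N" "S2 \<in> GL UNIV ?N" "T1 \<in> GL UNIV ?N" "T2 \<in> GL UNIV ?N"
    unfolding S1_def S2_def T1_def T2_def
    by (rule U.iprod_GL, rule pos_pair(2), assumption, rule ns, rule sub,
        rule U.iprod_GL, rule pos_pair(2), assumption, rule ns, rule sub,
        rule U.iprod_GL, rule neg_pair(2), assumption, rule ns, rule sub,
        rule U.iprod_GL, rule neg_pair(2), assumption, rule ns, rule sub)
  have neg_GL: "?neg i \<in> GL UNIV ?N" if "i \<in> set a \<union> set b" for i
    using ab_lt[OF that] Ac[of i] by (intro U.gelem_GL) auto
  have GLn: "Na \<in> GL UNIV ?N" "Nb \<in> GL UNIV ?N"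
    unfolding Na_def Nb_def by (rule U.prod_mats_GL, use neg_GL in auto)+
  have pos_neg: "?pos i \<in> carrier_mat ?N ?N \<and> ?neg i \<in> carrier_mat ?N ?N \<and> ?pos i * ?neg i = 1\<^sub>m ?N"
    "?neg i \<in> carrier_mat ?N ?N \<and> ?pos i \<in> carrier_mat ?N ?N \<and> ?neg i * ?pos i = 1\<^sub>m ?N"
    if "i \<in> set a \<union> set b" for i
  proof -
    have i: "0 < i" "i < m" and A: "Ac i \<in> carrier_mat n n" using ab_lt[OF that] Ac by auto
    have "- (- Ac i) = Ac i" using A by (intro eq_matI) simp_all
    then show "?pos i \<in> carrier_mat ?N ?N \<and> ?neg i \<in> carrier_mat ?N ?N \<and> ?pos i * ?neg i = 1\<^sub>m ?N"
      "?neg i \<in> carrier_mat ?N ?N \<and> ?pos i \<in> carrier_mat ?N ?N \<and> ?neg i * ?pos i = 1\<^sub>m ?N"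
      using gelem_inverse[OF i Wc[OF i(2)]] gelem_pos_dim[OF i(2) Wc[OF i(2)]] gelem_neg_dim[of i m "Ac i" n] i A
      by simp_all
  qed
  have NaPa: "Na * Pa = 1\<^sub>m ?N"
    unfolding Na_def Pa_def pprod_def by (rule prod_mats_inverse[OF pos_neg(2)]) simp
  have PbNb: "Pb * Nb = 1\<^sub>m ?N"
    using prod_mats_inverse[of "rev b" ?pos ?N ?neg, OF pos_neg(1)] unfolding Nb_def Pb_def pprod_def by simp
  have s_sub: "set (u @ 0 # v) \<subseteq> {..<m}" "set (0 # v) \<subseteq> {..<m}" using s_lt unfolding s by auto
  have Pc: "Pa \<in> carrier_mat ?N ?N" "Pb \<in> carrier_mat ?N ?N" "Pu \<in> carrier_mat ?N ?N" "Pv \<in> carrier_mat ?N ?N" "M0 \<in> carrier_mat ?N ?N"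
    unfolding Pa_def Pb_def Pu_def Pv_def M0_def
    by (rule pprod_carrier[OF _ Wc], rule a_lt u_lt s_sub, assumption)+
  have DDc: "DD \<in> carrier_mat ?N ?N"
  proof -
    have "n + (m - 1) * n = m * n" using m by (cases m) simp_all
    then show ?thesis unfolding DD_def using Ac[of m] by (intro carrier_matI) simp_all
  qed
  note dims [simp] = GLs[THEN GL_carrier, THEN carrier_matD(1)] GLs[THEN GL_carrier, THEN carrier_matD(2)]
    GLn[THEN GL_carrier, THEN carrier_matD(1)] GLn[THEN GL_carrier, THEN carrier_matD(2)]
    Pc[THEN carrier_matD(1)] Pc[THEN carrier_matD(2)] DDc[THEN carrier_matD(1)] DDc[THEN carrier_matD(2)]
  have bc0: "dim_row (block_col m n 0 :: complex mat) = ?N" "dim_col (block_col m n 0 :: complex mat) = n"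
    using m by (simp_all add: block_col_dim)
  have c1: "Na * (Pa * Z) = Z" if "dim_row Z = ?N" for Z
    using that by (subst mult_assoc_dim[symmetric]) (simp_all add: NaPa left_mult_one_mat')
  have c2: "Pb * (Nb * Z) = Z" if "dim_row Z = ?N" for Z
    using that by (subst mult_assoc_dim[symmetric]) (simp_all add: PbNb left_mult_one_mat')
  define G H where "G = T1 * (S1 * Na)" and "H = Nb * (S2 * T2)"
  have GG: "G \<in> GL UNIV ?N" "H \<in> GL UNIV ?N"
    unfolding G_def H_def by (intro U.GL_mult GLs GLn)+
  have M: "pprod m n ?W (p @ 0 # q) = Pa * (M0 * Pb)"
  proof -
    have "pprod m n ?W (rev a @ ((u @ 0 # v) @ rev b)) = Pa * pprod m n ?W ((u @ 0 # v) @ rev b)"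
      unfolding Pa_def by (rule pprod_append[OF _ _ Wc]) (use a_lt s_sub in auto)
    also have "pprod m n ?W ((u @ 0 # v) @ rev b) = M0 * Pb"
      unfolding M0_def Pb_def by (rule pprod_append[OF s_sub(1) a_lt(2) Wc])
    finally show ?thesis by (simp add: p_def q_def)
  qed
  have Pp: "pprod m n ?W p = Pa * Pu"
    unfolding p_def Pa_def Pu_def by (rule pprod_append[OF a_lt(1) u_lt(1) Wc])
  have Pq: "pprod m n ?W q = Pv * Pb"
    unfolding q_def Pb_def Pv_def by (rule pprod_append[OF u_lt(2) a_lt(2) Wc])
  have F\<sigma>: "fiedler_prod m n Ac \<sigma> = M0"
  proof -
    have "map (fiedler_mat m n Ac) \<sigma> = map ?pos s"
      unfolding sw(1) map_map
      by (rule map_cong[OF refl]) (use s_lt in \<open>auto simp: elem_mat_eq_gelem simp del: elem_mat.simps\<close>)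
    then show ?thesis unfolding fiedler_prod_def M0_def pprod_def s by simp
  qed
  have F\<tau>: "fiedler_prod m n Ac \<tau> = Na * (DD * Nb)"
  proof -
    have e: "map (fiedler_mat m n Ac) \<tau> = map ?neg a @ ?neg m # map ?neg b"
    proof -
      have "map (fiedler_mat m n Ac) \<tau> = map ?neg w"
        unfolding \<tau> map_map
        by (rule map_cong[OF refl]) (use w_pos in \<open>auto simp: elem_mat_eq_gelem simp del: elem_mat.simps\<close>)
      then show ?thesis unfolding w by simp
    qed
    have nm: "?neg m = DD" by (simp add: gelem.simps DD_def)
    have "set (map ?neg a) \<subseteq> carrier_mat ?N ?N" "set (?neg m # map ?neg b) \<subseteq> carrier_mat ?N ?N"
      using pos_neg(1) DDc unfolding nm by auto
    from prod_mats_append[OF this] show ?thesis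
      unfolding fiedler_prod_def e nm by (simp add: Na_def Nb_def)
  qed
  have eq1: "elem_prod m n \<tau>1 Y1 * elem_prod m n \<sigma>1 X1 * fiedler_prod m n Ac \<sigma> * elem_prod m n \<sigma>2 X2 * elem_prod m n \<tau>2 Y2
      = G * pprod m n ?W (p @ 0 # q) * H"
    unfolding elem_prod_eq_iprod S1_def[symmetric] S2_def[symmetric] T1_def[symmetric] T2_def[symmetric] F\<sigma> M G_def H_def
    by (simp add: mult_assoc_dim c1 c2)
  have eq2: "elem_prod m n \<tau>1 Y1 * elem_prod m n \<sigma>1 X1 * fiedler_prod m n Ac \<tau> * elem_prod m n \<sigma>2 X2 * elem_prod m n \<tau>2 Y2
      = G * DD * H"
    unfolding elem_prod_eq_iprod S1_def[symmetric] S2_def[symmetric] T1_def[symmetric] T2_def[symmetric] F\<tau> G_def H_def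
    by (simp add: mult_assoc_dim)
  let ?ps = "\<lambda>\<alpha>. map (\<lambda>i. (PosI i, ?W i)) \<alpha>"
  have ps_pair: "X \<in> carrier_mat n n \<and> (\<exists>i<m. t = PosI i)" if "(t, X) \<in> set (?ps \<alpha>)" "set \<alpha> \<subseteq> {..<m}" for t X \<alpha>
    using that Wc by auto
  have pos_dim: "gelem m n t X \<in> carrier_mat ?N ?N" if "X \<in> carrier_mat n n \<and> (\<exists>i<m. t = PosI i)" for t and X :: "complex mat"
    using that gelem_pos_dim by blast
  have maps: "map fst (zip \<sigma>1 X1) = \<sigma>1" "map fst (zip \<sigma>2 X2) = \<sigma>2"
    using ns by (simp_all add: nonsingular_assignment_def matrix_assignment_def)
  have \<sigma>: "\<sigma> = map PosI u @ PosI 0 # map PosI v" unfolding sw(1) s by simp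
  have uv0: "PosI 0 \<notin> set (map PosI u)" "PosI 0 \<notin> set (map PosI v)" using dist(1) unfolding s by auto
  have mem_\<sigma>: "NegI i \<notin> set \<tau>" if "PosI i \<in> set \<sigma>" for i
    using that dist(3) unfolding sw(1) \<tau> by auto
  obtain j where j: "j < m" "inversion_count (\<sigma>1 @ \<sigma>) j" "S1 * (Pu * block_col m n 0) = block_col m n j"
  proof -
    let ?l = "zip \<sigma>1 X1 @ ?ps u"
    have pair: "X \<in> carrier_mat n n \<and> (\<exists>i<m. t = PosI i)" if "(t, X) \<in> set ?l" for t X
      using that pos_pair(1)[OF _ ns(1) sub(1), of t X] ps_pair[OF _ u_lt(1), of t X] by auto
    have mf: "map fst ?l @ (PosI 0 # map PosI v) = \<sigma>1 @ \<sigma>" unfolding \<sigma> by (simp add: maps comp_def)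
    have "SIP (\<sigma>1 @ \<sigma>)" using SIP_append_left[of "\<sigma>1 @ \<sigma>" \<sigma>2] sip(1) by simp
    then have sip': "SIP (map fst ?l @ (PosI 0 # map PosI v))" unfolding mf .
    have "0 < m" using m by simp
    from iprod_block_col[OF sip' inversion_count_base[OF uv0(2)] this pair]
    obtain j where j: "j < m" "inversion_count (\<sigma>1 @ \<sigma>) j" "iprod m n ?l * block_col m n 0 = block_col m n j"
      unfolding mf by blast
    have "iprod m n ?l = S1 * Pu"
      unfolding S1_def Pu_def pprod_eq_iprod by (rule iprod_append) (rule pos_dim[OF pair])
    then show ?thesis using j that bc0 by (simp add: mult_assoc_dim)
  qed
  obtain c where c: "c < m" "inversion_count (rev (\<sigma> @ \<sigma>2)) c" "S2\<^sup>T * (Pv\<^sup>T * block_col m n 0) = block_col m n c"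
  proof -
    let ?l = "?ps v @ zip \<sigma>2 X2"
    let ?r = "rev (map (\<lambda>(s, X). (s, X\<^sup>T)) ?l)"
    have pair: "X \<in> carrier_mat n n \<and> (\<exists>i<m. t = PosI i)" if "(t, X) \<in> set ?l" for t X
      using that pos_pair(1)[OF _ ns(2) sub(2), of t X] ps_pair[OF _ u_lt(2), of t X] by auto
    have pair': "X \<in> carrier_mat n n \<and> (\<exists>i<m. t = PosI i)" if "(t, X) \<in> set ?r" for t X
    proof -
      from mem_transposed_pairs[OF that] obtain X' where "(t, X') \<in> set ?l" "X = X'\<^sup>T" by blast
      then show ?thesis using pair[of t X'] by simp
    qed
    have "map fst (map (\<lambda>(s, X). (s, X\<^sup>T)) ?l) = map fst ?l"
      unfolding map_map by (rule map_cong[OF refl]) auto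
    then have "map fst ?r = rev (map fst ?l)" by (simp only: rev_map[symmetric])
    also have "map fst ?l = map PosI v @ \<sigma>2" by (simp add: maps comp_def)
    finally have mf: "map fst ?r @ (PosI 0 # rev (map PosI u)) = rev (\<sigma> @ \<sigma>2)" unfolding \<sigma> by simp
    have "SIP (\<sigma> @ \<sigma>2)" using SIP_append_right[of \<sigma>1 "\<sigma> @ \<sigma>2"] sip(1) by simp
    then have sip': "SIP (map fst ?r @ (PosI 0 # rev (map PosI u)))" unfolding mf by (rule SIP_rev)
    have z: "PosI 0 \<notin> set (rev (map PosI u))" using uv0(1) unfolding set_rev .
    have "0 < m" using m by simp
    from iprod_block_col[OF sip' inversion_count_base[OF z] this pair']
    obtain c where c: "c < m" "inversion_count (rev (\<sigma> @ \<sigma>2)) c" "iprod m n ?r * block_col m n 0 = block_col m n c"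
      unfolding mf by blast
    have "iprod m n ?l = Pv * S2"
      unfolding S2_def Pv_def pprod_eq_iprod by (rule iprod_append) (rule pos_dim[OF pair])
    moreover have "(iprod m n ?l)\<^sup>T = iprod m n ?r"
      by (rule iprod_transpose) (use pair pos_dim in blast)
    ultimately have "iprod m n ?r = S2\<^sup>T * Pv\<^sup>T" by (simp add: transpose_mult_dim)
    then show ?thesis using c that bc0 by (simp add: mult_assoc_dim)
  qed
  have T1j: "T1 * block_col m n j = block_col m n j"
    unfolding T1_def
  proof (rule iprod_block_col_fix[OF j(1)])
    fix t X assume tX: "(t, X) \<in> set (zip \<tau>1 Y1)"
    obtain i where i: "X \<in> carrier_mat n n" "t \<in> set \<tau>1" "i \<in> set w" "t = NegI i"
      using neg_pair(1)[OF tX ns(3) sub(3)] by blast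
    have "PosI j \<in> set \<sigma>" using inversion_count_mem[OF _ j(2), of j] sub(1) by auto
    then have nj: "NegI j \<notin> set \<tau>" by (rule mem_\<sigma>)
    have t\<tau>: "NegI i \<in> set \<tau>" using i sub by auto
    then have "j \<noteq> i" using nj by auto
    (* Each index of \<tau>1 occurs again in \<tau>, so its successor must occur as well; but the successor
       of -(j + 1) is -j, and j belongs to \<sigma>. *)
    moreover have "Suc j \<noteq> i"
    proof
      assume "Suc j = i"
      have "SIP (\<tau>1 @ \<tau>)" using SIP_append_left[of "\<tau>1 @ \<tau>" \<tau>2] sip(2) by simp
      from SIP_succ_mem[OF this, of t] i(2,4) t\<tau> obtain s' where "s' \<in> set \<tau>1 \<union> set \<tau>" "is_succ_index s' (NegI i)" by auto
      then show False using nj sub(3) \<open>Suc j = i\<close> by auto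
    qed
    ultimately show "X \<in> carrier_mat n n \<and> (\<exists>i. 0 < i \<and> i \<le> m \<and> t = NegI i \<and> j \<noteq> i \<and> Suc j \<noteq> i)"
      using i w_pos[OF i(3)] by blast
  qed
  have T2c: "T2\<^sup>T * block_col m n c = block_col m n c"
  proof -
    let ?r = "rev (map (\<lambda>(s, X). (s, X\<^sup>T)) (zip \<tau>2 Y2))"
    have "T2\<^sup>T = iprod m n ?r"
      unfolding T2_def
    proof (rule iprod_transpose)
      fix t X assume tX: "(t, X) \<in> set (zip \<tau>2 Y2)"
      show "X \<in> carrier_mat n n \<and> gelem m n t X \<in> carrier_mat ?N ?N"
        using neg_pair(1)[OF tX ns(4) sub(4)] neg_pair(2)[OF tX ns(4) sub(4), THEN GL_carrier] by blast
    qed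
    moreover have "iprod m n ?r * block_col m n c = block_col m n c"
    proof (rule iprod_block_col_fix[OF c(1)])
      fix t X assume "(t, X) \<in> set ?r"
      from mem_transposed_pairs[OF this] obtain X' where tX: "(t, X') \<in> set (zip \<tau>2 Y2)" "X = X'\<^sup>T" by blast
      obtain i where i: "X' \<in> carrier_mat n n" "t \<in> set \<tau>2" "i \<in> set w" "t = NegI i"
        using neg_pair(1)[OF tX(1) ns(4) sub(4)] by blast
      have "PosI c \<in> set \<sigma>" using inversion_count_mem[OF _ c(2), of c] sub(2) by auto
      then have nj: "NegI c \<notin> set \<tau>" by (rule mem_\<sigma>)
      have t\<tau>: "NegI i \<in> set \<tau>" using i sub by auto
      then have "c \<noteq> i" using nj by auto
      moreover have "Suc c \<noteq> i"
      proof
        assume "Suc c = i"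
        have "SIP (\<tau> @ \<tau>2)" using SIP_append_right[of \<tau>1 "\<tau> @ \<tau>2"] sip(2) by simp
        from SIP_succ_mem[OF this, of t] i(2,4) t\<tau> obtain s' where "s' \<in> set \<tau> \<union> set \<tau>2" "is_succ_index s' (NegI i)" by auto
        then show False using nj sub(4) \<open>Suc c = i\<close> by auto
      qed
      ultimately show "X \<in> carrier_mat n n \<and> (\<exists>i. 0 < i \<and> i \<le> m \<and> t = NegI i \<and> c \<noteq> i \<and> Suc c \<noteq> i)"
        using i w_pos[OF i(3)] tX(2) by auto
    qed
    ultimately show ?thesis by simp
  qed
  have x: "G * (pprod m n ?W p * block_col m n 0) = block_col m n j"
    unfolding G_def Pp using bc0 by (simp add: mult_assoc_dim c1 j(3) T1j)
  have y: "H\<^sup>T * ((pprod m n ?W q)\<^sup>T * block_col m n 0) = block_col m n c"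
  proof -
    have "H\<^sup>T * ((pprod m n ?W q)\<^sup>T * block_col m n 0) = (Pv * (Pb * (Nb * (S2 * T2))))\<^sup>T * block_col m n 0"
      unfolding H_def Pq using bc0 by (simp add: transpose_mult_dim mult_assoc_dim)
    also have "\<dots> = T2\<^sup>T * (S2\<^sup>T * (Pv\<^sup>T * block_col m n 0))"
      using bc0 by (simp add: c2 transpose_mult_dim mult_assoc_dim)
    finally show ?thesis unfolding c(3) T2c .
  qed
  have "fiedler_prod m n Ac \<tau> \<in> carrier_mat ?N ?N" "fiedler_prod m n Ac \<sigma> \<in> carrier_mat ?N ?N"
    unfolding F\<tau> F\<sigma> using Pc(5) by (simp_all add: carrier_matI)
  moreover have "elem_prod m n \<tau>1 Y1 \<in> carrier_mat ?N ?N" "elem_prod m n \<sigma>1 X1 \<in> carrier_mat ?N ?N"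
    "elem_prod m n \<sigma>2 X2 \<in> carrier_mat ?N ?N" "elem_prod m n \<tau>2 Y2 \<in> carrier_mat ?N ?N"
    unfolding elem_prod_eq_iprod S1_def[symmetric] S2_def[symmetric] T1_def[symmetric] T2_def[symmetric]
    by (rule GL_carrier, rule GLs)+
  ultimately have eq: "EGFP m n Ac \<sigma> \<tau> \<sigma>1 \<sigma>2 \<tau>1 \<tau>2 X1 X2 Y1 Y2 =
      lam \<cdot>\<^sub>m poly_mat (G * DD * H) - poly_mat (G * pprod m n ?W (p @ 0 # q) * H)"
    unfolding eq1[symmetric] eq2[symmetric] by (intro EGFP_eq)
  show thesis
    by (rule that[OF dpq spq GG eq[unfolded DD_def] j(1) inversions_eq[OF j(2)] x c(1) consecutions_eq[OF c(2)] y])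
qed

section \<open>Equivalence of the system matrices\<close>

text \<open>Regrouping the blocks of \<open>diag(I, S)\<close> for a system matrix \<open>S\<close>, so that the identity becomes
  part of the first diagonal block.\<close>

lemma dsum_four_block_mat:
  fixes P C B H :: "'a :: zero mat"
  assumes P: "P \<in> carrier_mat n n" and C: "C \<in> carrier_mat n r" and B: "B \<in> carrier_mat r n" and H: "H \<in> carrier_mat r r"
    and I: "I \<in> carrier_mat a a"
  shows "I \<oplus>\<^sub>d four_block_mat P C B H
    = four_block_mat (I \<oplus>\<^sub>d P) (0\<^sub>m a r @\<^sub>r C) (0\<^sub>m a r @\<^sub>r B\<^sup>T)\<^sup>T H" (is "?L = ?R")
proof (rule eq_matI)
  fix i j assume "i < dim_row ?R" "j < dim_col ?R"
  then have ij: "i < a + n + r" "j < a + n + r" using assms by simp_all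
  consider (1) "i < a" | (2) i' where "i = a + i'" "i' < n" | (3) i' where "i = a + n + i'" "i' < r"
    using ij by (metis add.assoc le_Suc_ex nat_add_left_cancel_less not_less)
  then show "?L $$ (i, j) = ?R $$ (i, j)"
  proof cases
    case 1
    then show ?thesis using ij assms
      by (cases "j < a"; cases "j < a + n") (simp_all add: dsum_def append_rows_index)
  next
    case 2
    consider "j < a" | j' where "j = a + j'" "j' < n" | j' where "j = a + n + j'" "j' < r"
      using ij by (metis add.assoc le_Suc_ex nat_add_left_cancel_less not_less)
    then show ?thesis using 2 assms
      by cases (simp_all add: dsum_def append_rows_index)
  next
    case 3
    consider "j < a" | j' where "j = a + j'" "j' < n" | j' where "j = a + n + j'" "j' < r"
      using ij by (metis add.assoc le_Suc_ex nat_add_left_cancel_less not_less)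
    then show ?thesis using 3 assms
      by cases (simp_all add: dsum_def append_rows_index)
  qed
qed (use assms in simp_all)

text \<open>The determinant of an invertible polynomial matrix is a unit, that is, a nonzero constant.\<close>

lemma GL_unimodular:
  fixes U :: "complex poly mat"
  assumes "U \<in> GL UNIV N" shows "unimodular U"
proof -
  obtain V where V: "V \<in> GL UNIV N" "U * V = 1\<^sub>m N" using assms by (rule GL_E)
  note c = GL_carrier[OF assms] GL_carrier[OF V(1)]
  have "det U * det V = 1" using det_mult[OF c] V(2) by simp
  then have "is_unit (det U)" by (metis dvd_triv_left)
  then obtain d where "det U = [:d:]" "is_unit d" by (auto simp: is_unit_poly_iff)
  then show ?thesis using c(1) unfolding unimodular_def by (intro conjI exI[of _ d]) auto
qed

lemma (in comm_ring_hom) mat_hom_block_col: "map_mat hom (block_col m n j) = block_col m n j"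
  by (simp add: block_col_def mat_hom_append_rows mat_hom_one mat_hom_zero)

lemma last_block_mult:
  fixes C :: "'a :: comm_ring_1 mat"
  assumes "C \<in> carrier_mat n r" shows "last_block k n * C = 0\<^sub>m (k * n) r @\<^sub>r C"
  using assms unfolding last_block_def by (simp add: append_rows_mult left_mult_one_mat')

text \<open>A correction in the last diagonal block, written in terms of the last block column.\<close>

lemma last_block_outer:
  fixes R :: "'a :: comm_ring_1 mat"
  assumes R: "R \<in> carrier_mat n n"
  shows "last_block k n * (R * (last_block k n)\<^sup>T) = 0\<^sub>m (k * n) (k * n) \<oplus>\<^sub>d R"
proof -
  have [simp]: "dim_row R = n" "dim_col R = n" using R by auto
  have "R * (last_block k n)\<^sup>T = (last_block k n * R\<^sup>T)\<^sup>T"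
    by (simp add: transpose_mult_dim)
  also have "last_block k n * R\<^sup>T = 0\<^sub>m (k * n) n @\<^sub>r R\<^sup>T"
    by (rule last_block_mult) (simp add: R)
  finally have 1: "R * (last_block k n)\<^sup>T = (0\<^sub>m (k * n) n @\<^sub>r R\<^sup>T)\<^sup>T" .
  have "(0\<^sub>m (k * n) n @\<^sub>r R\<^sup>T)\<^sup>T \<in> carrier_mat n (k * n + n)" by (rule carrier_matI) simp_all
  from last_block_mult[OF this, of k] show ?thesis unfolding 1
    by (simp only:) (rule eq_matI; simp add: append_rows_index dsum_def)
qed

lemma four_block_mat_sandwich:
  fixes U V L C B H :: "'a :: comm_ring_1 mat"
  assumes U: "U \<in> carrier_mat N N" and V: "V \<in> carrier_mat N N" and L: "L \<in> carrier_mat N N"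
    and C: "C \<in> carrier_mat N r" and B: "B \<in> carrier_mat r N" and H: "H \<in> carrier_mat r r"
  shows "four_block_mat U (0\<^sub>m N r) (0\<^sub>m r N) (1\<^sub>m r) * four_block_mat L C B H * four_block_mat V (0\<^sub>m N r) (0\<^sub>m r N) (1\<^sub>m r)
    = four_block_mat (U * L * V) (U * C) (B * V) H"
proof -
  note d [simp] = U[THEN carrier_matD(1)] U[THEN carrier_matD(2)] V[THEN carrier_matD(1)] V[THEN carrier_matD(2)]
    L[THEN carrier_matD(1)] L[THEN carrier_matD(2)] C[THEN carrier_matD(1)] C[THEN carrier_matD(2)]
    B[THEN carrier_matD(1)] B[THEN carrier_matD(2)] H[THEN carrier_matD(1)] H[THEN carrier_matD(2)]
  have c: "U * L \<in> carrier_mat N N" "U * C \<in> carrier_mat N r" by (rule carrier_matI; simp)+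
  have "four_block_mat U (0\<^sub>m N r) (0\<^sub>m r N) (1\<^sub>m r) * four_block_mat L C B H = four_block_mat (U * L) (U * C) B H"
    by (subst mult_four_block_square[OF U zero_carrier_mat zero_carrier_mat one_carrier_mat L C B H])
       (use B C H in \<open>simp add: add_zero_mat_dim left_mult_one_mat'\<close>)
  moreover have "four_block_mat (U * L) (U * C) B H * four_block_mat V (0\<^sub>m N r) (0\<^sub>m r N) (1\<^sub>m r)
     = four_block_mat (U * L * V) (U * C) (B * V) H"
    by (subst mult_four_block_square[OF c B H V zero_carrier_mat zero_carrier_mat one_carrier_mat])
       (use B C H c in \<open>simp add: add_zero_mat_dim right_mult_one_mat'\<close>)
  ultimately show ?thesis by simp
qed

text \<open>Horner's scheme at the indeterminate gives unimodular \<open>U\<close> and \<open>V\<close> for the pencil. Since they also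
  take the two block vectors to the last ones, bordering them with an identity of size \<open>r\<close> transforms the
  whole system matrix.\<close>

lemma finite_part:
  fixes Ac :: "nat \<Rightarrow> complex mat"
  assumes Ac: "\<And>i. i \<le> Suc k \<Longrightarrow> Ac i \<in> carrier_mat n n"
    and A: "A \<in> carrier_mat r r" and E: "E \<in> carrier_mat r r" and C: "C \<in> carrier_mat n r" and B: "B \<in> carrier_mat r n"
    and dist: "distinct (p @ 0 # q)" and set: "set (p @ 0 # q) = {..k}"
    and G: "G \<in> GL UNIV (Suc k * n)" and H: "H \<in> GL UNIV (Suc k * n)"
    and x: "G * (pprod (Suc k) n (\<lambda>i. - Ac i) p * last_block k n) = block_col (Suc k) n j" and j: "j < Suc k"
    and y: "H\<^sup>T * ((pprod (Suc k) n (\<lambda>i. - Ac i) q)\<^sup>T * last_block k n) = block_col (Suc k) n c" and c: "c < Suc k"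
    and L: "L = lam \<cdot>\<^sub>m poly_mat (G * (Ac (Suc k) \<oplus>\<^sub>d 1\<^sub>m (k * n)) * H) - poly_mat (G * pprod (Suc k) n (\<lambda>i. - Ac i) (p @ 0 # q) * H)"
  shows "\<exists>U\<in>GL UNIV (Suc k * n). \<exists>V\<in>GL UNIV (Suc k * n).
    diag2 U (poly_mat (1\<^sub>m r)) * system_matrix L (block_col (Suc k) n j * C) (B * (block_col (Suc k) n c)\<^sup>T) A E * diag2 V (poly_mat (1\<^sub>m r))
     = diag2 (1\<^sub>m (k * n)) (system_matrix (mat_polynomial (Suc k) n Ac) C B A E)"
proof -
  interpret R: coeff_ring "UNIV :: complex poly set" by (rule coeff_ring_UNIV)
  let ?N = "n + k * n" and ?m = "Suc k"
  let ?W = "\<lambda>i. - Ac i" and ?X = "\<lambda>i. poly_mat (- Ac i)" and ?D = "poly_mat (Ac (Suc k))"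
  let ?DD = "Ac ?m \<oplus>\<^sub>d 1\<^sub>m (k * n)" and ?M = "pprod ?m n ?W (p @ 0 # q)"
  have Wc: "?W i \<in> carrier_mat n n" if "i < ?m" for i using Ac[of i] that by simp
  have Am: "Ac ?m \<in> carrier_mat n n" using Ac by simp
  have sub: "set (p @ 0 # q) \<subseteq> {..<?m}" "set p \<subseteq> {..<?m}" "set q \<subseteq> {..<?m}"
  proof -
    show "set (p @ 0 # q) \<subseteq> {..<?m}" unfolding set by auto
    then show "set p \<subseteq> {..<?m}" "set q \<subseteq> {..<?m}" by auto
  qed
  have hp: "poly_mat (pprod ?m n ?W w) = pprod ?m n ?X w" if "set w \<subseteq> {..<?m}" for w
    by (rule const_poly.mat_hom_pprod[OF that Wc])
  have pc: "pprod ?m n ?W w \<in> carrier_mat ?N ?N" if "set w \<subseteq> {..<?m}" for w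
    using pprod_carrier[OF that Wc] by simp
  have Gc: "G \<in> carrier_mat ?N ?N" "H \<in> carrier_mat ?N ?N" using GL_carrier[OF G] GL_carrier[OF H] by simp_all
  have DDc: "?DD \<in> carrier_mat ?N ?N" using Am by (intro carrier_matI) simp_all
  have "R.fiedler_reducible k n lam ?X ?D p q"
    by (rule R.fiedler_pencil_reducible) (use Am Ac dist set in simp_all)
  then have red: "reducible_to UNIV k n (lam \<cdot>\<^sub>m (?D \<oplus>\<^sub>d 1\<^sub>m (k * n)) - pprod ?m n ?X (p @ 0 # q))
     (pprod ?m n ?X p * last_block k n) ((pprod ?m n ?X q)\<^sup>T * last_block k n) (horner k n lam ?X ?D)"
    unfolding R.fiedler_reducible_def .
  have GH: "poly_mat G \<in> GL UNIV ?N" "poly_mat H \<in> GL UNIV ?N"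
    using const_poly.mat_hom_GL[OF coeff_ring_UNIV _ G] const_poly.mat_hom_GL[OF coeff_ring_UNIV _ H] by simp_all
  let ?T = "lam \<cdot>\<^sub>m (?D \<oplus>\<^sub>d 1\<^sub>m (k * n)) - pprod ?m n ?X (p @ 0 # q)"
  have hDD: "poly_mat ?DD = ?D \<oplus>\<^sub>d 1\<^sub>m (k * n)" by (simp add: dsum_map const_poly.mat_hom_one)
  have L': "poly_mat G * ?T * poly_mat H = L"
  proof -
    have "poly_mat G * ?T * poly_mat H = lam \<cdot>\<^sub>m (poly_mat G * poly_mat ?DD * poly_mat H) - poly_mat G * poly_mat ?M * poly_mat H"
      unfolding hDD[symmetric] hp[OF sub(1), symmetric] using Gc DDc pc[OF sub(1)]
      by (simp add: sandwich_minus[of _ ?N] sandwich_smult[of _ ?N])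
    also have "poly_mat G * poly_mat ?DD * poly_mat H = poly_mat (G * ?DD * H)"
      using Gc DDc by (simp add: const_poly.mat_hom_mult[of _ ?N ?N _ ?N] mult_carrier_mat[of _ ?N ?N _ ?N])
    also have "poly_mat G * poly_mat ?M * poly_mat H = poly_mat (G * ?M * H)"
      using Gc pc[OF sub(1)] by (simp add: const_poly.mat_hom_mult[of _ ?N ?N _ ?N] mult_carrier_mat[of _ ?N ?N _ ?N])
    finally show ?thesis unfolding L .
  qed
  have lb: "poly_mat (last_block k n) = last_block k n"
    unfolding last_block_eq_block_col by (rule const_poly.mat_hom_block_col)
  have x': "poly_mat G * (pprod ?m n ?X p * last_block k n) = block_col ?m n j"
  proof -
    have "poly_mat (G * (pprod ?m n ?W p * last_block k n)) = poly_mat G * (pprod ?m n ?X p * last_block k n)"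
      using Gc pc[OF sub(2)] 
      by (simp add: const_poly.mat_hom_mult[of _ ?N ?N _ n] mult_carrier_mat[of _ ?N ?N _ n] hp[OF sub(2)] lb)
    then show ?thesis unfolding x const_poly.mat_hom_block_col by (rule sym)
  qed
  have y': "(poly_mat H)\<^sup>T * ((pprod ?m n ?X q)\<^sup>T * last_block k n) = block_col ?m n c"
  proof -
    have "poly_mat (H\<^sup>T * ((pprod ?m n ?W q)\<^sup>T * last_block k n)) = (poly_mat H)\<^sup>T * ((pprod ?m n ?X q)\<^sup>T * last_block k n)"
      using Gc pc[OF sub(3)] 
      by (simp add: const_poly.mat_hom_mult[of _ ?N ?N _ n] mult_carrier_mat[of _ ?N ?N _ n] hp[OF sub(3), symmetric] lb map_mat_transpose)
    then show ?thesis unfolding y const_poly.mat_hom_block_col by (rule sym)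
  qed
  have Z: "horner k n lam ?X ?D = mat_polynomial ?m n Ac"
  proof (rule eq_matI)
    fix a b assume "a < dim_row (mat_polynomial ?m n Ac)" "b < dim_col (mat_polynomial ?m n Ac)"
    then have ab: "a < n" "b < n" by (simp_all add: mat_polynomial_def)
    have mon: "lam ^ l * [:z:] = monom z l" for l and z :: complex by (simp add: monom_altdef)
    have "(\<Sum>l\<le>k. lam ^ l * ?X l $$ (a, b)) = (\<Sum>l\<le>k. - monom (Ac l $$ (a, b)) l)"
    proof (rule sum.cong[OF refl])
      fix l assume "l \<in> {..k}"
      then have "Ac l \<in> carrier_mat n n" using Ac by simp
      then have "lam ^ l * ?X l $$ (a, b) = lam ^ l * [:- (Ac l $$ (a, b)):]" using ab by simp
      then show "lam ^ l * ?X l $$ (a, b) = - monom (Ac l $$ (a, b)) l" unfolding mon by (simp add: minus_monom)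
    qed
    moreover have "lam ^ Suc k * ?D $$ (a, b) = monom (Ac ?m $$ (a, b)) ?m"
      using ab Am mon[of "Suc k" "Ac ?m $$ (a, b)"] by (simp del: power_Suc)
    ultimately show "horner k n lam ?X ?D $$ (a, b) = mat_polynomial ?m n Ac $$ (a, b)"
      using ab by (simp add: horner_def mat_polynomial_def sum_negf del: power_Suc)
  qed (simp_all add: horner_def mat_polynomial_def)
  have "reducible_to UNIV k n (poly_mat G * ?T * poly_mat H) (poly_mat G * (pprod ?m n ?X p * last_block k n))
     ((poly_mat H)\<^sup>T * ((pprod ?m n ?X q)\<^sup>T * last_block k n)) (horner k n lam ?X ?D)"
  proof (rule R.reducible_to_equiv[OF GH _ _ _ red])
    have q: "pprod ?m n ?X w \<in> carrier_mat ?N ?N" if "set w \<subseteq> {..<?m}" for w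
      unfolding hp[OF that, symmetric] using pc[OF that] by simp
    note qd = q[THEN carrier_matD(1)] q[THEN carrier_matD(2)]
    show "?T \<in> carrier_mat ?N ?N" by (rule carrier_matI) (use qd[OF sub(1)] Am in simp_all)
    show "pprod ?m n ?X p * last_block k n \<in> carrier_mat ?N n" by (rule carrier_matI) (use qd[OF sub(2)] in simp_all)
    show "(pprod ?m n ?X q)\<^sup>T * last_block k n \<in> carrier_mat ?N n" by (rule carrier_matI) (use qd[OF sub(3)] in simp_all)
  qed
  then obtain U V where UV: "U \<in> GL UNIV ?N" "V \<in> GL UNIV ?N" "U * L * V = 1\<^sub>m (k * n) \<oplus>\<^sub>d mat_polynomial ?m n Ac"
    "U * block_col ?m n j = last_block k n" "V\<^sup>T * block_col ?m n c = last_block k n"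
    unfolding reducible_to_def L' x' y' Z by blast
  note Uc = GL_carrier[OF UV(1)] and Vc = GL_carrier[OF UV(2)]
  have Lc: "L \<in> carrier_mat ?N ?N" 
    unfolding L by (rule carrier_matI) (use Gc in simp_all)
  let ?H = "poly_mat A - lam \<cdot>\<^sub>m poly_mat E"
  have Hc: "?H \<in> carrier_mat r r" by (rule carrier_matI) (use E in simp_all)
  have bj: "block_col ?m n i \<in> carrier_mat ?N n" if "i < ?m" for i using block_col_carrier[OF that, of n] by simp
  have pC: "poly_mat C \<in> carrier_mat n r" "poly_mat B \<in> carrier_mat r n" using C B by simp_all
  let ?C' = "block_col ?m n j * poly_mat C" and ?B' = "poly_mat B * (block_col ?m n c)\<^sup>T"
  have C': "poly_mat (block_col ?m n j * C) = ?C'"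
    using const_poly.mat_hom_mult[OF bj[OF j] C] unfolding const_poly.mat_hom_block_col .
  have B': "poly_mat (B * (block_col ?m n c)\<^sup>T) = ?B'"
    using const_poly.mat_hom_mult[OF B transpose_carrier_mat[THEN iffD2, OF bj[OF c]]] 
    unfolding map_mat_transpose[symmetric] const_poly.mat_hom_block_col .
  have CBc: "?C' \<in> carrier_mat ?N r" "?B' \<in> carrier_mat r ?N"
    using mult_carrier_mat[OF bj[OF j] pC(1)] mult_carrier_mat[OF pC(2) transpose_carrier_mat[THEN iffD2, OF bj[OF c]]] by simp_all
  have UC: "U * ?C' = 0\<^sub>m (k * n) r @\<^sub>r poly_mat C"
    using assoc_mult_mat[OF Uc bj[OF j] pC(1)] unfolding UV(4) last_block_mult[OF pC(1)] by simp
  have BV: "?B' * V = (0\<^sub>m (k * n) r @\<^sub>r (poly_mat B)\<^sup>T)\<^sup>T"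
  proof -
    have "(V\<^sup>T * (block_col ?m n c * (poly_mat B)\<^sup>T))\<^sup>T = ?B' * V"
      using carrier_matD[OF Vc] carrier_matD[OF B] 
      by (simp add: transpose_mult_dim mult_assoc_dim block_col_dim(1)[OF c] block_col_dim(2))
    moreover have "V\<^sup>T * (block_col ?m n c * (poly_mat B)\<^sup>T) = last_block k n * (poly_mat B)\<^sup>T"
      unfolding UV(5)[symmetric]
      by (rule assoc_mult_mat[symmetric, of _ ?N ?N _ n _ r]) (use Vc bj[OF c] pC in simp_all)
    ultimately show ?thesis using last_block_mult[of "(poly_mat B)\<^sup>T" n r k] pC(2) by simp
  qed
  have "diag2 U (poly_mat (1\<^sub>m r)) * system_matrix L (block_col ?m n j * C) (B * (block_col ?m n c)\<^sup>T) A E * diag2 V (poly_mat (1\<^sub>m r))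
     = four_block_mat (U * L * V) (U * ?C') (?B' * V) ?H"
  proof -
    have d: "diag2 U (poly_mat (1\<^sub>m r)) = four_block_mat U (0\<^sub>m ?N r) (0\<^sub>m r ?N) (1\<^sub>m r)"
       "diag2 V (poly_mat (1\<^sub>m r)) = four_block_mat V (0\<^sub>m ?N r) (0\<^sub>m r ?N) (1\<^sub>m r)"
      unfolding diag2_eq_dsum using Uc Vc by (simp_all add: dsum_def const_poly.mat_hom_one)
    show ?thesis unfolding d system_matrix_def C' B'
      by (rule four_block_mat_sandwich[OF Uc Vc Lc CBc Hc])
  qed
  also have "\<dots> = 1\<^sub>m (k * n) \<oplus>\<^sub>d four_block_mat (mat_polynomial ?m n Ac) (poly_mat C) (poly_mat B) ?H"
    unfolding UV(3) UC BV
    by (rule dsum_four_block_mat[symmetric, OF _ pC Hc one_carrier_mat]) (simp add: mat_polynomial_def)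
  finally show ?thesis
    using UV(1,2) unfolding diag2_eq_dsum system_matrix_def by auto
qed

section \<open>Behaviour at infinity\<close>

lemma (in coeff_ring) mats_const:
  assumes "comm_ring_hom h" "range h \<subseteq> S" "X \<in> carrier_mat a b"
  shows "map_mat h X \<in> mats S a b"
  using assms by (auto simp: mats_def)

abbreviation const_rat :: "complex mat \<Rightarrow> complex poly fract mat" where
  "const_rat M \<equiv> map_mat (\<lambda>c. to_fract [:c:]) M"

lemma rat_mat_poly_mat: "rat_mat (poly_mat M) = const_rat M"
  by (rule eq_matI) simp_all

lemma rat_mat_pencil:
  assumes "X \<in> carrier_mat a b" "Y \<in> carrier_mat a b"
  shows "rat_mat (lam \<cdot>\<^sub>m poly_mat X - poly_mat Y) = lam_rat \<cdot>\<^sub>m const_rat X - const_rat Y"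
proof (rule eq_matI)
  fix i j assume "i < dim_row (lam_rat \<cdot>\<^sub>m const_rat X - const_rat Y)" "j < dim_col (lam_rat \<cdot>\<^sub>m const_rat X - const_rat Y)"
  then have ij: "i < a" "j < b" using assms by simp_all
  have "rat_mat (lam \<cdot>\<^sub>m poly_mat X - poly_mat Y) $$ (i, j) = to_fract (lam * [:X $$ (i, j):] - [:Y $$ (i, j):])"
    using ij assms by simp
  also have "\<dots> = lam_rat * to_fract [:X $$ (i, j):] - to_fract [:Y $$ (i, j):]"
    by (simp only: to_fract_diff to_fract_mult)
  also have "\<dots> = (lam_rat \<cdot>\<^sub>m const_rat X - const_rat Y) $$ (i, j)"
    using ij assms by simp
  finally show "rat_mat (lam \<cdot>\<^sub>m poly_mat X - poly_mat Y) $$ (i, j) = (lam_rat \<cdot>\<^sub>m const_rat X - const_rat Y) $$ (i, j)" .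
qed (use assms in simp_all)

lemma minus_dsum:
  fixes A B C D :: "'a :: group_add mat"
  assumes "A \<in> carrier_mat p p" "B \<in> carrier_mat q q" "C \<in> carrier_mat p p" "D \<in> carrier_mat q q"
  shows "(A \<oplus>\<^sub>d B) - (C \<oplus>\<^sub>d D) = (A - C) \<oplus>\<^sub>d (B - D)"
proof -
  have z: "0\<^sub>m a b - 0\<^sub>m a b = (0\<^sub>m a b :: 'a mat)" for a b by (rule eq_matI) simp_all
  show ?thesis
    using minus_four_block_mat[OF assms(1) zero_carrier_mat zero_carrier_mat assms(2) assms(3) zero_carrier_mat zero_carrier_mat assms(4)] assms
    by (simp add: dsum_def z)
qed

lemma inverse_power_mult_power:
  fixes x :: "'a :: field"
  assumes "x \<noteq> 0" "l \<le> m"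
  shows "inverse (x ^ m) * x ^ l = inverse x ^ (m - l)"
  using assms by (simp add: power_inverse power_diff divide_inverse)

text \<open>The transfer function of the pencil is the pencil of the coefficients with \<open>A_0\<close> replaced by
  \<open>A_0 + F\<close>, where \<open>F\<close> is the strictly proper part of the given rational matrix. Dividing by the
  indeterminate turns it into a reversed Fiedler pencil over the proper rational functions.\<close>

lemma infinite_part:
  fixes Ac :: "nat \<Rightarrow> complex mat"
  assumes Ac: "\<And>i. i \<le> Suc k \<Longrightarrow> Ac i \<in> carrier_mat n n"
    and A: "A \<in> carrier_mat r r" and E: "E \<in> carrier_mat r r" and inv: "invertible_mat E"
    and C: "C \<in> carrier_mat n r" and B: "B \<in> carrier_mat r n"
    and dist: "distinct (p @ 0 # q)" and set: "set (p @ 0 # q) = {..k}"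
    and G: "G \<in> GL UNIV (Suc k * n)" and H: "H \<in> GL UNIV (Suc k * n)"
    and x: "G * (pprod (Suc k) n (\<lambda>i. - Ac i) p * last_block k n) = block_col (Suc k) n j" and j: "j < Suc k"
    and y: "H\<^sup>T * ((pprod (Suc k) n (\<lambda>i. - Ac i) q)\<^sup>T * last_block k n) = block_col (Suc k) n c" and c: "c < Suc k"
    and L: "L = lam \<cdot>\<^sub>m poly_mat (G * (Ac (Suc k) \<oplus>\<^sub>d 1\<^sub>m (k * n)) * H) - poly_mat (G * pprod (Suc k) n (\<lambda>i. - Ac i) (p @ 0 # q) * H)"
  shows "\<exists>U\<in>GL proper (Suc k * n). \<exists>V\<in>GL proper (Suc k * n).
    U * (inverse lam_rat \<cdot>\<^sub>m transfer_function L (block_col (Suc k) n j * C) (B * (block_col (Suc k) n c)\<^sup>T) A E) * V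
     = diag2 (1\<^sub>m (k * n)) (inverse (lam_rat ^ Suc k) \<cdot>\<^sub>m transfer_function (mat_polynomial (Suc k) n Ac) C B A E)"
proof -
  let ?N = "n + k * n" and ?m = "Suc k" and ?mu = "inverse lam_rat"
  let ?W = "\<lambda>i. - Ac i" and ?X = "\<lambda>i. const_rat (- Ac i)" and ?D = "const_rat (Ac (Suc k))"
  let ?DD = "Ac ?m \<oplus>\<^sub>d 1\<^sub>m (k * n)" and ?M = "pprod ?m n ?W (p @ 0 # q)"
  define I where "I = inv_mat (lam_rat \<cdot>\<^sub>m const_rat E - const_rat A)"
  define F where "F = const_rat C * (I * const_rat B)"
  (* The transfer function is absorbed into the coefficient with index 0. *)
  define W' where "W' = (\<lambda>i. if i = 0 then ?X 0 - F else ?X i)"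
  have lm: "?mu * lam_rat = 1" by simp
  have mu: "?mu \<in> proper" using limit_inverse_lam by (auto simp: proper_def)
  have rng: "range (\<lambda>c. to_fract [:c:]) \<subseteq> proper" using limit_const by (auto simp: proper_def)
  have const: "const_rat X \<in> mats proper a b" if "X \<in> carrier_mat a b" for X a b
    using proper.mats_const[OF const_fract.comm_ring_hom_axioms rng that] .
  have Im: "I \<in> mats proper r r"
    using resolvent_proper[OF A E inv] unfolding rat_mat_poly_mat I_def .
  have Fm: "F \<in> mats proper n n"
    unfolding F_def by (rule proper.mats_mult[OF const[OF C] proper.mats_mult[OF Im const[OF B]]])
  note Ic = mats_carrier[OF Im] and Fc = mats_carrier[OF Fm]
  have Wc: "?W i \<in> carrier_mat n n" if "i < ?m" for i using Ac[of i] that by simp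
  have Am: "Ac ?m \<in> carrier_mat n n" using Ac by simp
  have A0: "Ac 0 \<in> carrier_mat n n" using Ac by simp
  have W'm: "W' i \<in> mats proper n n" if "i \<le> k" for i
    using that Ac[of i] Fm by (auto simp: W'_def intro!: proper.mats_minus const)
  have sub: "set (p @ 0 # q) \<subseteq> {..<?m}" "set p \<subseteq> {..<?m}" "set q \<subseteq> {..<?m}" "set (0 # q) \<subseteq> {..<?m}"
  proof -
    show "set (p @ 0 # q) \<subseteq> {..<?m}" unfolding set by auto
    then show "set p \<subseteq> {..<?m}" "set q \<subseteq> {..<?m}" "set (0 # q) \<subseteq> {..<?m}" by auto
  qed
  have hp: "const_rat (pprod ?m n ?W w) = pprod ?m n ?X w" if "set w \<subseteq> {..<?m}" for w
    by (rule const_fract.mat_hom_pprod[OF that Wc])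
  have pc: "pprod ?m n ?W w \<in> carrier_mat ?N ?N" if "set w \<subseteq> {..<?m}" for w
    using pprod_carrier[OF that Wc] by simp
  define g h Pp Pq l where "g = const_rat G" and "h = const_rat H" and "Pp = pprod ?m n ?X p" and "Pq = pprod ?m n ?X q"
    and "l = (last_block k n :: complex poly fract mat)"
  define M0 M0' where "M0 = 1\<^sub>m (k * n) \<oplus>\<^sub>d ?X 0" and "M0' = 1\<^sub>m (k * n) \<oplus>\<^sub>d W' 0"
  have Gc: "G \<in> carrier_mat ?N ?N" "H \<in> carrier_mat ?N ?N" using GL_carrier[OF G] GL_carrier[OF H] by simp_all
  have DDc: "?DD \<in> carrier_mat ?N ?N" using Am by (intro carrier_matI) simp_all
  have gh: "g \<in> GL proper ?N" "h \<in> GL proper ?N"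
    using const_fract.mat_hom_GL[OF proper.coeff_ring_axioms rng G] const_fract.mat_hom_GL[OF proper.coeff_ring_axioms rng H]
    by (simp_all add: g_def h_def)
  note ghc = gh[THEN GL_carrier]
  have Ppc: "Pp \<in> carrier_mat ?N ?N" "Pq \<in> carrier_mat ?N ?N"
    unfolding Pp_def Pq_def hp[OF sub(2), symmetric] hp[OF sub(3), symmetric] using pc[OF sub(2)] pc[OF sub(3)] by simp_all
  have M0c: "M0 \<in> carrier_mat ?N ?N" "M0' \<in> carrier_mat ?N ?N"
    unfolding M0_def M0'_def using A0 mats_carrier[OF W'm[of 0]] by (intro carrier_matI; simp)+
  have lc: "l \<in> carrier_mat ?N n" by (simp add: l_def)
  note dims [simp] = ghc[THEN carrier_matD(1)] ghc[THEN carrier_matD(2)] Ppc[THEN carrier_matD(1)] Ppc[THEN carrier_matD(2)]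
    M0c[THEN carrier_matD(1)] M0c[THEN carrier_matD(2)] lc[THEN carrier_matD(1)] lc[THEN carrier_matD(2)]
    Fc[THEN carrier_matD(1)] Fc[THEN carrier_matD(2)] Ic[THEN carrier_matD(1)] Ic[THEN carrier_matD(2)]
    C[THEN carrier_matD(1)] C[THEN carrier_matD(2)] B[THEN carrier_matD(1)] B[THEN carrier_matD(2)]
  define D where "D = ?D \<oplus>\<^sub>d 1\<^sub>m (k * n)"
  have hDD: "const_rat ?DD = D" by (simp add: D_def dsum_map const_fract.mat_hom_one)
  have Dc: "D \<in> carrier_mat ?N ?N" unfolding hDD[symmetric] using DDc by simp
  have M: "const_rat ?M = Pp * (M0 * Pq)"
  proof -
    have "pprod ?m n ?W (p @ 0 # q) = pprod ?m n ?W p * pprod ?m n ?W (0 # q)"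
      by (rule pprod_append[OF sub(2,4) Wc])
    then have "const_rat ?M = Pp * const_rat (pprod ?m n ?W (0 # q))"
      using const_fract.mat_hom_mult[OF pc[OF sub(2)] pc[OF sub(4)]] by (simp add: Pp_def hp[OF sub(2)])
    then show ?thesis unfolding hp[OF sub(4)] by (simp add: pprod_Cons M0_def Pq_def gelem.simps)
  qed
  define M' where "M' = pprod ?m n W' (p @ 0 # q)"
  have M': "M' = Pp * (M0' * Pq)"
  proof -
    have W'c: "W' i \<in> carrier_mat n n" if "i < ?m" for i using mats_carrier[OF W'm[of i]] that by simp
    have nz: "0 \<notin> set p" "0 \<notin> set q" using dist by auto
    have e: "pprod ?m n W' w = pprod ?m n ?X w" if "0 \<notin> set w" for w
      unfolding pprod_def by (rule arg_cong[of _ _ "prod_mats (?m * n)"], rule map_cong[OF refl]) (use that in \<open>auto simp: W'_def\<close>)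
    have "M' = pprod ?m n W' p * pprod ?m n W' (0 # q)"
      unfolding M'_def by (rule pprod_append[OF sub(2,4) W'c])
    then show ?thesis by (simp add: pprod_Cons e[OF nz(1)] e[OF nz(2)] Pp_def Pq_def M0'_def gelem.simps)
  qed
  have lb: "const_rat (last_block k n) = l"
    unfolding last_block_eq_block_col l_def by (rule const_fract.mat_hom_block_col)
  have x': "block_col ?m n j = g * (Pp * l)"
  proof -
    have "const_rat (G * (pprod ?m n ?W p * last_block k n)) = g * (Pp * l)"
      using Gc pc[OF sub(2)] 
      by (simp add: const_fract.mat_hom_mult[of _ ?N ?N _ n] mult_carrier_mat[of _ ?N ?N _ n] hp[OF sub(2)] lb g_def Pp_def)
    then show ?thesis unfolding x const_fract.mat_hom_block_col .
  qed
  have y': "(block_col ?m n c)\<^sup>T = l\<^sup>T * (Pq * h)"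
  proof -
    have "const_rat (H\<^sup>T * ((pprod ?m n ?W q)\<^sup>T * last_block k n)) = h\<^sup>T * (Pq\<^sup>T * l)"
      using Gc pc[OF sub(3)] 
      by (simp add: const_fract.mat_hom_mult[of _ ?N ?N _ n] mult_carrier_mat[of _ ?N ?N _ n] hp[OF sub(3), symmetric] lb map_mat_transpose h_def Pq_def)
    then have "block_col ?m n c = h\<^sup>T * (Pq\<^sup>T * l)" unfolding y const_fract.mat_hom_block_col .
    then show ?thesis by (simp add: transpose_mult_dim mult_assoc_dim)
  qed
  have bj: "block_col ?m n i \<in> carrier_mat ?N n" if "i < ?m" for i using block_col_carrier[OF that, of n] by simp
  have C': "const_rat (block_col ?m n j * C) = g * (Pp * (l * const_rat C))"
    using const_fract.mat_hom_mult[OF bj[OF j] C] unfolding const_fract.mat_hom_block_col x' by (simp add: mult_assoc_dim)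
  have B': "const_rat (B * (block_col ?m n c)\<^sup>T) = const_rat B * (l\<^sup>T * (Pq * h))"
    using const_fract.mat_hom_mult[OF B transpose_carrier_mat[THEN iffD2, OF bj[OF c]]] 
    unfolding map_mat_transpose[symmetric] const_fract.mat_hom_block_col y' .
  define Y where "Y = Pp * (l * (F * l\<^sup>T)) * Pq"
  have Yc: "Y \<in> carrier_mat ?N ?N" unfolding Y_def by (rule carrier_matI) simp_all
  have MY: "const_rat ?M - Y = M'"
  proof -
    have "const_rat ?M - Y = Pp * M0 * Pq - Pp * (l * (F * l\<^sup>T)) * Pq"
      unfolding M Y_def by (simp add: mult_assoc_dim)
    also have "\<dots> = Pp * (M0 - l * (F * l\<^sup>T)) * Pq"
      by (rule sandwich_minus[symmetric, OF Ppc M0c(1)]) (rule carrier_matI; simp)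
    also have "M0 - l * (F * l\<^sup>T) = M0'"
    proof -
      have e: "l * (F * l\<^sup>T) = 0\<^sub>m (k * n) (k * n) \<oplus>\<^sub>d F" unfolding l_def by (rule last_block_outer[OF Fc])
      have "1\<^sub>m (k * n) - 0\<^sub>m (k * n) (k * n) = (1\<^sub>m (k * n) :: complex poly fract mat)"
        by (rule eq_matI) simp_all
      then show ?thesis unfolding e M0_def M0'_def W'_def using A0
        by (subst minus_dsum[where p = "k * n" and q = n]) (simp_all add: Fc)
    qed
    finally show ?thesis unfolding M' by (simp add: mult_assoc_dim)
  qed
  define TF where "TF = transfer_function L (block_col ?m n j * C) (B * (block_col ?m n c)\<^sup>T) A E"
  have M'c: "M' \<in> carrier_mat ?N ?N" unfolding M' by (rule carrier_matI) simp_all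
  have Mc: "const_rat ?M \<in> carrier_mat ?N ?N" using pc[OF sub(1)] by simp
  have TF: "?mu \<cdot>\<^sub>m TF = g * (D - ?mu \<cdot>\<^sub>m M') * h"
  proof -
    have rL: "rat_mat L = lam_rat \<cdot>\<^sub>m (g * D * h) - g * const_rat ?M * h"
    proof -
      have hom3: "const_rat (G * Q * H) = g * const_rat Q * h" if "Q \<in> carrier_mat ?N ?N" for Q
        unfolding g_def h_def const_fract.mat_hom_mult[OF mult_carrier_mat[OF Gc(1) that] Gc(2)]
          const_fract.mat_hom_mult[OF Gc(1) that] by (rule refl)
      have "rat_mat L = lam_rat \<cdot>\<^sub>m const_rat (G * ?DD * H) - const_rat (G * ?M * H)"
        unfolding L
        by (rule rat_mat_pencil[OF mult_carrier_mat[OF mult_carrier_mat[OF Gc(1) DDc] Gc(2)]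
              mult_carrier_mat[OF mult_carrier_mat[OF Gc(1) pc[OF sub(1)]] Gc(2)]])
      also have "const_rat (G * ?DD * H) = g * D * h" unfolding hom3[OF DDc] hDD by (rule refl)
      also have "const_rat (G * ?M * H) = g * const_rat ?M * h" by (rule hom3[OF pc[OF sub(1)]])
      finally show ?thesis .
    qed
    have "TF = rat_mat L + g * (Pp * (l * const_rat C)) * I * (const_rat B * (l\<^sup>T * (Pq * h)))"
      unfolding TF_def transfer_function_def rat_mat_poly_mat C' B' I_def by (rule refl)
    also have "g * (Pp * (l * const_rat C)) * I * (const_rat B * (l\<^sup>T * (Pq * h))) = g * Y * h"
      unfolding Y_def F_def by (simp add: mult_assoc_dim)
    finally have t: "TF = lam_rat \<cdot>\<^sub>m (g * D * h) - g * const_rat ?M * h + g * Y * h" unfolding rL .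
    have f1: "g * M' * h = g * const_rat ?M * h - g * Y * h"
      unfolding MY[symmetric] by (rule sandwich_minus[OF ghc Mc Yc])
    have "g * (D - ?mu \<cdot>\<^sub>m M') * h = g * D * h - g * (?mu \<cdot>\<^sub>m M') * h"
      by (rule sandwich_minus[OF ghc Dc smult_carrier_mat[OF M'c]])
    then have f2: "g * (D - ?mu \<cdot>\<^sub>m M') * h = g * D * h - ?mu \<cdot>\<^sub>m (g * M' * h)"
      unfolding sandwich_smult[OF ghc M'c] .
    have f3: "a \<cdot>\<^sub>m (b \<cdot>\<^sub>m X1 - X2 + X3) = X1 - a \<cdot>\<^sub>m (X2 - X3)"
      if "X1 \<in> carrier_mat ?N ?N" "X2 \<in> carrier_mat ?N ?N" "X3 \<in> carrier_mat ?N ?N" and ab1: "a * b = 1"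
      for X1 X2 X3 and a b :: "complex poly fract"
    proof (rule eq_matI)
      fix i i' assume "i < dim_row (X1 - a \<cdot>\<^sub>m (X2 - X3))" "i' < dim_col (X1 - a \<cdot>\<^sub>m (X2 - X3))"
      then have ij: "i < ?N" "i' < ?N" using that by simp_all
      have "a * (b * s - t + u) = (a * b) * s - a * (t - u)" for s t u :: "complex poly fract"
        by (simp add: algebra_simps)
      then have "a * (b * s - t + u) = s - a * (t - u)" for s t u :: "complex poly fract"
        unfolding ab1 by simp
      then show "(a \<cdot>\<^sub>m (b \<cdot>\<^sub>m X1 - X2 + X3)) $$ (i, i') = (X1 - a \<cdot>\<^sub>m (X2 - X3)) $$ (i, i')"
        using ij that(1-3) by simp
    qed (use that in simp_all)
    have gZh: "g * Z * h \<in> carrier_mat ?N ?N" if "Z \<in> carrier_mat ?N ?N" for Z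
      by (rule mult_carrier_mat[OF mult_carrier_mat[OF ghc(1) that] ghc(2)])
    show ?thesis unfolding t f2 f1 by (rule f3[OF gZh[OF Dc] gZh[OF Mc] gZh[OF Yc] lm])
  qed
  let ?P = "transfer_function (mat_polynomial ?m n Ac) C B A E"
  have P: "?P = rat_mat (mat_polynomial ?m n Ac) + F"
    unfolding transfer_function_def rat_mat_poly_mat F_def I_def[symmetric] by (simp add: mult_assoc_dim)
  define Z where "Z = inverse (lam_rat ^ ?m) \<cdot>\<^sub>m ?P"
  have Z: "Z = mat n n (\<lambda>ij. ?D $$ ij - (\<Sum>i\<le>k. ?mu ^ (Suc k - i) * W' i $$ ij))"
  proof (rule eq_matI)
    fix a b assume "a < dim_row (mat n n (\<lambda>ij. ?D $$ ij - (\<Sum>i\<le>k. ?mu ^ (Suc k - i) * W' i $$ ij)))"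
      "b < dim_col (mat n n (\<lambda>ij. ?D $$ ij - (\<Sum>i\<le>k. ?mu ^ (Suc k - i) * W' i $$ ij)))"
    then have ab: "a < n" "b < n" by simp_all
    define f where "f = (\<lambda>i. to_fract [:Ac i $$ (a, b):] :: complex poly fract)"
    have mon: "to_fract (monom z l) = lam_rat ^ l * to_fract [:z:]" for l z
    proof -
      have "monom z l = lam ^ l * [:z:]" by (simp add: monom_altdef)
      then show ?thesis by (simp only: to_fract_mult fract_hom.hom_power)
    qed
    have pow: "inverse (lam_rat ^ ?m) * lam_rat ^ l = ?mu ^ (?m - l)" if "l \<le> ?m" for l
      by (rule inverse_power_mult_power[OF _ that]) simp
    have "Z $$ (a, b) = inverse (lam_rat ^ ?m) * ((\<Sum>l\<le>?m. lam_rat ^ l * f l) + F $$ (a, b))"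
      using ab Fc unfolding Z_def P by (simp add: mat_polynomial_def fract_hom.hom_sum mon f_def del: power_Suc sum.atMost_Suc)
    also have "\<dots> = (\<Sum>l\<le>?m. ?mu ^ (?m - l) * f l) + ?mu ^ ?m * F $$ (a, b)"
      unfolding distrib_left sum_distrib_left power_inverse[of lam_rat ?m]
      by (rule arg_cong2[of _ _ _ _ "(+)"], rule sum.cong[OF refl]) (simp_all only: atMost_iff pow mult.assoc[symmetric])
    also have "\<dots> = f ?m + ((\<Sum>l\<le>k. ?mu ^ (?m - l) * f l) + ?mu ^ ?m * F $$ (a, b))"
      by (simp only: sum.atMost_Suc diff_self_eq_0 power_0 mult_1 add_ac)
    also have "(\<Sum>l\<le>k. ?mu ^ (?m - l) * f l) + ?mu ^ ?m * F $$ (a, b) = - (\<Sum>l\<le>k. ?mu ^ (?m - l) * W' l $$ (a, b))"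
    proof -
      have w: "W' l $$ (a, b) = (if l = 0 then - f l - F $$ (a, b) else - f l)" if "l \<le> k" for l
      proof -
        have "Ac l \<in> carrier_mat n n" using Ac[of l] that by simp
        then have "?X l $$ (a, b) = to_fract [:- (Ac l $$ (a, b)):]" "dim_row (?X l) = n" "dim_col (?X l) = n" using ab by simp_all
        moreover have "to_fract [:- z:] = - to_fract [:z:]" for z :: complex by (rule const_fract.hom_uminus)
        ultimately have X: "?X l $$ (a, b) = - f l" "dim_row (?X l) = n" "dim_col (?X l) = n" by (simp_all only: f_def)
        have "W' l = (if l = 0 then ?X l - F else ?X l)" by (simp add: W'_def)
        moreover have "(?X l - F) $$ (a, b) = ?X l $$ (a, b) - F $$ (a, b)" using ab by simp
        ultimately show ?thesis by (simp only: X split: if_split) simp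
      qed
      have "(\<Sum>l\<le>k. ?mu ^ (?m - l) * W' l $$ (a, b)) = (\<Sum>l\<le>k. - (?mu ^ (?m - l) * f l) + (if l = 0 then - (?mu ^ ?m * F $$ (a, b)) else 0))"
        by (rule sum.cong[OF refl]) (auto simp: w algebra_simps simp del: power_Suc)
      also have "\<dots> = - (\<Sum>l\<le>k. ?mu ^ (?m - l) * f l) - ?mu ^ ?m * F $$ (a, b)"
        unfolding sum.distrib sum_negf by (simp del: power_Suc)
      finally show ?thesis by simp
    qed
    finally show "Z $$ (a, b) = mat n n (\<lambda>ij. ?D $$ ij - (\<Sum>i\<le>k. ?mu ^ (Suc k - i) * W' i $$ ij)) $$ (a, b)"
      using ab Am by (simp add: f_def del: power_Suc)
  qed (simp_all add: Z_def P)
  have "\<exists>U\<in>GL proper ?N. \<exists>V\<in>GL proper ?N.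
    U * ((?D \<oplus>\<^sub>d 1\<^sub>m (k * n)) - ?mu \<cdot>\<^sub>m pprod ?m n W' (p @ 0 # q)) * V = 1\<^sub>m (k * n) \<oplus>\<^sub>d Z"
    by (rule proper.reversed_pencil_reducible[OF mu const[OF Am] W'm dist set Z])
  then obtain U V where UV: "U \<in> GL proper ?N" "V \<in> GL proper ?N" "U * (D - ?mu \<cdot>\<^sub>m M') * V = 1\<^sub>m (k * n) \<oplus>\<^sub>d Z"
    unfolding D_def[symmetric] M'_def[symmetric] by blast
  obtain g' where g': "g' \<in> GL proper ?N" "g * g' = 1\<^sub>m ?N" "g' * g = 1\<^sub>m ?N" using gh(1) by (rule GL_E)
  obtain h' where h': "h' \<in> GL proper ?N" "h * h' = 1\<^sub>m ?N" "h' * h = 1\<^sub>m ?N" using gh(2) by (rule GL_E)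
  note cc = UV(1,2)[THEN GL_carrier] g'(1)[THEN GL_carrier] h'(1)[THEN GL_carrier]
  note dims2 [simp] = cc[THEN carrier_matD(1)] cc[THEN carrier_matD(2)] Dc[THEN carrier_matD(1)] Dc[THEN carrier_matD(2)]
    M'c[THEN carrier_matD(1)] M'c[THEN carrier_matD(2)]
  have c1: "g' * (g * Q) = Q" if "dim_row Q = ?N" for Q
    using that by (subst mult_assoc_dim[symmetric]) (simp_all add: g' left_mult_one_mat')
  have c2: "h * (h' * Q) = Q" if "dim_row Q = ?N" for Q
    using that by (subst mult_assoc_dim[symmetric]) (simp_all add: h' left_mult_one_mat')
  have "U * g' * (?mu \<cdot>\<^sub>m TF) * (h' * V) = U * (D - ?mu \<cdot>\<^sub>m M') * V"
    unfolding TF by (simp add: mult_assoc_dim c1 c2)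
  then have "U * g' * (?mu \<cdot>\<^sub>m TF) * (h' * V) = diag2 (1\<^sub>m (k * n)) Z"
    unfolding UV(3) diag2_eq_dsum .
  moreover have "U * g' \<in> GL proper (?m * n)" "h' * V \<in> GL proper (?m * n)"
    using proper.GL_mult[OF UV(1) g'(1)] proper.GL_mult[OF h'(1) UV(2)] by simp_all
  ultimately show ?thesis unfolding TF_def Z_def by blast
qed

section \<open>EGFPs are Rosenbrock strong linearizations\<close>

lemma pencil_uminus:
  assumes "X \<in> carrier_mat a b" "Y \<in> carrier_mat a b"
  shows "lam \<cdot>\<^sub>m poly_mat Y - poly_mat X = poly_mat (- X) - lam \<cdot>\<^sub>m poly_mat (- Y)"
  by (rule eq_matI) (use assms in simp_all)

lemma invertible_one_mat: "invertible_mat (1\<^sub>m r)"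
  by (auto simp: invertible_mat_def inverts_mat_def intro!: exI[of _ "1\<^sub>m r"])

theorem theorem4p6:
  fixes m n r :: nat
    and Ac :: "nat \<Rightarrow> complex mat"
    and A E B C :: "complex mat"
    and \<sigma> \<tau> \<sigma>1 \<sigma>2 \<tau>1 \<tau>2 :: "index list"
    and X1 X2 Y1 Y2 :: "complex mat list"
  assumes "m \<ge> 2"
    and "\<And>i. i \<le> m \<Longrightarrow> Ac i \<in> carrier_mat n n"
    and "Ac m \<noteq> 0\<^sub>m n n"
    and "A \<in> carrier_mat r r"
    and "E \<in> carrier_mat r r"
    and "invertible_mat E"
    and "C \<in> carrier_mat n r"
    and "B \<in> carrier_mat r n"
    and "irreducible_system n r C B A E"
    and "EGFP_data m n Ac \<sigma> \<tau> \<sigma>1 \<sigma>2 \<tau>1 \<tau>2 X1 X2 Y1 Y2"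
    and "PosI 0 \<in> set \<sigma>"
    and "NegI m \<in> set \<tau>"
  shows "rosenbrock_strong_linearization m n r (mat_polynomial m n Ac) C B A E
           (EGFP_rational m n Ac C B A E \<sigma> \<tau> \<sigma>1 \<sigma>2 \<tau>1 \<tau>2 X1 X2 Y1 Y2)"
proof -
  note Ac = assms(2) and A = assms(4) and E = assms(5) and C = assms(7) and B = assms(8)
  obtain k where m: "m = Suc k" using assms(1) by (cases m) auto
  obtain p q G H j c where dist: "distinct (p @ 0 # q)" and set: "set (p @ 0 # q) = {..<m}"
    and G: "G \<in> GL UNIV (m * n)" and H: "H \<in> GL UNIV (m * n)"
    and L: "EGFP m n Ac \<sigma> \<tau> \<sigma>1 \<sigma>2 \<tau>1 \<tau>2 X1 X2 Y1 Y2 =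
      lam \<cdot>\<^sub>m poly_mat (G * (Ac m \<oplus>\<^sub>d 1\<^sub>m ((m - 1) * n)) * H)
      - poly_mat (G * pprod m n (\<lambda>i. - Ac i) (p @ 0 # q) * H)"
    and j: "j < m" and inv: "inversions 0 (\<sigma>1 @ \<sigma>) = int j"
    and x: "G * (pprod m n (\<lambda>i. - Ac i) p * block_col m n 0) = block_col m n j"
    and c: "c < m" and cons: "consecutions 0 (\<sigma> @ \<sigma>2) = int c"
    and y: "H\<^sup>T * ((pprod m n (\<lambda>i. - Ac i) q)\<^sup>T * block_col m n 0) = block_col m n c"
    using EGFP_factorization[OF assms(1) Ac assms(10-12)] by blast
  define L where "L = EGFP m n Ac \<sigma> \<tau> \<sigma>1 \<sigma>2 \<tau>1 \<tau>2 X1 X2 Y1 Y2"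
  define X Y where "X = - (G * pprod m n (\<lambda>i. - Ac i) (p @ 0 # q) * H)"
    and "Y = - (G * (Ac m \<oplus>\<^sub>d 1\<^sub>m ((m - 1) * n)) * H)"
  let ?C = "block_col m n j * C" and ?B = "B * (block_col m n c)\<^sup>T"
  have set': "set (p @ 0 # q) = {..k}" unfolding set m by auto
  have Gd [simp]: "dim_row G = m * n" "dim_col G = m * n" "dim_row H = m * n" "dim_col H = m * n"
    using GL_carrier[OF G] GL_carrier[OF H] by auto
  have XY: "X \<in> carrier_mat (m * n) (m * n)" "Y \<in> carrier_mat (m * n) (m * n)"
    unfolding X_def Y_def by (rule carrier_matI; simp)+
  have LXY: "L = poly_mat X - lam \<cdot>\<^sub>m poly_mat Y"
    unfolding L_def L X_def Y_def
    by (rule pencil_uminus[where a = "m * n" and b = "m * n"]; rule carrier_matI; simp)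
  have LL: "EGFP_rational m n Ac C B A E \<sigma> \<tau> \<sigma>1 \<sigma>2 \<tau>1 \<tau>2 X1 X2 Y1 Y2 = system_matrix L ?C ?B A E"
  proof -
    have nat: "nat (int m - int i) = m - i" for i by (simp add: nat_diff_distrib')
    show ?thesis
      unfolding EGFP_rational_def inv cons nat kronecker_unit_col[OF C j] kronecker_unit_row[OF B c] L_def
      by (rule refl)
  qed
  have irr: "irreducible_system (m * n) r ?C ?B A E" by (rule irreducible_embed[OF assms(9) j c])
  have one: "1\<^sub>m r \<in> carrier_mat r r" "invertible_mat (1\<^sub>m r :: complex mat)"
    by (simp, rule invertible_one_mat)
  have L': "L = lam \<cdot>\<^sub>m poly_mat (G * (Ac (Suc k) \<oplus>\<^sub>d 1\<^sub>m (k * n)) * H)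
      - poly_mat (G * pprod (Suc k) n (\<lambda>i. - Ac i) (p @ 0 # q) * H)"
    unfolding L_def L unfolding m by simp
  note x' = x[unfolded m last_block_eq_block_col[symmetric]] and y' = y[unfolded m last_block_eq_block_col[symmetric]]
  obtain U V where UV: "U \<in> GL UNIV (m * n)" "V \<in> GL UNIV (m * n)"
    "diag2 U (poly_mat (1\<^sub>m r)) * system_matrix L ?C ?B A E * diag2 V (poly_mat (1\<^sub>m r))
      = diag2 (1\<^sub>m ((m - 1) * n)) (system_matrix (mat_polynomial m n Ac) C B A E)"
    using finite_part[OF Ac[unfolded m] A E C B dist set' G[unfolded m] H[unfolded m] x' j[unfolded m] y' c[unfolded m] L']
    unfolding m by auto
  obtain Ol Or where O: "Ol \<in> GL proper (m * n)" "Or \<in> GL proper (m * n)"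
    "Ol * (inverse lam_rat \<cdot>\<^sub>m transfer_function L ?C ?B A E) * Or
      = diag2 (1\<^sub>m ((m - 1) * n)) (inverse (lam_rat ^ m) \<cdot>\<^sub>m transfer_function (mat_polynomial m n Ac) C B A E)"
    using infinite_part[OF Ac[unfolded m] A E assms(6) C B dist set' G[unfolded m] H[unfolded m] x' j[unfolded m] y' c[unfolded m] L']
    unfolding m by auto
  have a: "\<exists>U V U0 V0. U \<in> carrier_mat (m * n) (m * n) \<and> unimodular U \<and>
      V \<in> carrier_mat (m * n) (m * n) \<and> unimodular V \<and>
      U0 \<in> carrier_mat r r \<and> invertible_mat U0 \<and> V0 \<in> carrier_mat r r \<and> invertible_mat V0 \<and>
      diag2 U (poly_mat U0) * system_matrix L ?C ?B A E * diag2 V (poly_mat V0)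
        = diag2 (1\<^sub>m ((m - 1) * n)) (system_matrix (mat_polynomial m n Ac) C B A E)"
    using GL_carrier[OF UV(1)] GL_unimodular[OF UV(1)] GL_carrier[OF UV(2)] GL_unimodular[OF UV(2)] one UV(3)
    by blast
  have b: "\<exists>Ol Or. Ol \<in> carrier_mat (m * n) (m * n) \<and> biproper Ol \<and>
      Or \<in> carrier_mat (m * n) (m * n) \<and> biproper Or \<and>
      Ol * (inverse lam_rat \<cdot>\<^sub>m transfer_function L ?C ?B A E) * Or
        = diag2 (1\<^sub>m ((m - 1) * n)) (inverse (lam_rat ^ m) \<cdot>\<^sub>m transfer_function (mat_polynomial m n Ac) C B A E)"
    using GL_carrier[OF O(1)] GL_proper_biproper[OF O(1)] GL_carrier[OF O(2)] GL_proper_biproper[OF O(2)] O(3)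
    by blast
  show ?thesis
    unfolding rosenbrock_strong_linearization_def LL
    by (rule exI[of _ X], rule exI[of _ Y], rule exI[of _ ?C], rule exI[of _ ?B], rule exI[of _ A], rule exI[of _ E])
       (use XY irr a b LXY in simp)
qed

end
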